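(* Let $z_j=iy_j$ ($j\ge1$) with $y_j>0$, $y_{j+1}>y_j$ for all $j\ge 1$ and $\lim_{j\to\infty}y_j=+\infty$, and let $\{w_j\}_{j\ge1}\subset\mathbb{C}^{m\times m}$. Suppose that all truncated matrix Nevanlinna--Pick problems $w(z_j)=w_j$, $1\le j\le n$, $w\in\mathcal{R}_m$ ($n\ge1$) are completely indeterminate, i.e. $\mathbf{P}_n>O$ for every $n\ge1$. Let $(P_j)$ and $(Q_j)$ be the associated sequences of rational matrix functions of the first and second kind (see context). Then the problem ($w\in\mathcal{R}_m$, $w(z_j)=w_j$ for all $j\in\mathbb{N}$) is completely indeterminate if and only if both matrix series $$\sum_{j=1}^{\infty}P_j^*(0)P_j(0),\qquad\sum_{j=1}^{\infty}Q_j^*(0)Q_j(0)$$ converge.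
   Context: Notation: $m\ge 1$ is fixed; $\mathbb{C}_+=\{\operatorname{Im}z>0\}$; $A^*$ is the conjugate transpose; for Hermitian matrices $A\ge B$ ($A>B$) means $A-B$ is positive semidefinite (positive definite). Convergence of matrices is entrywise. $\mathcal{R}_m$ is the set of holomorphic $w:\mathbb{C}_+\to\mathbb{C}^{m\times m}$ with $\frac{w(z)-w(z)^*}{2i}\ge O$ for all $z\in\mathbb{C}_+$. Data: nodes $z_j\in\mathbb{C}_+$ and values $w_j\in\mathbb{C}^{m\times m}$ ($j\ge1$); $\mathcal{Z}=\{z_j\}_{j\ge1}$. Let $\mathcal{F}$ be the set of all $w\in\mathcal{R}_m$ with $w(z_j)=w_j$ for all $j\ge1$. Block matrices: $T_n=\operatorname{diag}(z_1^{-1}I_m,\dots,z_n^{-1}I_m)$, $v_n=\operatorname{col}(I_m,\dots,I_m)\in\mathbb{C}^{nm\times m}$, $u_n=\operatorname{col}(w_1,\dots,w_n)$, $R_{T_n}(z)=(I-zT_n)^{-1}$, and the Pick matrix $\mathbf{P}_n=T_n^{-1}\Big(\frac{w_j-w_k^*}{z_j-\bar z_k}\Big)_{j,k=1}^nT_n^{-*}$, where $T_n^{-*}=(T_n^{-1})^*$. The $n$-th truncated problem is called completely indeterminate when $\mathbf{P}_n>O$. For $j>1$ write $\mathbf{P}_j=\begin{pmatrix}\mathbf{P}_{j-1}&B_j\\ B_j^*&C_j\end{pmatrix}$ with $C_j\in\mathbb{C}^{m\times m}$; $\widehat K_1=\mathbf{P}_1$, $\widehat K_j=C_j-B_j^*\mathbf{P}_{j-1}^{-1}B_j$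 for $j>1$ (these are positive definite). Rational matrix functions of the first and second kind: $P_1(z)=\widehat K_1^{-1/2}R_{T_1}(z)v_1$, $Q_1(z)=-\widehat K_1^{-1/2}R_{T_1}(z)u_1$, and for $j>1$: $P_j(z)=\widehat K_j^{-1/2}(-B_j^*\mathbf{P}_{j-1}^{-1},\,I)R_{T_j}(z)v_j$, $Q_j(z)=-\widehat K_j^{-1/2}(-B_j^*\mathbf{P}_{j-1}^{-1},\,I)R_{T_j}(z)u_j$. Complete indeterminacy of the full problem: when all $\mathbf{P}_n>O$, for $z_0\in\mathbb{C}_+\setminus\mathcal{Z}$ the set $\{w(z_0):w\in\mathcal{F}\}$ is a matrix ball $\{c(z_0)+r(z_0)V\rho(z_0):V\in\mathbb{C}^{m\times m},\,V^*V\le I_m\}$ with $c(z_0)\in\mathbb{C}^{m\times m}$ and semi-radii $r(z_0)\ge O$, $\rho(z_0)\ge O$ (limits of the centers and positive definite semi-radii of the analogous balls for the truncated problems). The full problem is called completely indeterminate if $\operatorname{rank}r(z_0)=\operatorname{rank}\rho(z_0)=m$; it is known that this does not depend on the choice of $z_0\in\mathbb{C}_+\setminus\mathcal{Z}$. *)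

theory Defs
  imports
    "HOL-Complex_Analysis.Complex_Analysis"
    "Jordan_Normal_Form.Schur_Decomposition"
    "Jordan_Normal_Form.Gauss_Jordan_Elimination"
    "Jordan_Normal_Form.DL_Rank"
begin

text \<open>
  All matrices are of type \<^typ>\<open>complex mat\<close>, so that the block matrices of varying size \<open>n * m\<close>
  live in one type. Nodes \<open>z j\<close>, values \<open>W j\<close> and the rational functions are indexed by
  \<open>j \<ge> 1\<close>; whatever these sequences do at index \<open>0\<close> is never used.
\<close>

definition upper_half :: "complex set" where
  "upper_half = {z. 0 < Im z}"

text \<open>For \<open>v \<in> carrier_vec n\<close>, \<open>(A *\<^sub>v v) \<bullet>c v\<close> is the number \<open>v\<^sup>* A v\<close>; it is real
  for Hermitian \<open>A\<close>.\<close>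

definition hermitian_mat :: "nat \<Rightarrow> complex mat \<Rightarrow> bool" where
  "hermitian_mat n A \<longleftrightarrow> A \<in> carrier_mat n n \<and> mat_adjoint A = A"

definition psd_mat :: "nat \<Rightarrow> complex mat \<Rightarrow> bool" where
  "psd_mat n A \<longleftrightarrow> hermitian_mat n A \<and>
     (\<forall>v \<in> carrier_vec n. 0 \<le> Re ((A *\<^sub>v v) \<bullet>c v))"

definition pd_mat :: "nat \<Rightarrow> complex mat \<Rightarrow> bool" where
  "pd_mat n A \<longleftrightarrow> hermitian_mat n A \<and>
     (\<forall>v \<in> carrier_vec n. v \<noteq> 0\<^sub>v n \<longrightarrow> 0 < Re ((A *\<^sub>v v) \<bullet>c v))"

text \<open>The inverse of an invertible matrix; arbitrary for a singular one.\<close>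

definition minv :: "complex mat \<Rightarrow> complex mat" where
  "minv A = the (mat_inverse A)"

text \<open>\<open>A\<^bsup>-1/2\<^esup>\<close> for positive definite \<open>A\<close>: the unique positive definite square root of
  \<open>A\<^bsup>-1\<^esup>\<close>.\<close>

definition inv_sqrt_mat :: "nat \<Rightarrow> complex mat \<Rightarrow> complex mat" where
  "inv_sqrt_mat n A = (THE S. pd_mat n S \<and> S * S = minv A)"

definition mat_tendsto :: "nat \<Rightarrow> (nat \<Rightarrow> complex mat) \<Rightarrow> complex mat \<Rightarrow> bool" where
  "mat_tendsto m A L \<longleftrightarrow> (\<forall>a<m. \<forall>b<m. (\<lambda>n. A n $$ (a, b)) \<longlonglongrightarrow> L $$ (a, b))"

text \<open>Entrywise convergence of \<open>\<Sum>j\<ge>1. A j\<close>; the shift discards index \<open>0\<close>.\<close>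

definition mat_series_converges :: "nat \<Rightarrow> (nat \<Rightarrow> complex mat) \<Rightarrow> bool" where
  "mat_series_converges m A \<longleftrightarrow> (\<forall>a<m. \<forall>b<m. summable (\<lambda>j. A (Suc j) $$ (a, b)))"


definition nevanlinna_class :: "nat \<Rightarrow> (complex \<Rightarrow> complex mat) set" where
  "nevanlinna_class m = {w.
     (\<forall>z \<in> upper_half. w z \<in> carrier_mat m m) \<and>
     (\<forall>a<m. \<forall>b<m. (\<lambda>z. w z $$ (a, b)) holomorphic_on upper_half) \<and>
     (\<forall>z \<in> upper_half. psd_mat m ((1 / (2 * \<i>)) \<cdot>\<^sub>m (w z - mat_adjoint (w z))))}"

definition np_solutions ::
  "nat \<Rightarrow> (nat \<Rightarrow> complex) \<Rightarrow> (nat \<Rightarrow> complex mat) \<Rightarrow> (complex \<Rightarrow> complex mat) set" where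
  "np_solutions m z W = {w \<in> nevanlinna_class m. \<forall>j\<ge>1. w (z j) = W j}"

definition np_solutions_trunc ::
  "nat \<Rightarrow> (nat \<Rightarrow> complex) \<Rightarrow> (nat \<Rightarrow> complex mat) \<Rightarrow> nat \<Rightarrow> (complex \<Rightarrow> complex mat) set" where
  "np_solutions_trunc m z W n = {w \<in> nevanlinna_class m. \<forall>j. 1 \<le> j \<and> j \<le> n \<longrightarrow> w (z j) = W j}"


text \<open>The matrix with \<open>r \<times> c\<close> blocks \<open>F j k\<close> of size \<open>m \<times> m\<close>, where
  \<open>1 \<le> j \<le> r\<close> and \<open>1 \<le> k \<le> c\<close>.\<close>

definition block_mat :: "nat \<Rightarrow> nat \<Rightarrow> nat \<Rightarrow> (nat \<Rightarrow> nat \<Rightarrow> complex mat) \<Rightarrow> complex mat" where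
  "block_mat m r c F =
     mat (r * m) (c * m) (\<lambda>(i, k). F (Suc (i div m)) (Suc (k div m)) $$ (i mod m, k mod m))"

definition T_mat :: "nat \<Rightarrow> (nat \<Rightarrow> complex) \<Rightarrow> nat \<Rightarrow> complex mat" where
  "T_mat m z n = block_mat m n n (\<lambda>j k. if j = k then inverse (z j) \<cdot>\<^sub>m 1\<^sub>m m else 0\<^sub>m m m)"

definition v_mat :: "nat \<Rightarrow> nat \<Rightarrow> complex mat" where
  "v_mat m n = block_mat m n 1 (\<lambda>j _. 1\<^sub>m m)"

definition u_mat :: "nat \<Rightarrow> (nat \<Rightarrow> complex mat) \<Rightarrow> nat \<Rightarrow> complex mat" where
  "u_mat m W n = block_mat m n 1 (\<lambda>j _. W j)"

definition R_mat :: "nat \<Rightarrow> (nat \<Rightarrow> complex) \<Rightarrow> nat \<Rightarrow> complex \<Rightarrow> complex mat" where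
  "R_mat m z n x = minv (1\<^sub>m (n * m) - x \<cdot>\<^sub>m T_mat m z n)"

definition pick_mat ::
  "nat \<Rightarrow> (nat \<Rightarrow> complex) \<Rightarrow> (nat \<Rightarrow> complex mat) \<Rightarrow> nat \<Rightarrow> complex mat" where
  "pick_mat m z W n =
     minv (T_mat m z n)
     * block_mat m n n (\<lambda>j k. (1 / (z j - cnj (z k))) \<cdot>\<^sub>m (W j - mat_adjoint (W k)))
     * mat_adjoint (minv (T_mat m z n))"

definition B_mat ::
  "nat \<Rightarrow> (nat \<Rightarrow> complex) \<Rightarrow> (nat \<Rightarrow> complex mat) \<Rightarrow> nat \<Rightarrow> complex mat" where
  "B_mat m z W j =
     (case split_block (pick_mat m z W j) ((j - 1) * m) ((j - 1) * m) of (_, B, _, _) \<Rightarrow> B)"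

definition C_mat ::
  "nat \<Rightarrow> (nat \<Rightarrow> complex) \<Rightarrow> (nat \<Rightarrow> complex mat) \<Rightarrow> nat \<Rightarrow> complex mat" where
  "C_mat m z W j =
     (case split_block (pick_mat m z W j) ((j - 1) * m) ((j - 1) * m) of (_, _, _, C) \<Rightarrow> C)"

definition K_hat ::
  "nat \<Rightarrow> (nat \<Rightarrow> complex) \<Rightarrow> (nat \<Rightarrow> complex mat) \<Rightarrow> nat \<Rightarrow> complex mat" where
  "K_hat m z W j =
     (if j = 1 then pick_mat m z W 1
      else C_mat m z W j
           - mat_adjoint (B_mat m z W j) * minv (pick_mat m z W (j - 1)) * B_mat m z W j)"

text \<open>The block row \<open>(-B\<^sub>j\<^sup>* P\<^bsub>j-1\<^esub>\<^bsup>-1\<^esup>, I)\<close> for \<open>j > 1\<close>, written as a four-block matrix with an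
  empty lower half; it is the identity for \<open>j = 1\<close>.\<close>

definition L_row ::
  "nat \<Rightarrow> (nat \<Rightarrow> complex) \<Rightarrow> (nat \<Rightarrow> complex mat) \<Rightarrow> nat \<Rightarrow> complex mat" where
  "L_row m z W j =
     (if j = 1 then 1\<^sub>m m
      else four_block_mat
             (- (mat_adjoint (B_mat m z W j) * minv (pick_mat m z W (j - 1)))) (1\<^sub>m m)
             (0\<^sub>m 0 ((j - 1) * m)) (0\<^sub>m 0 m))"

definition P_fun ::
  "nat \<Rightarrow> (nat \<Rightarrow> complex) \<Rightarrow> (nat \<Rightarrow> complex mat) \<Rightarrow> nat \<Rightarrow> complex \<Rightarrow> complex mat" where
  "P_fun m z W j x =
     inv_sqrt_mat m (K_hat m z W j) * L_row m z W j * R_mat m z j x * v_mat m j"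

definition Q_fun ::
  "nat \<Rightarrow> (nat \<Rightarrow> complex) \<Rightarrow> (nat \<Rightarrow> complex mat) \<Rightarrow> nat \<Rightarrow> complex \<Rightarrow> complex mat" where
  "Q_fun m z W j x =
     - (inv_sqrt_mat m (K_hat m z W j) * L_row m z W j * R_mat m z j x * u_mat m W j)"


definition matrix_ball :: "nat \<Rightarrow> complex mat \<Rightarrow> complex mat \<Rightarrow> complex mat \<Rightarrow> complex mat set" where
  "matrix_ball m c r \<rho> =
     {c + r * V * \<rho> | V. V \<in> carrier_mat m m \<and> psd_mat m (1\<^sub>m m - mat_adjoint V * V)}"

text \<open>\<open>c\<close>, \<open>r\<close>, \<open>\<rho>\<close> are a center and semi-radii of the ball of values at \<open>z0\<close> of the full problem,
  obtained as limits of centers and positive definite semi-radii for the truncated problems.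
  A ball determines its semi-radii only up to \<open>(r, \<rho>) \<mapsto> (t r, \<rho> / t)\<close> with \<open>t > 0\<close>
  (and less sharply if it is a single point), hence a relation and not a function.\<close>

definition limit_ball_data ::
  "nat \<Rightarrow> (nat \<Rightarrow> complex) \<Rightarrow> (nat \<Rightarrow> complex mat) \<Rightarrow> complex
     \<Rightarrow> complex mat \<Rightarrow> complex mat \<Rightarrow> complex mat \<Rightarrow> bool" where
  "limit_ball_data m z W z0 c r \<rho> \<longleftrightarrow>
     c \<in> carrier_mat m m \<and> psd_mat m r \<and> psd_mat m \<rho> \<and>
     (\<lambda>w. w z0) ` np_solutions m z W = matrix_ball m c r \<rho> \<and>
     (\<exists>cn rn \<rho>n.
        (\<forall>n\<ge>1. cn n \<in> carrier_mat m m \<and> pd_mat m (rn n) \<and> pd_mat m (\<rho>n n) \<and>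
           (\<lambda>w. w z0) ` np_solutions_trunc m z W n = matrix_ball m (cn n) (rn n) (\<rho>n n)) \<and>
        mat_tendsto m cn c \<and> mat_tendsto m rn r \<and> mat_tendsto m \<rho>n \<rho>)"

text \<open>Complete indeterminacy of the full problem, tested at the point \<open>z0\<close>. Whether both
  semi-radii have rank \<open>m\<close> is the same for every choice of \<open>c\<close>, \<open>r\<close>, \<open>\<rho>\<close>: it says that
  the ball of values has nonempty interior.\<close>

definition completely_indeterminate_at ::
  "nat \<Rightarrow> (nat \<Rightarrow> complex) \<Rightarrow> (nat \<Rightarrow> complex mat) \<Rightarrow> complex \<Rightarrow> bool" where
  "completely_indeterminate_at m z W z0 \<longleftrightarrow>
     (\<exists>c r \<rho>. limit_ball_data m z W z0 c r \<rho> \<and> vec_space.rank m r = m \<and> vec_space.rank m \<rho> = m)"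

end

theory Submission
  imports Defs "Jordan_Normal_Form.Spectral_Radius" "HOL-Real_Asymp.Real_Asymp"
begin

text \<open>For families \<open>f\<close>, \<open>g\<close> of matrices with the indices \<open>j = 1, 2, ...\<close> let \<open>Gram n f g\<close> be
  \<open>col(f)\<^sup>* P\<^sub>n\<^sup>-\<^sup>1 col(g)\<close>, the form of the inverse Pick matrix. A Schur complement splits off the last
  node: \<open>Gram (n + 1) f g = Gram n f g + (hat n f)\<^sup>* (hat n g)\<close> (\<open>Gram_Suc\<close>), and at the origin the
  rational functions of the first and second kind are exactly \<open>hat n 1\<close> and \<open>- hat n W\<close> (\<open>P_fun_0\<close>, \<open>Q_fun_0\<close>).
  So the two series in the theorem converge if and only if the families \<open>1\<close> and \<open>W\<close> are square summable in
  the coordinates \<open>hat\<close> (the predicate \<open>l2\<close>), that is, if and only if their Gram forms stay bounded.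

  Fix \<open>x\<close> in the upper half-plane that is not a node, and put \<open>v\<^sub>x(j) = z\<^sub>j (z\<^sub>j - x)\<^sup>-\<^sup>1 I\<close>,
  \<open>u\<^sub>x(j) = z\<^sub>j (z\<^sub>j - x)\<^sup>-\<^sup>1 W\<^sub>j\<close>. Positivity of the
  Pick matrix of the nodes \<open>z\<^sub>1, ..., z\<^sub>n, x\<close> with the additional value \<open>X\<close> amounts to
  \<open>(X - X\<^sup>*) / (x - cnj x)\<close> dominating the Gram form of \<open>u - v X\<^sup>*\<close>, both families taken at
  \<open>cnj x\<close> (\<open>extended_pick\<close>). The Pick matrix of a Nevanlinna function is
  positive, which comes from integrating its imaginary part against Cauchy kernels over large
  circles (\<open>pick_mat_psd\<close>); conversely a positive definite Pick matrix admits an explicit rational solution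
  (\<open>pick_solution_exists\<close>). Completing the square turns the inequality into a matrix ball. By an identity between
  Gram forms at \<open>x\<close> and at \<open>cnj x\<close> (\<open>left_radius_sq_inverse\<close>) its semi-radii are
  \<open>(4 (Im x)\<^sup>2 Gram n v\<^sub>x v\<^sub>x)\<^sup>-\<^sup>1\<^sup>/\<^sup>2\<close> and \<open>(Gram n v v)\<^sup>-\<^sup>1\<^sup>/\<^sup>2\<close> with \<open>v\<close> at \<open>cnj x\<close>; boundary points
  of the ball are reached by a normal family argument (\<open>nevanlinna_compact\<close>, \<open>trunc_ball\<close>).

  If the full problem is completely indeterminate, two
  solutions have values at \<open>x\<close> whose difference is invertible. The inequality for each of them bounds
  the Gram forms of \<open>u - v X\<^sup>*\<close>, and the two bounds together make \<open>u\<close> and \<open>v\<close> at \<open>cnj x\<close> square summable. The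
  same argument with the reflected node \<open>cnj x\<close> gives \<open>u\<close> and \<open>v\<close> at \<open>x\<close> (\<open>indeterminate_imp_l2\<close>). If, conversely, these four
  families are square summable then all Gram forms converge, so that centres and semi-radii of the truncated balls
  converge, the latter to positive definite limits (\<open>l2_imp_indeterminate\<close>).

  It remains to pass from \<open>x\<close> to the origin. Multiplication of families by the scalars
  \<open>d\<^sub>j = z\<^sub>j (z\<^sub>j - x)\<^sup>-\<^sup>1\<close> intertwines with \<open>P\<^sub>n\<close> up to a matrix of rank at most \<open>2 m\<close> that is built from
  the four families. In the coordinates \<open>hat\<close> this makes it a triangular operator whose diagonal is \<open>d\<close> and whose strict lower
  triangle is a product of square summable sequences (\<open>hat_intertwine\<close>). A discrete Gronwall inequality inverts such an operator
  on square summable families as long as \<open>d\<close> stays away from \<open>0\<close>, which holds because \<open>z\<^sub>j\<close> tends to infinity (\<open>l2_volterra\<close>).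
  Since the multiplication maps the families at the origin to those at \<open>x\<close>, and the inverse one goes
  back, square summability at the origin and at \<open>x\<close>, \<open>cnj x\<close> are equivalent (\<open>l2_to_origin\<close>, \<open>l2_from_origin\<close>).\<close>

(* The entry and scalar product notation of other libraries would make that for vectors and matrices ambiguous. *)
unbundle no vec_syntax
no_notation fps_nth (infixl "$" 75)
no_notation Inner_Product.real_inner_class.inner (infix "\<bullet>" 70)

section \<open>Matrix algebra with adjoints\<close>

lemma dim_mat_adjoint [simp]:
  "dim_row (mat_adjoint A) = dim_col A" "dim_col (mat_adjoint A) = dim_row A"
  by (auto simp: mat_adjoint_def)

lemma index_mat_adjoint [simp]:
  "i < dim_col A \<Longrightarrow> j < dim_row A \<Longrightarrow> mat_adjoint A $$ (i, j) = cnj (A $$ (j, i))"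
  for A :: "complex mat"
  by (simp add: mat_adjoint_def mat_of_rows_def)

lemma mat_adjoint_carrier [simp]:
  "mat_adjoint A \<in> carrier_mat n k \<longleftrightarrow> A \<in> carrier_mat k n"
  unfolding carrier_mat_def by (simp add: conj_commute)

lemma mat_adjoint_adjoint [simp]: "mat_adjoint (mat_adjoint A) = A" for A :: "complex mat"
  by (rule eq_matI) auto

lemma mat_adjoint_one [simp]: "mat_adjoint (1\<^sub>m n) = (1\<^sub>m n :: complex mat)"
  by (rule eq_matI) auto

lemma mat_adjoint_zero [simp]: "mat_adjoint (0\<^sub>m n k) = (0\<^sub>m k n :: complex mat)"
  by (rule eq_matI) auto

text \<open>The distributive, associative and adjoint laws are stated with hypotheses on dimensions
  instead of carriers: such conditions contain no new variables, so that the simplifier can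
  discharge them for compound expressions.\<close>

lemma mat_adjoint_add:
  "dim_row A = dim_row B \<Longrightarrow> dim_col A = dim_col B \<Longrightarrow>
   mat_adjoint (A + B) = mat_adjoint A + mat_adjoint B" for A B :: "complex mat"
  by (rule eq_matI) auto

lemma mat_adjoint_minus:
  "dim_row A = dim_row B \<Longrightarrow> dim_col A = dim_col B \<Longrightarrow>
   mat_adjoint (A - B) = mat_adjoint A - mat_adjoint B" for A B :: "complex mat"
  by (rule eq_matI) auto

lemma mat_adjoint_uminus: "mat_adjoint (- A) = - mat_adjoint A" for A :: "complex mat"
  by (rule eq_matI) auto

lemma mat_adjoint_smult: "mat_adjoint (k \<cdot>\<^sub>m A) = cnj k \<cdot>\<^sub>m mat_adjoint A" for A :: "complex mat"
  by (rule eq_matI) auto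

lemma mat_adjoint_mult:
  fixes A B :: "complex mat"
  assumes "dim_col A = dim_row B"
  shows "mat_adjoint (A * B) = mat_adjoint B * mat_adjoint A"
proof (rule eq_matI)
  fix i j assume "i < dim_row (mat_adjoint B * mat_adjoint A)" "j < dim_col (mat_adjoint B * mat_adjoint A)"
  then show "mat_adjoint (A * B) $$ (i, j) = (mat_adjoint B * mat_adjoint A) $$ (i, j)"
    using assms by (auto simp: scalar_prod_def mult.commute intro!: sum.cong)
qed (use assms in auto)

lemma mat_mult_assoc:
  "dim_col A = dim_row B \<Longrightarrow> dim_col B = dim_row C \<Longrightarrow> (A * B) * C = A * (B * C)"
  for A B C :: "complex mat"
  by (rule assoc_mult_mat[of _ "dim_row A" "dim_col A" _ "dim_col B" _ "dim_col C"]) auto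

lemma mat_mult_add:
  "dim_col A = dim_row B \<Longrightarrow> dim_row B = dim_row C \<Longrightarrow> dim_col B = dim_col C \<Longrightarrow>
   A * (B + C) = A * B + A * C" for A B C :: "complex mat"
  by (rule mult_add_distrib_mat[of _ "dim_row A" "dim_col A" _ "dim_col B"]) auto

lemma mat_add_mult:
  "dim_col A = dim_row C \<Longrightarrow> dim_row A = dim_row B \<Longrightarrow> dim_col A = dim_col B \<Longrightarrow>
   (A + B) * C = A * C + B * C" for A B C :: "complex mat"
  by (rule add_mult_distrib_mat[of _ "dim_row A" "dim_col A" _ _ "dim_col C"]) auto

lemma mat_mult_minus:
  "dim_col A = dim_row B \<Longrightarrow> dim_row B = dim_row C \<Longrightarrow> dim_col B = dim_col C \<Longrightarrow>
   A * (B - C) = A * B - A * C" for A B C :: "complex mat"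
  by (rule mult_minus_distrib_mat[of _ "dim_row A" "dim_col A" _ "dim_col B"]) auto

lemma mat_minus_mult:
  "dim_col A = dim_row C \<Longrightarrow> dim_row A = dim_row B \<Longrightarrow> dim_col A = dim_col B \<Longrightarrow>
   (A - B) * C = A * C - B * C" for A B C :: "complex mat"
  by (rule minus_mult_distrib_mat[of _ "dim_row A" "dim_col A" _ _ "dim_col C"]) auto

lemma mat_mult_smult:
  "dim_col A = dim_row B \<Longrightarrow> A * (k \<cdot>\<^sub>m B) = k \<cdot>\<^sub>m (A * B)" for A B :: "complex mat"
  by (rule mult_smult_distrib[of _ "dim_row A" "dim_col A" _ "dim_col B"]) auto

lemma mat_smult_mult:
  "dim_col A = dim_row B \<Longrightarrow> (k \<cdot>\<^sub>m A) * B = k \<cdot>\<^sub>m (A * B)" for A B :: "complex mat"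
  by (rule mult_smult_assoc_mat[of _ "dim_row A" "dim_col A" _ "dim_col B"]) auto

lemma mat_smult_smult: "k \<cdot>\<^sub>m (l \<cdot>\<^sub>m A) = (k * l) \<cdot>\<^sub>m A" for A :: "complex mat"
  by (rule eq_matI) auto

lemma smult_one_mat: "(1 :: complex) \<cdot>\<^sub>m A = A"
  by (intro eq_matI) simp_all

lemmas mat_expand = mat_mult_assoc mat_mult_add mat_add_mult mat_mult_minus mat_minus_mult
  mat_mult_smult mat_smult_mult mat_smult_smult
  mat_adjoint_add mat_adjoint_minus mat_adjoint_uminus mat_adjoint_smult mat_adjoint_mult

lemma mat_uminus_zero: "- 0\<^sub>m n k = (0\<^sub>m n k :: complex mat)"
  by (rule eq_matI) auto

lemma mat_uminus_add_self: "dim_row A = n \<Longrightarrow> dim_col A = k \<Longrightarrow> - A + A = 0\<^sub>m n k" for A :: "complex mat"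
  by (rule eq_matI) auto

lemma mat_uminus_add: "dim_row A = dim_row B \<Longrightarrow> dim_col A = dim_col B \<Longrightarrow> - A + B = B - A" for A B :: "complex mat"
  by (rule eq_matI) auto

lemma mat_add_minus_cancel: "dim_row A = dim_row B \<Longrightarrow> dim_col A = dim_col B \<Longrightarrow> A + (B - A) = B" for A B :: "complex mat"
  by (rule eq_matI) auto

lemmas mat_zero_simps = mat_uminus_zero left_mult_zero_mat' right_mult_zero_mat'

lemma cscalar_sum: "dim_vec w = dim_vec v \<Longrightarrow> v \<bullet>c w = (\<Sum>i<dim_vec v. v $ i * cnj (w $ i))"
  for v w :: "complex vec"
  by (simp add: scalar_prod_def atLeast0LessThan)

lemma mat_vec_index: "i < dim_row A \<Longrightarrow> dim_vec v = dim_col A \<Longrightarrow> (A *\<^sub>v v) $ i = (\<Sum>k<dim_col A. A $$ (i, k) * v $ k)"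
  for A :: "complex mat"
  by (simp add: scalar_prod_def atLeast0LessThan)

lemma mat_mult_entry:
  fixes A :: "complex mat"
  assumes "A \<in> carrier_mat n k" "B \<in> carrier_mat k l" "i < n" "j < l"
  shows "(A * B) $$ (i, j) = (\<Sum>t<k. A $$ (i, t) * B $$ (t, j))"
  using assms by (simp add: scalar_prod_def atLeast0LessThan)

lemma cscalar_adjoint:
  fixes A :: "complex mat"
  assumes "dim_vec v = dim_col A" "dim_vec w = dim_row A"
  shows "(A *\<^sub>v v) \<bullet>c w = v \<bullet>c (mat_adjoint A *\<^sub>v w)"
proof -
  have "(A *\<^sub>v v) \<bullet>c w = (\<Sum>i<dim_row A. \<Sum>k<dim_col A. A $$ (i, k) * v $ k * cnj (w $ i))"
    using assms by (simp del: index_mult_mat_vec add: cscalar_sum mat_vec_index sum_distrib_right)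
  also have "\<dots> = (\<Sum>k<dim_col A. \<Sum>i<dim_row A. A $$ (i, k) * v $ k * cnj (w $ i))"
    by (rule sum.swap)
  also have "\<dots> = v \<bullet>c (mat_adjoint A *\<^sub>v w)"
    using assms by (simp del: index_mult_mat_vec add: cscalar_sum mat_vec_index sum_distrib_left ac_simps)
  finally show ?thesis .
qed

lemma cscalar_self: "v \<bullet>c v = of_real (\<Sum>i<dim_vec v. (cmod (v $ i))\<^sup>2)" for v :: "complex vec"
  by (simp only: cscalar_sum complex_norm_square[symmetric] of_real_sum)

lemma cscalar_self_pos:
  fixes v :: "complex vec"
  assumes "v \<noteq> 0\<^sub>v (dim_vec v)"
  shows "0 < Re (v \<bullet>c v)"
proof -
  obtain i where i: "i < dim_vec v" "v $ i \<noteq> 0" using assms by (metis eq_vecI index_zero_vec)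
  have "0 < (\<Sum>i<dim_vec v. (cmod (v $ i))\<^sup>2)"
    using i by (intro sum_pos2[of _ i]) auto
  then show ?thesis by (simp add: cscalar_self del: of_real_sum)
qed

lemma cscalar_self_nonneg: "0 \<le> Re (v \<bullet>c v)" for v :: "complex vec"
  by (simp add: cscalar_self sum_nonneg del: of_real_sum)

lemma cscalar_form:
  assumes "A \<in> carrier_mat n n" "v \<in> carrier_vec n" "w \<in> carrier_vec n"
  shows "(A *\<^sub>v v) \<bullet>c w = (\<Sum>i<n. \<Sum>k<n. cnj (w $ i) * A $$ (i, k) * v $ k)"
  using assms by (simp del: index_mult_mat_vec add: cscalar_sum mat_vec_index sum_distrib_left sum_distrib_right ac_simps)

section \<open>Inverses\<close>

lemma minv_eqI:
  assumes "A \<in> carrier_mat n n" "B \<in> carrier_mat n n" "A * B = 1\<^sub>m n"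
  shows "minv A = B"
proof -
  have BA: "B * A = 1\<^sub>m n" using assms mat_mult_left_right_inverse by blast
  have U: "A \<in> Units (ring_mat TYPE(complex) n ())"
    using assms BA by (auto simp: Units_def ring_mat_def)
  obtain C where C: "mat_inverse A = Some C"
    using mat_inverse(1)[OF assms(1), where b = "()"] U by fastforce
  from mat_inverse(2)[OF assms(1) C] have "A * C = 1\<^sub>m n" "C \<in> carrier_mat n n" by auto
  note C' = this
  have "C = (B * A) * C" using BA C' by simp
  also have "\<dots> = B * (A * C)" by (rule assoc_mult_mat[OF assms(2,1) C'(2)])
  also have "\<dots> = B" unfolding C'(1) by (rule right_mult_one_mat[OF assms(2)])
  finally show ?thesis using C by (simp add: minv_def)
qed

lemma minv_works:
  assumes "A \<in> carrier_mat n n" "det A \<noteq> 0"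
  shows minv_carrier: "minv A \<in> carrier_mat n n"
    and minv_right: "A * minv A = 1\<^sub>m n"
    and minv_left: "minv A * A = 1\<^sub>m n"
proof -
  have U: "A \<in> Units (ring_mat TYPE(complex) n ())"
    by (rule det_non_zero_imp_unit[OF assms])
  obtain C where C: "mat_inverse A = Some C"
    using mat_inverse(1)[OF assms(1), where b = "()"] U by fastforce
  show "minv A \<in> carrier_mat n n" "A * minv A = 1\<^sub>m n" "minv A * A = 1\<^sub>m n"
    using mat_inverse(2)[OF assms(1) C] C by (auto simp: minv_def)
qed

lemma det_nonzeroI:
  fixes A :: "complex mat"
  assumes "A \<in> carrier_mat n n" "\<And>v. v \<in> carrier_vec n \<Longrightarrow> v \<noteq> 0\<^sub>v n \<Longrightarrow> A *\<^sub>v v \<noteq> 0\<^sub>v n"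
  shows "det A \<noteq> 0"
  using assms det_0_iff_vec_prod_zero_field by blast

lemma det_nonzero_right_inverse:
  fixes A :: "complex mat"
  assumes "A \<in> carrier_mat n n" "B \<in> carrier_mat n n" "A * B = 1\<^sub>m n"
  shows "det A \<noteq> 0" "det B \<noteq> 0"
  using det_mult[OF assms(1,2)] assms(3) by auto

lemma mat_vec_nonzero:
  fixes A :: "complex mat"
  assumes "A \<in> carrier_mat n n" "det A \<noteq> 0" "v \<in> carrier_vec n" "v \<noteq> 0\<^sub>v n"
  shows "A *\<^sub>v v \<noteq> 0\<^sub>v n"
  using assms det_0_iff_vec_prod_zero_field by blast

text \<open>Cramer's rule shows that the entries of the inverse are continuous and holomorphic functions of the matrix.\<close>

lemma minv_entry:
  assumes "A \<in> carrier_mat n n" "det A \<noteq> 0" "i < n" "j < n"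
  shows "minv A $$ (i, j) = cofactor A j i / det A"
proof -
  have *: "minv A = (1 / det A) \<cdot>\<^sub>m adj_mat A"
  proof (rule minv_eqI[OF assms(1)])
    show "(1 / det A) \<cdot>\<^sub>m adj_mat A \<in> carrier_mat n n" using adj_mat(1)[OF assms(1)] by simp
    have "A * ((1 / det A) \<cdot>\<^sub>m adj_mat A) = (1 / det A) \<cdot>\<^sub>m (A * adj_mat A)"
      using adj_mat(1)[OF assms(1)] assms(1) by (simp add: mat_mult_smult)
    also have "\<dots> = 1\<^sub>m n" using adj_mat(2)[OF assms(1)] assms(2) by (auto intro!: eq_matI)
    finally show "A * ((1 / det A) \<cdot>\<^sub>m adj_mat A) = 1\<^sub>m n" .
  qed
  show ?thesis unfolding * using assms by (simp add: adj_mat_def)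
qed

lemma minv_adjoint:
  assumes "A \<in> carrier_mat n n" "det A \<noteq> 0"
  shows "minv (mat_adjoint A) = mat_adjoint (minv A)"
proof -
  note c = minv_carrier[OF assms]
  have c': "mat_adjoint A \<in> carrier_mat n n" "mat_adjoint (minv A) \<in> carrier_mat n n"
    using assms(1) c by (simp_all only: mat_adjoint_carrier)
  have "mat_adjoint A * mat_adjoint (minv A) = mat_adjoint (minv A * A)"
    using assms(1) c by (subst mat_adjoint_mult) auto
  also have "\<dots> = 1\<^sub>m n" unfolding minv_left[OF assms] by simp
  finally show ?thesis by (rule minv_eqI[OF c'])
qed

lemma det_adjoint_nonzero:
  fixes A :: "complex mat"
  assumes "A \<in> carrier_mat n n" "det A \<noteq> 0"
  shows "det (mat_adjoint A) \<noteq> 0"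
proof -
  note c = minv_carrier[OF assms]
  have c': "mat_adjoint A \<in> carrier_mat n n" "mat_adjoint (minv A) \<in> carrier_mat n n"
    using assms(1) c by (simp_all only: mat_adjoint_carrier)
  have "mat_adjoint A * mat_adjoint (minv A) = mat_adjoint (minv A * A)"
    using assms(1) c by (subst mat_adjoint_mult) auto
  also have "\<dots> = 1\<^sub>m n" unfolding minv_left[OF assms] by simp
  finally show ?thesis by (rule det_nonzero_right_inverse(1)[OF c'])
qed

lemma minv_cancel:
  assumes "A \<in> carrier_mat n n" "det A \<noteq> 0" "X \<in> carrier_mat n k"
  shows "minv A * (A * X) = X" "A * (minv A * X) = X"
proof -
  note I = minv_works[OF assms(1,2)]
  have "minv A * (A * X) = (minv A * A) * X"
    by (rule assoc_mult_mat[symmetric, OF I(1) assms(1,3)])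
  then show "minv A * (A * X) = X" using assms(3) by (simp add: I)
  have "A * (minv A * X) = (A * minv A) * X"
    by (rule assoc_mult_mat[symmetric, OF assms(1) I(1) assms(3)])
  then show "A * (minv A * X) = X" using assms(3) by (simp add: I)
qed

section \<open>Positive matrices\<close>

lemma hermitian_carrier: "hermitian_mat n A \<Longrightarrow> A \<in> carrier_mat n n"
  and hermitian_adjoint: "hermitian_mat n A \<Longrightarrow> mat_adjoint A = A"
  by (auto simp: hermitian_mat_def)

lemma pd_hermitian: "pd_mat n A \<Longrightarrow> hermitian_mat n A"
  and psd_hermitian: "psd_mat n A \<Longrightarrow> hermitian_mat n A"
  unfolding pd_mat_def psd_mat_def by blast+

lemmas pd_carrier = hermitian_carrier[OF pd_hermitian]
  and psd_carrier = hermitian_carrier[OF psd_hermitian]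
  and pd_adjoint = hermitian_adjoint[OF pd_hermitian]
  and psd_adjoint = hermitian_adjoint[OF psd_hermitian]

lemma pd_imp_psd: "pd_mat n A \<Longrightarrow> psd_mat n A"
proof -
  assume A: "pd_mat n A"
  have "0 \<le> Re ((A *\<^sub>v v) \<bullet>c v)" if "v \<in> carrier_vec n" for v
  proof (cases "v = 0\<^sub>v n")
    case True
    then show ?thesis using pd_carrier[OF A] by (simp add: cscalar_sum)
  next
    case False
    then show ?thesis using A that by (force simp: pd_mat_def)
  qed
  then show "psd_mat n A" using A by (auto simp: psd_mat_def pd_mat_def)
qed

lemma pd_det: assumes "pd_mat n A" shows "det A \<noteq> 0"
proof (rule det_nonzeroI[OF pd_carrier[OF assms]])
  fix v :: "complex vec" assume v: "v \<in> carrier_vec n" "v \<noteq> 0\<^sub>v n"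
  then have "0 < Re ((A *\<^sub>v v) \<bullet>c v)" using assms by (auto simp: pd_mat_def)
  then show "A *\<^sub>v v \<noteq> 0\<^sub>v n" using v by auto
qed

lemma form_congruence:
  fixes A :: "complex mat"
  assumes "A \<in> carrier_mat n n" "X \<in> carrier_mat n k" "v \<in> carrier_vec k"
  shows "((mat_adjoint X * A * X) *\<^sub>v v) \<bullet>c v = (A *\<^sub>v (X *\<^sub>v v)) \<bullet>c (X *\<^sub>v v)"
proof -
  have c: "mat_adjoint X \<in> carrier_mat k n" "A * X \<in> carrier_mat n k" "X *\<^sub>v v \<in> carrier_vec n"
    "A *\<^sub>v (X *\<^sub>v v) \<in> carrier_vec n"
    using assms by auto
  have "(mat_adjoint X * A * X) *\<^sub>v v = mat_adjoint X *\<^sub>v (A *\<^sub>v (X *\<^sub>v v))"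
    unfolding assoc_mult_mat[OF c(1) assms(1,2)] assoc_mult_mat_vec[OF c(1,2) assms(3)]
      assoc_mult_mat_vec[OF assms] ..
  then show ?thesis
    using cscalar_adjoint[of "A *\<^sub>v (X *\<^sub>v v)" "mat_adjoint X" v] assms by simp
qed

lemma hermitian_congruence:
  assumes "hermitian_mat n A" "X \<in> carrier_mat n k"
  shows "hermitian_mat k (mat_adjoint X * A * X)"
  using assms by (auto simp: hermitian_mat_def mat_adjoint_mult mat_mult_assoc)

lemma psd_congruence:
  assumes "psd_mat n A" "X \<in> carrier_mat n k"
  shows "psd_mat k (mat_adjoint X * A * X)"
  unfolding psd_mat_def
proof (intro conjI ballI)
  fix v :: "complex vec" assume v: "v \<in> carrier_vec k"
  have "X *\<^sub>v v \<in> carrier_vec n" using assms v by auto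
  then show "0 \<le> Re ((mat_adjoint X * A * X *\<^sub>v v) \<bullet>c v)"
    using assms(1) unfolding form_congruence[OF psd_carrier[OF assms(1)] assms(2) v]
    by (auto simp: psd_mat_def)
qed (use hermitian_congruence psd_hermitian assms in blast)

lemma pd_congruence:
  assumes "pd_mat n A" "X \<in> carrier_mat n k"
    and inj: "\<And>v. v \<in> carrier_vec k \<Longrightarrow> v \<noteq> 0\<^sub>v k \<Longrightarrow> X *\<^sub>v v \<noteq> 0\<^sub>v n"
  shows "pd_mat k (mat_adjoint X * A * X)"
  unfolding pd_mat_def
proof (intro conjI ballI impI)
  fix v :: "complex vec" assume v: "v \<in> carrier_vec k" "v \<noteq> 0\<^sub>v k"
  have "X *\<^sub>v v \<in> carrier_vec n" using assms v by auto
  then show "0 < Re ((mat_adjoint X * A * X *\<^sub>v v) \<bullet>c v)"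
    using assms(1) inj[OF v] unfolding form_congruence[OF pd_carrier[OF assms(1)] assms(2) v(1)]
    by (auto simp: pd_mat_def)
qed (use hermitian_congruence pd_hermitian assms in blast)

lemma pd_one: "pd_mat n (1\<^sub>m n)"
  unfolding pd_mat_def hermitian_mat_def by (auto intro: cscalar_self_pos)

lemma psd_gram: "X \<in> carrier_mat n k \<Longrightarrow> psd_mat k (mat_adjoint X * X)"
  using psd_congruence[OF pd_imp_psd[OF pd_one], of X n k] by simp

lemma psd_zero: "psd_mat n (0\<^sub>m n n)"
proof -
  have "psd_mat n (mat_adjoint (0\<^sub>m n n) * 0\<^sub>m n n)" by (rule psd_gram) (rule zero_carrier_mat)
  also have "mat_adjoint (0\<^sub>m n n) * 0\<^sub>m n n = (0\<^sub>m n n :: complex mat)"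
    by (rule right_mult_zero_mat[of _ n n]) simp
  finally show ?thesis .
qed

lemma pd_minv: assumes "pd_mat n A" shows "pd_mat n (minv A)"
proof -
  note A = pd_carrier[OF assms] pd_det[OF assms]
  note I = minv_works[OF A]
  have adj: "mat_adjoint (minv A) = minv A"
    using minv_adjoint[OF A] pd_adjoint[OF assms] by simp
  have "pd_mat n (mat_adjoint (minv A) * A * minv A)"
    using I A by (intro pd_congruence[OF assms] mat_vec_nonzero det_nonzero_right_inverse(2)[OF A(1)]) auto
  then show ?thesis using I A by (simp add: adj)
qed

lemma form_add:
  fixes A B :: "complex mat"
  assumes "A \<in> carrier_mat n n" "B \<in> carrier_mat n n" "v \<in> carrier_vec n"
  shows "((A + B) *\<^sub>v v) \<bullet>c v = (A *\<^sub>v v) \<bullet>c v + (B *\<^sub>v v) \<bullet>c v"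
proof -
  have "(A + B) *\<^sub>v v = A *\<^sub>v v + B *\<^sub>v v" using assms by (rule add_mult_distrib_mat_vec)
  then show ?thesis using assms by (simp add: add_scalar_prod_distrib[of _ n])
qed

lemma form_smult:
  fixes A :: "complex mat"
  assumes "A \<in> carrier_mat n n" "v \<in> carrier_vec n"
  shows "((k \<cdot>\<^sub>m A) *\<^sub>v v) \<bullet>c v = k * ((A *\<^sub>v v) \<bullet>c v)"
  using assms by (simp del: index_mult_mat_vec add: cscalar_sum mat_vec_index sum_distrib_left sum_distrib_right ac_simps)

lemma psd_add: assumes "psd_mat n A" "psd_mat n B" shows "psd_mat n (A + B)"
proof -
  note c = psd_carrier[OF assms(1)] psd_carrier[OF assms(2)]
  show ?thesis using assms c
    by (auto simp: psd_mat_def hermitian_mat_def form_add[OF c] mat_adjoint_add)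
qed

lemma pd_psd_add: assumes "pd_mat n A" "psd_mat n B" shows "pd_mat n (A + B)"
proof -
  note c = pd_carrier[OF assms(1)] psd_carrier[OF assms(2)]
  show ?thesis using assms c
    by (auto simp: psd_mat_def pd_mat_def hermitian_mat_def form_add[OF c] mat_adjoint_add
      intro: add_pos_nonneg)
qed

lemma psd_smult: assumes "psd_mat n A" "0 \<le> t" shows "psd_mat n (complex_of_real t \<cdot>\<^sub>m A)"
proof -
  note c = psd_carrier[OF assms(1)]
  show ?thesis using assms c
    by (auto simp: psd_mat_def hermitian_mat_def form_smult[OF c] mat_adjoint_smult)
qed

lemma pd_smult: assumes "pd_mat n A" "0 < t" shows "pd_mat n (complex_of_real t \<cdot>\<^sub>m A)"
proof -
  note c = pd_carrier[OF assms(1)]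
  show ?thesis using assms c
    by (auto simp: pd_mat_def hermitian_mat_def form_smult[OF c] mat_adjoint_smult)
qed

lemma psd_diag: assumes "psd_mat n A" "i < n" shows "0 \<le> Re (A $$ (i, i))"
proof -
  note A = psd_carrier[OF assms(1)]
  have "0 \<le> Re ((A *\<^sub>v unit_vec n i) \<bullet>c unit_vec n i)"
    using assms by (auto simp: psd_mat_def)
  also have "(A *\<^sub>v unit_vec n i) \<bullet>c unit_vec n i
      = (\<Sum>j<n. if j = i then (\<Sum>k<n. if k = i then A $$ (j, k) else 0) else 0)"
    unfolding cscalar_form[OF A unit_vec_carrier unit_vec_carrier] by (intro sum.cong) (auto simp: unit_vec_def if_distrib cong: if_cong)
  also have "\<dots> = A $$ (i, i)" using assms(2) by (simp add: sum.delta)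
  finally show ?thesis .
qed

lemma hermitian_entry: "hermitian_mat n A \<Longrightarrow> i < n \<Longrightarrow> j < n \<Longrightarrow> A $$ (i, j) = cnj (A $$ (j, i))"
  by (metis carrier_matD hermitian_mat_def index_mat_adjoint)

section \<open>Square roots of positive definite matrices\<close>

lemma unitary_adjoint:
  fixes U :: "complex mat"
  assumes "U \<in> carrier_mat n n" "mat_adjoint U * U = 1\<^sub>m n"
  shows "U * mat_adjoint U = 1\<^sub>m n"
  using mat_mult_left_right_inverse[OF _ assms(1) assms(2)] assms(1) by simp

text \<open>Gram--Schmidt on a basis that starts with \<open>v\<close>, followed by normalization of the columns.\<close>

lemma unitary_with_first_column:
  assumes v: "v \<in> carrier_vec n" "v \<noteq> 0\<^sub>v n" and n: "0 < n"
  obtains U c where "U \<in> carrier_mat n n" "mat_adjoint U * U = 1\<^sub>m n" "col U 0 = c \<cdot>\<^sub>v (v :: complex vec)"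
proof -
  interpret cof_vec_space n "TYPE(complex)" .
  define ws where "ws = gram_schmidt n (basis_completion v)"
  note b = basis_completion[OF v]
  note gs = gram_schmidt_result[OF b(2,4,5) ws_def]
  have len: "length ws = n" using gs(4) b(6) by simp
  define W where "W = mat_of_cols n ws"
  have W: "W \<in> carrier_mat n n" unfolding W_def using mat_of_cols_carrier(1)[of n ws] len by auto
  have orth: "corthogonal_mat W"
    unfolding W_def by (rule orthogonal_mat_of_cols[OF gs(3,2) len])
  have "hd ws = v"
    unfolding ws_def using gram_schmidt_hd[OF v(1)] b(6,7) n
    by (metis hd_Cons_tl length_0_conv less_nat_zero_code)
  then have col0: "col W 0 = v"
    using n len gs(3) unfolding W_def by (subst col_mat_of_cols) (auto simp: hd_conv_nth)
  define s where "s = (\<lambda>j. sqrt (Re (col W j \<bullet>c col W j)))"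
  have pos: "0 < Re (col W j \<bullet>c col W j)" if "j < n" for j
  proof -
    have "col W j \<bullet>c col W j \<noteq> 0" using corthogonal_matD[OF orth, of j j] that W by auto
    then have "col W j \<noteq> 0\<^sub>v (dim_vec (col W j))" by (metis conjugate_square_eq_0_vec carrier_vec_dim_vec)
    then show ?thesis by (rule cscalar_self_pos)
  qed
  have ss: "of_real (s j) * of_real (s j) = col W j \<bullet>c col W j" if "j < n" for j
  proof -
    have "Im (col W j \<bullet>c col W j) = 0" by (simp add: cscalar_self del: of_real_sum)
    then have "of_real (Re (col W j \<bullet>c col W j)) = col W j \<bullet>c col W j" by (simp add: complex_eq_iff)
    then show ?thesis using pos[OF that] by (simp add: s_def flip: of_real_mult)
  qed
  have s0: "s j \<noteq> 0" if "j < n" for j using pos[OF that] by (simp add: s_def)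
  define U where "U = mat n n (\<lambda>(i, j). W $$ (i, j) / of_real (s j))"
  have U: "U \<in> carrier_mat n n" by (simp add: U_def)
  show thesis
  proof
    show "mat_adjoint U * U = 1\<^sub>m n"
    proof (rule eq_matI)
      fix i j assume ij: "i < dim_row (1\<^sub>m n)" "j < dim_col (1\<^sub>m n)"
      have "(mat_adjoint U * U) $$ (i, j) = (\<Sum>k<n. cnj (U $$ (k, i)) * U $$ (k, j))"
        using ij U by (simp add: scalar_prod_def atLeast0LessThan)
      also have "\<dots> = (\<Sum>k<n. W $$ (k, j) * cnj (W $$ (k, i))) / (of_real (s i) * of_real (s j))"
        using ij unfolding sum_divide_distrib by (intro sum.cong) (auto simp: U_def)
      also have "(\<Sum>k<n. W $$ (k, j) * cnj (W $$ (k, i))) = col W j \<bullet>c col W i"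
        using ij W by (simp add: cscalar_sum)
      also have "(col W j \<bullet>c col W i) / (of_real (s i) * of_real (s j)) = 1\<^sub>m n $$ (i, j)"
        using ij ss[of i] s0[of i] corthogonal_matD[OF orth, of j i] W
        by (cases "i = j") (auto simp flip: ss)
      finally show "(mat_adjoint U * U) $$ (i, j) = 1\<^sub>m n $$ (i, j)" .
    qed (use U in auto)
    show "col U 0 = (1 / of_real (s 0)) \<cdot>\<^sub>v v"
      unfolding col0[symmetric] using n W by (intro eq_vecI) (auto simp: U_def)
  qed (fact U)
qed

lemma four_block_adjoint:
  fixes A :: "complex mat"
  assumes "A \<in> carrier_mat n1 k1" "B \<in> carrier_mat n1 k2" "C \<in> carrier_mat n2 k1" "D \<in> carrier_mat n2 k2"
  shows "mat_adjoint (four_block_mat A B C D)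
    = four_block_mat (mat_adjoint A) (mat_adjoint C) (mat_adjoint B) (mat_adjoint D)"
  using assms by (intro eq_matI) auto

lemma cscalar_append:
  fixes v :: "complex vec"
  assumes "v \<in> carrier_vec n" "v' \<in> carrier_vec k" "w \<in> carrier_vec n" "w' \<in> carrier_vec k"
  shows "(v @\<^sub>v v') \<bullet>c (w @\<^sub>v w') = v \<bullet>c w + v' \<bullet>c w'"
proof -
  have "conjugate (w @\<^sub>v w') = conjugate w @\<^sub>v conjugate w'" by (intro eq_vecI) auto
  then show ?thesis using assms by (simp add: scalar_prod_append[of _ n _ k])
qed

lemma form_block_diag:
  fixes A :: "complex mat"
  assumes "A \<in> carrier_mat n n" "D \<in> carrier_mat k k" "v \<in> carrier_vec n" "w \<in> carrier_vec k"
  shows "((four_block_mat A (0\<^sub>m n k) (0\<^sub>m k n) D) *\<^sub>v (v @\<^sub>v w)) \<bullet>c (v @\<^sub>v w)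
     = (A *\<^sub>v v) \<bullet>c v + (D *\<^sub>v w) \<bullet>c w"
proof -
  have "four_block_mat A (0\<^sub>m n k) (0\<^sub>m k n) D *\<^sub>v (v @\<^sub>v w) = (A *\<^sub>v v + 0\<^sub>m n k *\<^sub>v w) @\<^sub>v (0\<^sub>m k n *\<^sub>v v + D *\<^sub>v w)"
    using assms by (intro four_block_mat_mult_vec[of _ n n _ k _ k]) auto
  also have "A *\<^sub>v v + 0\<^sub>m n k *\<^sub>v w = A *\<^sub>v v"
    using assms by (intro eq_vecI) auto
  also have "0\<^sub>m k n *\<^sub>v v + D *\<^sub>v w = D *\<^sub>v w"
    using assms by (intro eq_vecI) auto
  finally show ?thesis using assms by (simp add: cscalar_append[of _ n _ k])
qed

lemma block_diag_hermitian:
  assumes "hermitian_mat n A" "hermitian_mat k D"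
  shows "hermitian_mat (n + k) (four_block_mat A (0\<^sub>m n k) (0\<^sub>m k n) D)"
proof -
  note c = hermitian_carrier[OF assms(1)] hermitian_carrier[OF assms(2)]
  show ?thesis using c unfolding hermitian_mat_def
    by (simp add: four_block_adjoint[of _ n n _ k _ k] hermitian_adjoint[OF assms(1)] hermitian_adjoint[OF assms(2)])
qed

lemma pd_block_diag:
  assumes "pd_mat n A" "pd_mat k D"
  shows "pd_mat (n + k) (four_block_mat A (0\<^sub>m n k) (0\<^sub>m k n) D)"
  unfolding pd_mat_def[of "n + k"] Ball_def[symmetric] all_vec_append
proof (intro conjI ballI impI)
  show "hermitian_mat (n + k) (four_block_mat A (0\<^sub>m n k) (0\<^sub>m k n) D)"
    using block_diag_hermitian pd_hermitian assms by blast
  fix v w :: "complex vec" assume vw: "v \<in> carrier_vec n" "w \<in> carrier_vec k" "v @\<^sub>v w \<noteq> 0\<^sub>v (n + k)"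
  then have "v \<noteq> 0\<^sub>v n \<or> w \<noteq> 0\<^sub>v k" by (auto intro: eq_vecI)
  then show "0 < Re ((four_block_mat A (0\<^sub>m n k) (0\<^sub>m k n) D *\<^sub>v (v @\<^sub>v w)) \<bullet>c (v @\<^sub>v w))"
    unfolding form_block_diag[OF pd_carrier[OF assms(1)] pd_carrier[OF assms(2)] vw(1,2)]
    using assms pd_imp_psd[OF assms(1)] pd_imp_psd[OF assms(2)] vw
    by (auto simp: pd_mat_def psd_mat_def intro: add_pos_nonneg add_nonneg_pos)
qed

text \<open>Induction on the size: a unitary matrix whose first column is an eigenvector splits off a
  one-dimensional block.\<close>

lemma pd_sqrt_exists:
  assumes "pd_mat n A"
  shows "\<exists>S. pd_mat n S \<and> S * S = A"
  using assms
proof (induction n arbitrary: A)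
  case 0
  have "A * A = A" using pd_carrier[OF 0] by (intro eq_matI) auto
  then show ?case using 0 by blast
next
  case (Suc n)
  note A = pd_carrier[OF Suc.prems]
  obtain e where "e \<in> spectrum A" using spectrum_non_empty[OF A] by auto
  then obtain v where ev: "v \<in> carrier_vec (Suc n)" "v \<noteq> 0\<^sub>v (Suc n)" "A *\<^sub>v v = e \<cdot>\<^sub>v v"
    using A by (auto simp: spectrum_def eigenvalue_def eigenvector_def)
  obtain U c where U: "U \<in> carrier_mat (Suc n) (Suc n)" "mat_adjoint U * U = 1\<^sub>m (Suc n)" "col U 0 = c \<cdot>\<^sub>v v"
    by (rule unitary_with_first_column[OF ev(1,2)]) auto
  note UU = unitary_adjoint[OF U(1,2)]
  have Ua: "mat_adjoint U \<in> carrier_mat (Suc n) (Suc n)" using U by simp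
  note dU = det_nonzero_right_inverse[OF U(1) Ua UU]
  define A' where "A' = mat_adjoint U * A * U"
  have pd': "pd_mat (Suc n) A'"
    unfolding A'_def by (rule pd_congruence[OF Suc.prems U(1)]) (use mat_vec_nonzero[OF U(1) dU(1)] in auto)
  note A'c = pd_carrier[OF pd']
  have Acol: "A *\<^sub>v col U 0 = e \<cdot>\<^sub>v col U 0"
    unfolding U(3) using A ev by (simp add: mult_mat_vec[of _ "Suc n" "Suc n"] smult_smult_assoc mult.commute)
  have col0: "A' $$ (i, 0) = (if i = 0 then e else 0)" if "i < Suc n" for i
  proof -
    have "A' = mat_adjoint U * (A * U)" unfolding A'_def using A U(1) Ua by (intro assoc_mult_mat) auto
    then have "A' $$ (i, 0) = row (mat_adjoint U) i \<bullet> col (A * U) 0" using that U(1) A by simp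
    also have "col (A * U) 0 = A *\<^sub>v col U 0" using A U(1) by (intro col_mult2[of _ "Suc n" "Suc n" _ "Suc n"]) auto
    also have "row (mat_adjoint U) i \<bullet> (A *\<^sub>v col U 0) = e * (row (mat_adjoint U) i \<bullet> col U 0)"
      unfolding Acol using U(1) that by simp
    also have "row (mat_adjoint U) i \<bullet> col U 0 = (mat_adjoint U * U) $$ (i, 0)" using that U(1) by simp
    finally show ?thesis using that by (simp add: U(2))
  qed
  have row0: "A' $$ (0, i) = (if i = 0 then cnj e else 0)" if "i < Suc n" for i
    using hermitian_entry[OF pd_hermitian[OF pd'], of 0 i] col0[OF that] that by simp
  define A3 where "A3 = mat n n (\<lambda>(i, j). A' $$ (Suc i, Suc j))"
  have A3c: "A3 \<in> carrier_mat n n" by (simp add: A3_def)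
  have ecnj: "cnj e = e" using col0[of 0] row0[of 0] by simp
  have A': "A' = four_block_mat (e \<cdot>\<^sub>m 1\<^sub>m 1) (0\<^sub>m 1 n) (0\<^sub>m n 1) A3"
    by (rule eq_matI) (use A'c col0 row0 ecnj in \<open>auto simp: A3_def less_Suc_eq_0_disj\<close>)
  define X where "X = mat (Suc n) n (\<lambda>(i, j). if i = Suc j then 1 else 0 :: complex)"
  have Xc: "X \<in> carrier_mat (Suc n) n" by (simp add: X_def)
  have "mat_adjoint X * A' * X = A3"
  proof (rule eq_matI)
    fix i j assume ij: "i < dim_row A3" "j < dim_col A3"
    then have ij': "i < n" "j < n" by (auto simp: A3_def)
    have "(mat_adjoint X * A') $$ (i, l) = A' $$ (Suc i, l)" if "l < Suc n" for l
    proof -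
      have "(mat_adjoint X * A') $$ (i, l) = (\<Sum>k<Suc n. cnj (X $$ (k, i)) * A' $$ (k, l))"
        using ij' A'c that Xc by (simp add: scalar_prod_def atLeast0LessThan del: sum.lessThan_Suc)
      also have "\<dots> = (\<Sum>k<Suc n. if k = Suc i then A' $$ (k, l) else 0)"
        using ij' by (intro sum.cong) (auto simp: X_def)
      finally show ?thesis using ij' by (simp del: sum.lessThan_Suc)
    qed
    note first = this
    have "(mat_adjoint X * A' * X) $$ (i, j) = (\<Sum>l<Suc n. (mat_adjoint X * A') $$ (i, l) * X $$ (l, j))"
      using ij' A'c Xc by (intro mat_mult_entry[of _ n "Suc n" _ n]) auto
    also have "\<dots> = (\<Sum>l<Suc n. if l = Suc j then A' $$ (Suc i, l) else 0)"
      using ij' first by (intro sum.cong) (auto simp: X_def)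
    also have "\<dots> = A3 $$ (i, j)" using ij' by (simp add: A3_def del: sum.lessThan_Suc)
    finally show "(mat_adjoint X * A' * X) $$ (i, j) = A3 $$ (i, j)" .
  qed (auto simp: X_def A3_def)
  moreover have "pd_mat n (mat_adjoint X * A' * X)"
  proof (rule pd_congruence[OF pd'])
    fix w :: "complex vec" assume w: "w \<in> carrier_vec n" "w \<noteq> 0\<^sub>v n"
    have "(X *\<^sub>v w) $ Suc i = w $ i" if "i < n" for i
    proof -
      have "(X *\<^sub>v w) $ Suc i = (\<Sum>k<n. if i = k then w $ k else 0)"
        using that w by (simp add: scalar_prod_def atLeast0LessThan X_def if_distrib if_distribR cong: if_cong)
      then show ?thesis using that by simp
    qed
    then show "X *\<^sub>v w \<noteq> 0\<^sub>v (Suc n)" using w by (metis Suc_less_eq carrier_vecD eq_vecI index_zero_vec)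
  qed (simp add: X_def)
  ultimately have "pd_mat n A3" by simp
  then obtain S3 where S3: "pd_mat n S3" "S3 * S3 = A3" using Suc.IH by blast
  note S3c = pd_carrier[OF S3(1)]
  have e: "0 < Re e" "Im e = 0"
  proof -
    show "Im e = 0" using col0[of 0] row0[of 0] by (simp add: complex_eq_iff)
    have "0 < Re ((A *\<^sub>v v) \<bullet>c v)" using Suc.prems ev by (auto simp: pd_mat_def)
    also have "(A *\<^sub>v v) \<bullet>c v = e * (v \<bullet>c v)" using ev by simp
    also have "Re (e * (v \<bullet>c v)) = Re e * Re (v \<bullet>c v)" using \<open>Im e = 0\<close> by simp
    finally show "0 < Re e" using cscalar_self_nonneg[of v] by (simp add: zero_less_mult_iff)
  qed
  define f where "f = complex_of_real (sqrt (Re e))"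
  have ff: "f * f = e" using e by (simp add: f_def complex_eq_iff)
  define S' where "S' = four_block_mat (f \<cdot>\<^sub>m 1\<^sub>m 1) (0\<^sub>m 1 n) (0\<^sub>m n 1) S3"
  have pdS': "pd_mat (Suc n) S'"
    using pd_block_diag[OF pd_smult[OF pd_one, of "sqrt (Re e)" 1] S3(1)] e by (simp add: S'_def f_def)
  note S'c = pd_carrier[OF pdS']
  have S'2: "S' * S' = A'"
    unfolding S'_def A' using S3c A3c
    by (subst mult_four_block_mat[of _ 1 1 _ n _ n _ _ 1 _ n]) (auto simp: S3(2) ff mat_expand)
  define S where "S = mat_adjoint (mat_adjoint U) * S' * mat_adjoint U"
  have "pd_mat (Suc n) S"
    unfolding S_def
    by (rule pd_congruence[OF pdS' Ua]) (use mat_vec_nonzero[OF Ua dU(2)] in auto)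
  moreover have "S * S = A"
  proof -
    have "S * S = U * (S' * (mat_adjoint U * U) * S') * mat_adjoint U"
      unfolding S_def using U(1) Ua S'c by (simp add: mat_mult_assoc)
    also have "\<dots> = U * A' * mat_adjoint U" using S'c by (simp add: U(2) S'2)
    also have "\<dots> = (U * mat_adjoint U) * A * (U * mat_adjoint U)"
      unfolding A'_def using U(1) Ua A by (simp add: mat_mult_assoc)
    also have "\<dots> = A" using A by (simp add: UU)
    finally show ?thesis .
  qed
  ultimately show ?case by blast
qed

text \<open>With \<open>S = R\<^sup>2\<close> the form of \<open>S\<close> is \<open>|R v|\<^sup>2\<close>, and \<open>|v|\<close> is at most a multiple of \<open>|R v|\<close> because \<open>R\<close> is invertible.\<close>

lemma pd_lower_bound:
  assumes "pd_mat n S"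
  obtains \<kappa> where "0 < \<kappa>"
    "\<And>v. v \<in> carrier_vec n \<Longrightarrow> \<kappa> * (\<Sum>i<n. (cmod (v $ i))\<^sup>2) \<le> Re ((S *\<^sub>v v) \<bullet>c v)"
proof -
  obtain R where R: "pd_mat n R" "R * R = S" using pd_sqrt_exists[OF assms] by blast
  note Rc = pd_carrier[OF R(1)]
  note I = minv_works[OF Rc pd_det[OF R(1)]]
  define c where "c = 1 + (\<Sum>i<n. \<Sum>k<n. cmod (minv R $$ (i, k)))"
  have c: "1 \<le> c" by (simp add: c_def sum_nonneg)
  (* The successor keeps the constant meaningful for matrices of size 0. *)
  have "1 / (real (Suc n) * c\<^sup>2) * (\<Sum>i<n. (cmod (v $ i))\<^sup>2) \<le> Re ((S *\<^sub>v v) \<bullet>c v)"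
    if v: "v \<in> carrier_vec n" for v
  proof -
    define w where "w = R *\<^sub>v v"
    have w: "w \<in> carrier_vec n" using Rc v by (simp add: w_def)
    have "(S *\<^sub>v v) \<bullet>c v = ((mat_adjoint R * 1\<^sub>m n * R) *\<^sub>v v) \<bullet>c v"
      using Rc by (simp add: pd_adjoint[OF R(1)] R(2))
    also have "\<dots> = w \<bullet>c w"
      using w by (simp add: form_congruence[OF one_carrier_mat Rc v] flip: w_def)
    finally have form: "Re ((S *\<^sub>v v) \<bullet>c v) = (\<Sum>i<n. (cmod (w $ i))\<^sup>2)"
      using w by (simp add: cscalar_self del: of_real_sum)
    let ?W = "sqrt (\<Sum>i<n. (cmod (w $ i))\<^sup>2)"
    have W0: "0 \<le> (\<Sum>i<n. (cmod (w $ i))\<^sup>2)" by (simp add: sum_nonneg)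
    have wi: "cmod (w $ i) \<le> ?W" if "i < n" for i
      using that member_le_sum[of i "{..<n}" "\<lambda>i. (cmod (w $ i))\<^sup>2"] by (intro real_le_rsqrt) auto
    have vw: "v = minv R *\<^sub>v w"
      unfolding w_def assoc_mult_mat_vec[OF I(1) Rc v, symmetric] I(3) using v by simp
    have vi: "cmod (v $ i) \<le> c * ?W" if "i < n" for i
    proof -
      have "v $ i = (\<Sum>k<n. minv R $$ (i, k) * w $ k)"
        unfolding vw using I(1) w that by (simp del: index_mult_mat_vec add: mat_vec_index)
      also have "cmod \<dots> \<le> (\<Sum>k<n. cmod (minv R $$ (i, k)) * ?W)"
        by (intro sum_norm_le) (auto simp: norm_mult intro!: mult_left_mono wi)
      also have "\<dots> = (\<Sum>k<n. cmod (minv R $$ (i, k))) * ?W" by (simp add: sum_distrib_right)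
      also have "(\<Sum>k<n. cmod (minv R $$ (i, k))) \<le> c"
        unfolding c_def
        using member_le_sum[of i "{..<n}" "\<lambda>i. \<Sum>k<n. cmod (minv R $$ (i, k))"] that by (simp add: sum_nonneg)
      finally show ?thesis using W0 by (simp add: mult_right_mono)
    qed
    have "(\<Sum>i<n. (cmod (v $ i))\<^sup>2) \<le> (\<Sum>i<n. (c * ?W)\<^sup>2)"
      by (intro sum_mono power_mono vi) auto
    also have "\<dots> = real n * c\<^sup>2 * (\<Sum>i<n. (cmod (w $ i))\<^sup>2)" using W0 by (simp add: power_mult_distrib)
    also have "\<dots> \<le> real (Suc n) * c\<^sup>2 * (\<Sum>i<n. (cmod (w $ i))\<^sup>2)"
      using W0 by (intro mult_right_mono) auto
    finally have "(\<Sum>i<n. (cmod (v $ i))\<^sup>2) \<le> (\<Sum>i<n. (cmod (w $ i))\<^sup>2) * (real (Suc n) * c\<^sup>2)"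
      by (simp only: mult.commute)
    moreover have "0 < real (Suc n) * c\<^sup>2" using c by simp
    ultimately show ?thesis unfolding form by (simp only: mult_1 times_divide_eq_left pos_divide_le_eq)
  qed
  moreover have "0 < 1 / (real (Suc n) * c\<^sup>2)" using c by simp
  ultimately show thesis by (rule that[rotated])
qed

text \<open>A submultiplicative norm on matrices of every size, with elementary bounds by entries.\<close>

definition mnorm :: "complex mat \<Rightarrow> real" where
  "mnorm A = (\<Sum>i<dim_row A. \<Sum>j<dim_col A. cmod (A $$ (i, j)))"

lemma mnorm_nonneg [simp]: "0 \<le> mnorm A"
  by (simp add: mnorm_def sum_nonneg)

lemma entry_le_mnorm: assumes "i < dim_row A" "j < dim_col A" shows "cmod (A $$ (i, j)) \<le> mnorm A"
proof -
  have "cmod (A $$ (i, j)) \<le> (\<Sum>j<dim_col A. cmod (A $$ (i, j)))"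
    using assms member_le_sum[of j "{..<dim_col A}" "\<lambda>j. cmod (A $$ (i, j))"] by simp
  also have "\<dots> \<le> mnorm A"
    unfolding mnorm_def using assms member_le_sum[of i "{..<dim_row A}" "\<lambda>i. \<Sum>j<dim_col A. cmod (A $$ (i, j))"]
    by (simp add: sum_nonneg)
  finally show ?thesis .
qed

lemma trace_commute:
  fixes A :: "complex mat"
  assumes "A \<in> carrier_mat n n" "B \<in> carrier_mat n n"
  shows "(\<Sum>i<n. (A * B) $$ (i, i)) = (\<Sum>i<n. (B * A) $$ (i, i))"
proof -
  have "(\<Sum>i<n. (A * B) $$ (i, i)) = (\<Sum>i<n. \<Sum>k<n. A $$ (i, k) * B $$ (k, i))"
    using assms by (simp add: scalar_prod_def atLeast0LessThan)
  also have "\<dots> = (\<Sum>k<n. \<Sum>i<n. A $$ (i, k) * B $$ (k, i))" by (rule sum.swap)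
  also have "\<dots> = (\<Sum>i<n. (B * A) $$ (i, i))"
    using assms by (simp add: scalar_prod_def atLeast0LessThan mult.commute)
  finally show ?thesis .
qed

text \<open>The diagonal entries of \<open>X\<^sup>* A X\<close> are values of the form of \<open>A\<close>; their sum is the trace that \<open>sqrt_lipschitz\<close> estimates.\<close>

lemma congruence_diag_entry:
  fixes A :: "complex mat"
  assumes "A \<in> carrier_mat n n" "X \<in> carrier_mat n k" "i < k"
  shows "(mat_adjoint X * (A * X)) $$ (i, i) = (A *\<^sub>v col X i) \<bullet>c col X i"
proof -
  have "(mat_adjoint X * (A * X)) $$ (i, i) = (\<Sum>j<n. cnj (X $$ (j, i)) * (A * X) $$ (j, i))"
    using assms by (subst mat_mult_entry[of _ k n _ k]) auto
  also have "\<dots> = (\<Sum>j<n. (A *\<^sub>v col X i) $ j * cnj (col X i $ j))"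
    using assms by (simp add: mult.commute)
  also have "\<dots> = (A *\<^sub>v col X i) \<bullet>c col X i" using assms by (simp add: cscalar_sum)
  finally show ?thesis .
qed

text \<open>The square root is Lipschitz near a matrix \<open>T\<^sup>2\<close> with \<open>T \<ge> \<kappa>\<close>: the difference
  \<open>X = S - T\<close> satisfies \<open>X S + T X = S\<^sup>2 - T\<^sup>2\<close>, and the trace of \<open>X (X S + T X)\<close> is at least
  \<open>\<kappa>\<close> times the sum of the squared entries of \<open>X\<close>.\<close>

lemma sqrt_lipschitz:
  assumes S: "psd_mat n S" and T: "hermitian_mat n T" and \<kappa>: "0 < \<kappa>"
    and low: "\<And>v. v \<in> carrier_vec n \<Longrightarrow> \<kappa> * (\<Sum>i<n. (cmod (v $ i))\<^sup>2) \<le> Re ((T *\<^sub>v v) \<bullet>c v)"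
    and ij: "i < n" "j < n"
  shows "cmod (S $$ (i, j) - T $$ (i, j)) \<le> mnorm (S * S - T * T) / \<kappa>"
proof -
  note Sc = psd_carrier[OF S] and Tc = hermitian_carrier[OF T]
  define X where "X = S - T"
  define D where "D = S * S - T * T"
  have Xc: "X \<in> carrier_mat n n" and Dc: "D \<in> carrier_mat n n" using Sc Tc by (auto simp: X_def D_def)
  have Xa: "mat_adjoint X = X"
    unfolding X_def using Sc Tc by (simp add: mat_adjoint_minus psd_adjoint[OF S] hermitian_adjoint[OF T])
  have D: "D = X * S + T * X"
    unfolding D_def X_def using Sc Tc
    by (simp add: mat_minus_mult mat_mult_minus del: index_mult_mat(1)) (rule eq_matI, simp_all del: index_mult_mat(1))
  define F where "F = (\<Sum>i<n. \<Sum>k<n. (cmod (X $$ (k, i)))\<^sup>2)"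
  have F0: "0 \<le> F" by (simp add: F_def sum_nonneg)
  have XF: "cmod (X $$ (k, i)) \<le> sqrt F" if "i < n" "k < n" for i k
  proof -
    have "(cmod (X $$ (k, i)))\<^sup>2 \<le> (\<Sum>k<n. (cmod (X $$ (k, i)))\<^sup>2)"
      using that member_le_sum[of k "{..<n}" "\<lambda>k. (cmod (X $$ (k, i)))\<^sup>2"] by simp
    also have "\<dots> \<le> F" unfolding F_def
      using that member_le_sum[of i "{..<n}" "\<lambda>i. \<Sum>k<n. (cmod (X $$ (k, i)))\<^sup>2"] by (simp add: sum_nonneg)
    finally show ?thesis by (rule real_le_rsqrt)
  qed
  have XDsplit: "X * D = X * (X * S) + X * (T * X)"
    unfolding D using Xc Sc Tc by (simp add: mat_mult_add)
  have "(\<Sum>i<n. (X * D) $$ (i, i)) = (\<Sum>i<n. (X * (X * S)) $$ (i, i)) + (\<Sum>i<n. (X * (T * X)) $$ (i, i))"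
    unfolding XDsplit using Xc Sc Tc by (simp add: sum.distrib del: index_mult_mat(1))
  also have "(\<Sum>i<n. (X * (X * S)) $$ (i, i)) = (\<Sum>i<n. (X * (S * X)) $$ (i, i))"
    using trace_commute[of X n "X * S"] Xc Sc by (simp add: mat_mult_assoc del: index_mult_mat(1))
  also have "(\<Sum>i<n. (X * (S * X)) $$ (i, i)) + (\<Sum>i<n. (X * (T * X)) $$ (i, i))
      = (\<Sum>i<n. (S *\<^sub>v col X i) \<bullet>c col X i) + (\<Sum>i<n. (T *\<^sub>v col X i) \<bullet>c col X i)"
    using congruence_diag_entry[OF Sc Xc] congruence_diag_entry[OF Tc Xc] by (simp add: Xa del: index_mult_mat(1))
  finally have tr: "(\<Sum>i<n. (X * D) $$ (i, i))
      = (\<Sum>i<n. (S *\<^sub>v col X i) \<bullet>c col X i) + (\<Sum>i<n. (T *\<^sub>v col X i) \<bullet>c col X i)" .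
  have "\<kappa> * F = (\<Sum>i<n. \<kappa> * (\<Sum>k<n. (cmod (col X i $ k))\<^sup>2))"
    unfolding F_def sum_distrib_left using Xc by simp
  also have "\<dots> \<le> (\<Sum>i<n. Re ((S *\<^sub>v col X i) \<bullet>c col X i) + Re ((T *\<^sub>v col X i) \<bullet>c col X i))"
  proof (intro sum_mono)
    fix i assume "i \<in> {..<n}"
    then have c: "col X i \<in> carrier_vec n" using Xc by simp
    show "\<kappa> * (\<Sum>k<n. (cmod (col X i $ k))\<^sup>2) \<le> Re ((S *\<^sub>v col X i) \<bullet>c col X i) + Re ((T *\<^sub>v col X i) \<bullet>c col X i)"
      using low[OF c] S c unfolding psd_mat_def by fastforce
  qed
  also have "\<dots> = Re (\<Sum>i<n. (X * D) $$ (i, i))" unfolding tr by (simp add: sum.distrib)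
  also have "\<dots> \<le> cmod (\<Sum>i<n. (X * D) $$ (i, i))" by (rule complex_Re_le_cmod)
  also have "\<dots> \<le> (\<Sum>i<n. \<Sum>k<n. sqrt F * cmod (D $$ (k, i)))"
  proof (intro sum_norm_le)
    fix i assume i: "i \<in> {..<n}"
    have "(X * D) $$ (i, i) = (\<Sum>k<n. X $$ (i, k) * D $$ (k, i))"
      using i Xc Dc by (simp add: scalar_prod_def atLeast0LessThan)
    also have "cmod \<dots> \<le> (\<Sum>k<n. sqrt F * cmod (D $$ (k, i)))"
      using i by (intro sum_norm_le) (auto simp: norm_mult intro!: mult_right_mono XF)
    finally show "cmod ((X * D) $$ (i, i)) \<le> (\<Sum>k<n. sqrt F * cmod (D $$ (k, i)))" .
  qed
  also have "\<dots> = sqrt F * mnorm D"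
    unfolding mnorm_def using Dc by (simp add: sum_distrib_left) (rule sum.swap)
  finally have "\<kappa> * sqrt F * sqrt F \<le> sqrt F * mnorm D" using F0 by (simp add: mult.assoc)
  then have "sqrt F \<le> mnorm D / \<kappa>"
  proof (cases "F = 0")
    case False
    have "sqrt F * (\<kappa> * sqrt F) \<le> sqrt F * mnorm D" using \<open>\<kappa> * sqrt F * sqrt F \<le> _\<close> by (simp only: ac_simps)
    then have "\<kappa> * sqrt F \<le> mnorm D" using False F0 by (simp only: mult_le_cancel_left) simp
    then show ?thesis using \<kappa> by (simp add: pos_le_divide_eq mult.commute)
  qed (use \<kappa> in simp)
  then show ?thesis using XF[OF ij(2,1)] ij Sc Tc by (simp add: X_def D_def)
qed

lemma pd_sqrt_unique:
  assumes "pd_mat n S" "pd_mat n T" "S * S = T * T"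
  shows "S = T"
proof (rule eq_matI)
  note c = pd_carrier[OF assms(1)] pd_carrier[OF assms(2)]
  obtain \<kappa> where k: "0 < \<kappa>"
    "\<And>v. v \<in> carrier_vec n \<Longrightarrow> \<kappa> * (\<Sum>i<n. (cmod (v $ i))\<^sup>2) \<le> Re ((T *\<^sub>v v) \<bullet>c v)"
    using pd_lower_bound[OF assms(2)] by blast
  have "mnorm (S * S - T * T) = 0" unfolding assms(3) mnorm_def using c by simp
  then show "S $$ (i, j) = T $$ (i, j)" if "i < dim_row T" "j < dim_col T" for i j
    using sqrt_lipschitz[OF pd_imp_psd[OF assms(1)] pd_hermitian[OF assms(2)] k] that c by fastforce
qed (use pd_carrier[OF assms(1)] pd_carrier[OF assms(2)] in auto)

lemma inv_sqrt:
  assumes "pd_mat n A"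
  shows inv_sqrt_pd: "pd_mat n (inv_sqrt_mat n A)"
    and inv_sqrt_square: "inv_sqrt_mat n A * inv_sqrt_mat n A = minv A"
proof -
  obtain S where S: "pd_mat n S" "S * S = minv A" using pd_sqrt_exists[OF pd_minv[OF assms]] by blast
  have "pd_mat n (inv_sqrt_mat n A) \<and> inv_sqrt_mat n A * inv_sqrt_mat n A = minv A"
    unfolding inv_sqrt_mat_def by (rule theI[of _ S]) (use S pd_sqrt_unique in metis)+
  then show "pd_mat n (inv_sqrt_mat n A)" "inv_sqrt_mat n A * inv_sqrt_mat n A = minv A" by auto
qed

section \<open>Entrywise limits\<close>

lemma det_tendsto:
  assumes "\<And>k. A k \<in> carrier_mat n n" "L \<in> carrier_mat n n"
    "\<And>i j. i < n \<Longrightarrow> j < n \<Longrightarrow> ((\<lambda>k. A k $$ (i, j)) \<longlongrightarrow> L $$ (i, j)) F"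
  shows "((\<lambda>k. det (A k)) \<longlongrightarrow> det (L :: complex mat)) F"
  unfolding det_def'[OF assms(1)] det_def'[OF assms(2)]
  by (intro tendsto_sum tendsto_mult tendsto_prod tendsto_const assms(3))
     (auto simp: permutes_in_image)

lemma cofactor_tendsto:
  assumes A: "\<And>k. A k \<in> carrier_mat n n" and L: "L \<in> carrier_mat n n"
    and lim: "\<And>i j. i < n \<Longrightarrow> j < n \<Longrightarrow> ((\<lambda>k. A k $$ (i, j)) \<longlongrightarrow> L $$ (i, j)) F"
    and ij: "i < n" "j < n"
  shows "((\<lambda>k. cofactor (A k) i j) \<longlongrightarrow> cofactor (L :: complex mat) i j) F"
  unfolding cofactor_def
proof (intro tendsto_mult tendsto_const det_tendsto[where n = "n - 1"])
  show "((\<lambda>k. mat_delete (A k) i j $$ (i', j')) \<longlongrightarrow> mat_delete L i j $$ (i', j')) F"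
    if "i' < n - 1" "j' < n - 1" for i' j'
    using that carrier_matD[OF L] carrier_matD[OF A] unfolding mat_delete_def by (auto intro!: lim)
qed (use A L mat_delete_carrier in blast)+

lemma minv_tendsto:
  assumes A: "\<And>k. A k \<in> carrier_mat n n" and L: "L \<in> carrier_mat n n" "det L \<noteq> 0"
    and dA: "\<And>k. det (A k) \<noteq> 0"
    and lim: "\<And>i j. i < n \<Longrightarrow> j < n \<Longrightarrow> ((\<lambda>k. A k $$ (i, j)) \<longlongrightarrow> L $$ (i, j)) F"
    and ij: "i < n" "j < n"
  shows "((\<lambda>k. minv (A k) $$ (i, j)) \<longlongrightarrow> minv L $$ (i, j)) F"
  unfolding minv_entry[OF A dA ij] minv_entry[OF L ij]
  by (intro tendsto_divide cofactor_tendsto[OF A L(1) lim] det_tendsto[OF A L(1) lim] L(2) ij)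

lemma mult_tendsto:
  assumes "\<And>k. A k \<in> carrier_mat n1 n2" "\<And>k. B k \<in> carrier_mat n2 n3"
    "L \<in> carrier_mat n1 n2" "M \<in> carrier_mat n2 n3"
    "\<And>i j. i < n1 \<Longrightarrow> j < n2 \<Longrightarrow> ((\<lambda>k. A k $$ (i, j)) \<longlongrightarrow> L $$ (i, j)) F"
    "\<And>i j. i < n2 \<Longrightarrow> j < n3 \<Longrightarrow> ((\<lambda>k. B k $$ (i, j)) \<longlongrightarrow> M $$ (i, j)) F"
    and ij: "i < n1" "j < n3"
  shows "((\<lambda>k. (A k * B k) $$ (i, j)) \<longlongrightarrow> (L * M :: complex mat) $$ (i, j)) F"
proof -
  have e: "(A k * B k) $$ (i, j) = (\<Sum>l<n2. A k $$ (i, l) * B k $$ (l, j))" for k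
    using assms(1)[of k] assms(2)[of k] ij by (simp add: scalar_prod_def atLeast0LessThan)
  have e': "(L * M) $$ (i, j) = (\<Sum>l<n2. L $$ (i, l) * M $$ (l, j))"
    using assms(3,4) ij by (simp add: scalar_prod_def atLeast0LessThan)
  show ?thesis unfolding e e'
    by (intro tendsto_sum tendsto_mult assms(5,6) ij) auto
qed

text \<open>The lower bound in \<open>sqrt_lipschitz\<close> is taken from the root of the limit, so that the constant is the same for all \<open>k\<close>.\<close>

lemma inv_sqrt_tendsto:
  assumes A: "\<And>k. pd_mat n (A k)" and L: "pd_mat n L"
    and lim: "\<And>i j. i < n \<Longrightarrow> j < n \<Longrightarrow> ((\<lambda>k. A k $$ (i, j)) \<longlongrightarrow> L $$ (i, j)) F"
    and ij: "i < n" "j < n"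
  shows "((\<lambda>k. inv_sqrt_mat n (A k) $$ (i, j)) \<longlongrightarrow> inv_sqrt_mat n L $$ (i, j)) F"
proof -
  obtain \<kappa> where k: "0 < \<kappa>"
    "\<And>v. v \<in> carrier_vec n \<Longrightarrow> \<kappa> * (\<Sum>i<n. (cmod (v $ i))\<^sup>2) \<le> Re ((inv_sqrt_mat n L *\<^sub>v v) \<bullet>c v)"
    using pd_lower_bound[OF inv_sqrt_pd[OF L]] by blast
  have c: "minv (A k) \<in> carrier_mat n n" "minv L \<in> carrier_mat n n" for k
    using pd_carrier[OF pd_minv[OF A]] pd_carrier[OF pd_minv[OF L]] by auto
  have e: "mnorm (minv (A k) - minv L) = (\<Sum>i<n. \<Sum>j<n. cmod (minv (A k) $$ (i, j) - minv L $$ (i, j)))" for k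
    unfolding mnorm_def using c(1)[of k] c(2) by simp
  have "((\<lambda>k. mnorm (minv (A k) - minv L)) \<longlongrightarrow> (\<Sum>i<n. \<Sum>j<n. cmod (minv L $$ (i, j) - minv L $$ (i, j)))) F"
    unfolding e
    by (intro tendsto_sum tendsto_norm tendsto_diff tendsto_const
          minv_tendsto[OF pd_carrier[OF A] pd_carrier[OF L] pd_det[OF L] pd_det[OF A] lim]) auto
  then have 0: "((\<lambda>k. mnorm (minv (A k) - minv L) / \<kappa>) \<longlongrightarrow> 0) F"
    by (simp add: tendsto_divide_zero)
  have "cmod (inv_sqrt_mat n (A k) $$ (i, j) - inv_sqrt_mat n L $$ (i, j)) \<le> mnorm (minv (A k) - minv L) / \<kappa>" for k
    using sqrt_lipschitz[OF pd_imp_psd[OF inv_sqrt_pd[OF A]] pd_hermitian[OF inv_sqrt_pd[OF L]] k ij]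
    by (simp add: inv_sqrt_square[OF A] inv_sqrt_square[OF L])
  then have "((\<lambda>k. inv_sqrt_mat n (A k) $$ (i, j) - inv_sqrt_mat n L $$ (i, j)) \<longlongrightarrow> 0) F"
    by (intro Lim_null_comparison[OF _ 0]) auto
  then show ?thesis by (simp add: LIM_zero_iff)
qed

section \<open>Schur complements\<close>

lemma minv_hermitian:
  assumes "hermitian_mat n P" "det P \<noteq> 0"
  shows "mat_adjoint (minv P) = minv P"
  using minv_adjoint[OF hermitian_carrier[OF assms(1)] assms(2)] hermitian_adjoint[OF assms(1)] by simp

text \<open>The unit triangular congruence \<open>Q = M\<^sup>* diag(P, K) M\<close> with
  \<open>K = C - B\<^sup>* P\<^sup>-\<^sup>1 B\<close> carries positivity and inverses across the bordering of \<open>P\<close> to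
  \<open>Q = (P, B; B\<^sup>*, C)\<close>. Its inverse \<open>N\<close> is \<open>M\<close> with the off-diagonal block negated.\<close>

context
  fixes n m :: nat and P B C :: "complex mat"
  assumes P: "pd_mat n P" and B: "B \<in> carrier_mat n m" and C: "hermitian_mat m C"
begin

private definition "K = C - mat_adjoint B * (minv P * B)"
private definition "M = four_block_mat (1\<^sub>m n) (minv P * B) (0\<^sub>m m n) (1\<^sub>m m)"
private definition "N = four_block_mat (1\<^sub>m n) (- (minv P * B)) (0\<^sub>m m n) (1\<^sub>m m)"

private lemma carriers:
  "P \<in> carrier_mat n n" "minv P \<in> carrier_mat n n" "C \<in> carrier_mat m m" "K \<in> carrier_mat m m"
  "mat_adjoint B \<in> carrier_mat m n" "minv P * B \<in> carrier_mat n m"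
  "mat_adjoint (minv P * B) \<in> carrier_mat m n"
  "M \<in> carrier_mat (n + m) (n + m)" "N \<in> carrier_mat (n + m) (n + m)"
  "mat_adjoint B * (minv P * B) \<in> carrier_mat m m"
proof -
  note c = pd_carrier[OF P] minv_carrier[OF pd_carrier[OF P] pd_det[OF P]] hermitian_carrier[OF C]
  show 1: "P \<in> carrier_mat n n" "minv P \<in> carrier_mat n n" "C \<in> carrier_mat m m" using c by auto
  show 2: "mat_adjoint B \<in> carrier_mat m n" "minv P * B \<in> carrier_mat n m" using c B by auto
  show 3: "mat_adjoint B * (minv P * B) \<in> carrier_mat m m" using 2 by auto
  show "K \<in> carrier_mat m m" unfolding K_def using 1 3 by (intro minus_carrier_mat)
  show "mat_adjoint (minv P * B) \<in> carrier_mat m n" using 2 by simp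
  show "M \<in> carrier_mat (n + m) (n + m)" "N \<in> carrier_mat (n + m) (n + m)"
    unfolding M_def N_def by (intro four_block_carrier_mat one_carrier_mat)+
qed

private lemma adj_PB: "mat_adjoint (minv P * B) = mat_adjoint B * minv P"
  using carriers B by (simp add: mat_adjoint_mult minv_hermitian[OF pd_hermitian[OF P] pd_det[OF P]])

private lemma MN: "M * N = 1\<^sub>m (n + m)" and NM: "N * M = 1\<^sub>m (n + m)"
proof -
  show "M * N = 1\<^sub>m (n + m)" unfolding M_def N_def using carriers
    by (subst mult_four_block_mat[of _ n n _ m _ m _ _ n _ m]) (simp_all add: mat_zero_simps mat_uminus_add_self)
  then show "N * M = 1\<^sub>m (n + m)" by (rule mat_mult_left_right_inverse[OF carriers(8,9)])
qed

private abbreviation (input) "Q \<equiv> four_block_mat P B (mat_adjoint B) C"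
private abbreviation (input) "DK \<equiv> four_block_mat P (0\<^sub>m n m) (0\<^sub>m m n) K"

private lemma Q_factor: "Q = mat_adjoint M * DK * M"
proof -
  have Ma: "mat_adjoint M = four_block_mat (1\<^sub>m n) (0\<^sub>m n m) (mat_adjoint B * minv P) (1\<^sub>m m)"
    unfolding M_def using carriers by (subst four_block_adjoint[of _ n n _ m _ m]) (auto simp: adj_PB)
  have PB: "P * (minv P * B) = B" "mat_adjoint B * (minv P * P) = mat_adjoint B"
    using carriers(5) by (simp_all add: minv_cancel(2)[OF carriers(1) pd_det[OF P] B] minv_left[OF carriers(1) pd_det[OF P]])
  have "mat_adjoint M * DK = four_block_mat P (0\<^sub>m n m) (mat_adjoint B) K"
    unfolding Ma using carriers PB
    by (subst mult_four_block_mat[of _ n n _ m _ m _ _ n _ m])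
      (simp_all add: mat_mult_assoc mat_zero_simps)
  then show ?thesis
    unfolding M_def using carriers PB B
    by (simp only:) (subst mult_four_block_mat[of _ n n _ m _ m _ _ n _ m],
      simp_all add: mat_mult_assoc mat_zero_simps K_def mat_add_minus_cancel)
qed

private lemma DK_factor: "DK = mat_adjoint N * Q * N"
proof -
  have NaMa: "mat_adjoint N * mat_adjoint M = 1\<^sub>m (n + m)"
    using carriers MN by (simp flip: mat_adjoint_mult)
  have DK: "DK \<in> carrier_mat (n + m) (n + m)" using carriers by simp
  have "mat_adjoint N * Q * N = (mat_adjoint N * mat_adjoint M) * DK * (M * N)"
    unfolding Q_factor using carriers DK by (simp add: mat_mult_assoc)
  then show ?thesis unfolding NaMa MN left_mult_one_mat[OF DK] right_mult_one_mat[OF DK] by simp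
qed

private lemma K_hermitian: "hermitian_mat m K"
proof -
  have "mat_adjoint (mat_adjoint B * (minv P * B)) = mat_adjoint B * (minv P * B)"
    using carriers B
    by (simp add: mat_adjoint_mult minv_hermitian[OF pd_hermitian[OF P] pd_det[OF P]] mat_mult_assoc)
  then have "mat_adjoint K = K"
    unfolding K_def using carriers B by (simp add: mat_adjoint_minus hermitian_adjoint[OF C])
  then show ?thesis using carriers by (simp add: hermitian_mat_def)
qed

private lemma form_K:
  assumes "v \<in> carrier_vec m"
  shows "(DK *\<^sub>v (0\<^sub>v n @\<^sub>v v)) \<bullet>c (0\<^sub>v n @\<^sub>v v) = (K *\<^sub>v v) \<bullet>c v"
  using carriers assms by (subst form_block_diag) auto

lemma pd_schur_complement:
  assumes "pd_mat (n + m) (four_block_mat P B (mat_adjoint B) C)"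
  shows "pd_mat m (C - mat_adjoint B * (minv P * B))"
  unfolding K_def[symmetric] pd_mat_def
proof (intro conjI ballI impI)
  have DK: "pd_mat (n + m) DK"
    unfolding DK_factor
    by (rule pd_congruence[OF assms carriers(9)])
      (rule mat_vec_nonzero[OF carriers(9) det_nonzero_right_inverse(2)[OF carriers(8,9) MN]])
  fix v :: "complex vec" assume v: "v \<in> carrier_vec m" "v \<noteq> 0\<^sub>v m"
  have "0\<^sub>v n @\<^sub>v v \<in> carrier_vec (n + m)" using v by simp
  moreover have "0\<^sub>v n @\<^sub>v v \<noteq> 0\<^sub>v (n + m)"
  proof
    assume 0: "0\<^sub>v n @\<^sub>v v = 0\<^sub>v (n + m)"
    have "v $ i = 0" if "i < m" for i
      using arg_cong[OF 0, of "\<lambda>w. w $ (n + i)"] that v by simp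
    then show False using v by (metis carrier_vecD eq_vecI index_zero_vec)
  qed
  ultimately show "0 < Re ((K *\<^sub>v v) \<bullet>c v)" using DK form_K[OF v(1)] unfolding pd_mat_def by metis
qed (fact K_hermitian)

lemma psd_schur_complement:
  assumes "psd_mat (n + m) (four_block_mat P B (mat_adjoint B) C)"
  shows "psd_mat m (C - mat_adjoint B * (minv P * B))"
  unfolding K_def[symmetric] psd_mat_def
proof (intro conjI ballI impI)
  have DK: "psd_mat (n + m) DK"
    unfolding DK_factor by (rule psd_congruence[OF assms carriers(9)])
  fix v :: "complex vec" assume v: "v \<in> carrier_vec m"
  then have "0\<^sub>v n @\<^sub>v v \<in> carrier_vec (n + m)" by simp
  then show "0 \<le> Re ((K *\<^sub>v v) \<bullet>c v)" using DK form_K[OF v] unfolding psd_mat_def by metis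
qed (fact K_hermitian)

lemma pd_from_schur_complement:
  assumes "pd_mat m (C - mat_adjoint B * (minv P * B))"
  shows "pd_mat (n + m) (four_block_mat P B (mat_adjoint B) C)"
  unfolding Q_factor
  by (rule pd_congruence[OF pd_block_diag[OF P assms[folded K_def]] carriers(8)])
    (rule mat_vec_nonzero[OF carriers(8) det_nonzero_right_inverse(1)[OF carriers(8,9) MN]])

text \<open>The inverse of the bordered matrix is \<open>N diag(P\<^sup>-\<^sup>1, K\<^sup>-\<^sup>1) N\<^sup>*\<close>, and \<open>N\<^sup>*\<close> replaces the last block of a column by its residual.\<close>

lemma gram_schur_complement:
  assumes "pd_mat m (C - mat_adjoint B * (minv P * B))"
    and F: "f \<in> carrier_mat n k" "f' \<in> carrier_mat m k" and G: "g \<in> carrier_mat n k" "g' \<in> carrier_mat m k"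
  shows "mat_adjoint (f @\<^sub>r f') * (minv (four_block_mat P B (mat_adjoint B) C) * (g @\<^sub>r g'))
    = mat_adjoint f * (minv P * g)
     + mat_adjoint (f' - mat_adjoint B * (minv P * f))
        * (minv (C - mat_adjoint B * (minv P * B)) * (g' - mat_adjoint B * (minv P * g)))"
proof -
  have K: "pd_mat m K" using assms(1) by (simp add: K_def)
  have Kc: "minv K \<in> carrier_mat m m" using minv_carrier[OF pd_carrier[OF K] pd_det[OF K]] .
  define E where "E = four_block_mat (minv P) (0\<^sub>m n m) (0\<^sub>m m n) (minv K)"
  have E: "E \<in> carrier_mat (n + m) (n + m)" using carriers Kc by (simp add: E_def)
  have DK: "DK \<in> carrier_mat (n + m) (n + m)" using carriers by simp
  have Qc: "Q \<in> carrier_mat (n + m) (n + m)" using carriers by simp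
  have DKE: "DK * E = 1\<^sub>m (n + m)"
    unfolding E_def using carriers Kc
    by (subst mult_four_block_mat[of _ n n _ m _ m _ _ n _ m])
      (simp_all add: minv_right[OF carriers(1) pd_det[OF P]]
        minv_right[OF pd_carrier[OF K] pd_det[OF K]] mat_zero_simps)
  have Na: "mat_adjoint N \<in> carrier_mat (n + m) (n + m)" using carriers by simp
  have MaNa: "mat_adjoint M * mat_adjoint N = 1\<^sub>m (n + m)"
    using carriers NM by (simp flip: mat_adjoint_mult)
  have "minv Q = N * E * mat_adjoint N"
  proof (rule minv_eqI[OF Qc])
    have "Q * (N * E * mat_adjoint N) = mat_adjoint M * (DK * (M * N) * E) * mat_adjoint N"
      unfolding Q_factor using carriers E DK by (simp add: mat_mult_assoc)
    also have "\<dots> = mat_adjoint M * mat_adjoint N"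
      using DK carriers by (simp add: MN DKE)
    finally show "Q * (N * E * mat_adjoint N) = 1\<^sub>m (n + m)" by (simp add: MaNa)
  qed (use carriers E in auto)
  have Na': "mat_adjoint N = four_block_mat (1\<^sub>m n) (0\<^sub>m n m) (- (mat_adjoint B * minv P)) (1\<^sub>m m)"
    unfolding N_def using carriers
    by (subst four_block_adjoint[of _ n n _ m _ m]) (auto simp: adj_PB mat_adjoint_uminus)
  have NaF: "mat_adjoint N * (h @\<^sub>r h') = h @\<^sub>r (h' - mat_adjoint B * (minv P * h))"
    if h: "h \<in> carrier_mat n k" "h' \<in> carrier_mat m k" for h h'
  proof -
    have "- (mat_adjoint B * minv P) * h + h' = h' - mat_adjoint B * (minv P * h)"
      using carriers h B by (simp add: mat_mult_assoc mat_uminus_add)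
    then show ?thesis
      unfolding Na' append_rows_def using carriers h
      by (subst mult_four_block_mat[of _ n n _ m _ m _ _ k _ 0])
        (simp_all add: mat_zero_simps)
  qed
  have app: "f @\<^sub>r f' \<in> carrier_mat (n + m) k" "g @\<^sub>r g' \<in> carrier_mat (n + m) k" using F G by (simp_all add: carrier_append_rows)
  let ?f = "f' - mat_adjoint B * (minv P * f)" and ?g = "g' - mat_adjoint B * (minv P * g)"
  have c: "?f \<in> carrier_mat m k" "?g \<in> carrier_mat m k" using carriers F G
    by (intro minus_carrier_mat mult_carrier_mat[of _ m n] mult_carrier_mat[of _ n n]; simp)+
  have "mat_adjoint (f @\<^sub>r f') * (minv Q * (g @\<^sub>r g'))
      = mat_adjoint (mat_adjoint N * (f @\<^sub>r f')) * (E * (mat_adjoint N * (g @\<^sub>r g')))"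
    unfolding \<open>minv Q = _\<close> using carriers E app Na by (simp add: mat_mult_assoc mat_adjoint_mult)
  also have "\<dots> = mat_adjoint (f @\<^sub>r ?f) * (E * (g @\<^sub>r ?g))"
    by (simp only: NaF[OF F] NaF[OF G])
  also have "E * (g @\<^sub>r ?g) = (minv P * g) @\<^sub>r (minv K * ?g)"
    unfolding E_def append_rows_def using carriers G c Kc
    by (subst mult_four_block_mat[of _ n n _ m _ m _ _ k _ 0])
      (simp_all add: mat_zero_simps)
  also have "mat_adjoint (f @\<^sub>r ?f) = four_block_mat (mat_adjoint f) (mat_adjoint ?f) (0\<^sub>m 0 n) (0\<^sub>m 0 m)"
    unfolding append_rows_def using F c B by (subst four_block_adjoint[of _ n k _ 0 _ m]) simp_all
  also have "four_block_mat (mat_adjoint f) (mat_adjoint ?f) (0\<^sub>m 0 n) (0\<^sub>m 0 m) * ((minv P * g) @\<^sub>r (minv K * ?g))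
      = four_block_mat (mat_adjoint f * (minv P * g) + mat_adjoint ?f * (minv K * ?g)) (0\<^sub>m k 0) (0\<^sub>m 0 k) (0\<^sub>m 0 0)"
    unfolding append_rows_def using carriers F G c Kc
    by (subst mult_four_block_mat[of _ k n _ m _ 0 _ _ k _ 0])
      (simp_all add: mat_zero_simps)
  also have "\<dots> = mat_adjoint f * (minv P * g) + mat_adjoint ?f * (minv K * ?g)"
    using carriers F G c Kc by (intro eq_matI) (simp_all del: index_mult_mat(1))
  finally show ?thesis by (simp add: K_def)
qed

end

section \<open>Block columns and the Gram forms of the Pick matrices\<close>

lemma block_index:
  fixes i n m :: nat
  assumes "i < n * m"
  shows "i div m < n" "i mod m < m"
  using assms by (simp add: less_mult_imp_div_less, cases "m = 0") auto

lemma block_index_last: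
  fixes i n m :: nat
  assumes "\<not> i < n * m" "i < Suc n * m"
  shows "i div m = n" "i mod m = i - n * m" "i - n * m < m"
proof -
  obtain r where r: "i = n * m + r" "r < m" using assms by (metis add.commute add_diff_inverse_nat less_diff_conv2 mult_Suc not_less)
  then show "i div m = n" "i mod m = i - n * m" "i - n * m < m" by auto
qed

lemma block_mat_carrier [simp]: "block_mat m r c F \<in> carrier_mat (r * m) (c * m)"
  and dim_block_mat [simp]: "dim_row (block_mat m r c F) = r * m" "dim_col (block_mat m r c F) = c * m"
  by (simp_all add: block_mat_def)

lemma block_mat_index:
  "i < r * m \<Longrightarrow> k < c * m \<Longrightarrow> block_mat m r c F $$ (i, k) = F (Suc (i div m)) (Suc (k div m)) $$ (i mod m, k mod m)"
  by (simp add: block_mat_def)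

text \<open>The block column with blocks \<open>f 1, ..., f n\<close>; both \<open>u_mat\<close> and \<open>v_mat\<close> are of this form.\<close>

definition coln :: "nat \<Rightarrow> nat \<Rightarrow> (nat \<Rightarrow> complex mat) \<Rightarrow> complex mat" where
  "coln m n f = block_mat m n 1 (\<lambda>j _. f j)"

lemma coln_carrier [simp]: "coln m n f \<in> carrier_mat (n * m) m"
  and dim_coln [simp]: "dim_row (coln m n f) = n * m" "dim_col (coln m n f) = m"
  by (simp_all add: coln_def block_mat_def)

lemma coln_index: "i < n * m \<Longrightarrow> b < m \<Longrightarrow> coln m n f $$ (i, b) = f (Suc (i div m)) $$ (i mod m, b)"
  by (simp add: coln_def block_mat_def)

lemma coln_cong: "(\<And>j. 1 \<le> j \<Longrightarrow> j \<le> n \<Longrightarrow> f j = g j) \<Longrightarrow> coln m n f = coln m n g"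
  by (rule eq_matI) (simp_all add: coln_index block_index Suc_leI)

lemma coln_Suc:
  assumes "f (Suc n) \<in> carrier_mat m m"
  shows "coln m (Suc n) f = coln m n f @\<^sub>r f (Suc n)"
proof (rule eq_matI)
  fix i b assume ib: "i < dim_row (coln m n f @\<^sub>r f (Suc n))" "b < dim_col (coln m n f @\<^sub>r f (Suc n))"
  then have ib': "i < Suc n * m" "i < n * m + m" "b < m" using assms by (auto simp: append_rows_def)
  show "coln m (Suc n) f $$ (i, b) = (coln m n f @\<^sub>r f (Suc n)) $$ (i, b)"
  proof (cases "i < n * m")
    case True
    then show ?thesis using ib' assms by (simp add: append_rows_def coln_index)
  next
    case False
    then show ?thesis using ib' assms block_index_last[OF False ib'(1)] by (simp add: append_rows_def coln_index)
  qed
qed (use assms in \<open>simp_all add: append_rows_def\<close>)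

lemma coln_diff:
  assumes "\<And>j. 1 \<le> j \<Longrightarrow> f j \<in> carrier_mat m m" "\<And>j. 1 \<le> j \<Longrightarrow> g j \<in> carrier_mat m m"
  shows "coln m n (\<lambda>j. f j - g j) = coln m n f - coln m n g"
  using assms by (intro eq_matI) (simp_all add: coln_index block_index carrier_matD[OF assms(2)])

lemma coln_smult:
  assumes "\<And>j. 1 \<le> j \<Longrightarrow> f j \<in> carrier_mat m m"
  shows "coln m n (\<lambda>j. c \<cdot>\<^sub>m f j) = c \<cdot>\<^sub>m coln m n f"
  using assms by (intro eq_matI) (simp_all add: coln_index block_index carrier_matD[OF assms])

lemma coln_mult:
  assumes "\<And>j. 1 \<le> j \<Longrightarrow> f j \<in> carrier_mat m m" "X \<in> carrier_mat m m"
  shows "coln m n (\<lambda>j. f j * X) = coln m n f * X"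
proof (rule eq_matI)
  fix i b assume "i < dim_row (coln m n f * X)" "b < dim_col (coln m n f * X)"
  then have ib: "i < n * m" "b < m" using assms by auto
  have "(f (Suc (i div m)) * X) $$ (i mod m, b) = (\<Sum>t<m. f (Suc (i div m)) $$ (i mod m, t) * X $$ (t, b))"
    using ib assms by (intro mat_mult_entry[of _ m m _ m]) (auto simp: block_index)
  moreover have "(coln m n f * X) $$ (i, b) = (\<Sum>t<m. coln m n f $$ (i, t) * X $$ (t, b))"
    using ib assms by (intro mat_mult_entry[of _ "n * m" m _ m]) auto
  ultimately show "coln m n (\<lambda>j. f j * X) $$ (i, b) = (coln m n f * X) $$ (i, b)"
    using ib by (simp add: coln_index del: index_mult_mat(1))
qed (use assms in auto)

definition block_diag :: "nat \<Rightarrow> nat \<Rightarrow> (nat \<Rightarrow> complex) \<Rightarrow> complex mat" where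
  "block_diag m n d = mat_diag (n * m) (\<lambda>i. d (Suc (i div m)))"

lemma block_diag_carrier [simp]: "block_diag m n d \<in> carrier_mat (n * m) (n * m)"
  and dim_block_diag [simp]: "dim_row (block_diag m n d) = n * m" "dim_col (block_diag m n d) = n * m"
  by (simp_all add: block_diag_def mat_diag_def)

lemma block_diag_mult:
  assumes "A \<in> carrier_mat (n * m) k"
  shows "block_diag m n d * A = mat (n * m) k (\<lambda>(i, j). d (Suc (i div m)) * A $$ (i, j))"
  using mat_diag_mult_left[OF assms] by (simp add: block_diag_def)

lemma mult_block_diag:
  assumes "A \<in> carrier_mat k (n * m)"
  shows "A * block_diag m n d = mat k (n * m) (\<lambda>(i, j). A $$ (i, j) * d (Suc (j div m)))"
  using mat_diag_mult_right[OF assms] by (simp add: block_diag_def)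

lemma block_diag_coln:
  assumes "\<And>j. 1 \<le> j \<Longrightarrow> f j \<in> carrier_mat m m"
  shows "block_diag m n d * coln m n f = coln m n (\<lambda>j. d j \<cdot>\<^sub>m f j)"
  unfolding block_diag_mult[OF coln_carrier] using assms
  by (intro eq_matI) (simp_all add: coln_index block_index carrier_matD[OF assms])

lemma coln_mult_adjoint_index:
  assumes "\<And>j. 1 \<le> j \<Longrightarrow> a j \<in> carrier_mat m m" "\<And>j. 1 \<le> j \<Longrightarrow> b j \<in> carrier_mat m m" "i < n * m" "k < l * m"
  shows "(coln m n a * mat_adjoint (coln m l b)) $$ (i, k)
    = (a (Suc (i div m)) * mat_adjoint (b (Suc (k div m)))) $$ (i mod m, k mod m)"
proof -
  have "(coln m n a * mat_adjoint (coln m l b)) $$ (i, k)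
      = (\<Sum>t<m. coln m n a $$ (i, t) * mat_adjoint (coln m l b) $$ (t, k))"
    using assms by (intro mat_mult_entry[of _ "n * m" m _ "l * m"]) auto
  also have "\<dots> = (\<Sum>t<m. a (Suc (i div m)) $$ (i mod m, t) * mat_adjoint (b (Suc (k div m))) $$ (t, k mod m))"
    using assms(3,4) by (intro sum.cong) (simp_all add: coln_index block_index carrier_matD[OF assms(2)])
  also have "\<dots> = (a (Suc (i div m)) * mat_adjoint (b (Suc (k div m)))) $$ (i mod m, k mod m)"
    using assms by (intro mat_mult_entry[symmetric, of _ m m _ m]) (auto simp: block_index)
  finally show ?thesis .
qed

text \<open>Nonvanishing denominators of the Pick matrix, instead of nodes in the upper half-plane, admit the node \<open>cnj x\<close> of a reflected point.\<close>

locale nodes =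
  fixes m :: nat and z :: "nat \<Rightarrow> complex" and W :: "nat \<Rightarrow> complex mat"
  assumes z_nonzero: "\<And>j. 1 \<le> j \<Longrightarrow> z j \<noteq> 0"
    and z_cnj: "\<And>j k. 1 \<le> j \<Longrightarrow> 1 \<le> k \<Longrightarrow> z j \<noteq> cnj (z k)"
    and W_carrier: "\<And>j. 1 \<le> j \<Longrightarrow> W j \<in> carrier_mat m m"
begin

text \<open>The factors \<open>z\<^sub>j\<close> and \<open>cnj z\<^sub>k\<close> come from the congruence with \<open>T\<^sub>n\<^sup>-\<^sup>1\<close> in the definition of the Pick matrix.\<close>

definition pick_block :: "nat \<Rightarrow> nat \<Rightarrow> complex mat" where
  "pick_block j k = (z j * cnj (z k) / (z j - cnj (z k))) \<cdot>\<^sub>m (W j - mat_adjoint (W k))"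

lemma pick_block_carrier [simp]: "1 \<le> j \<Longrightarrow> 1 \<le> k \<Longrightarrow> pick_block j k \<in> carrier_mat m m"
  unfolding pick_block_def using W_carrier by (intro smult_carrier_mat minus_carrier_mat) simp

lemma pick_block_adjoint: assumes "1 \<le> j" "1 \<le> k" shows "mat_adjoint (pick_block j k) = pick_block k j"
proof (rule eq_matI)
  note c = carrier_matD[OF W_carrier[OF assms(1)]] carrier_matD[OF W_carrier[OF assms(2)]]
  fix a b assume ab: "a < dim_row (pick_block k j)" "b < dim_col (pick_block k j)"
  have ne: "z k - cnj (z j) \<noteq> 0" "cnj (z j) - z k \<noteq> 0" using z_cnj assms by force+
  have e: "cnj (z j) * z k / (cnj (z j) - z k) = - (z k * cnj (z j) / (z k - cnj (z j)))"
    using ne by (simp add: field_simps)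
  have ab': "a < m" "b < m" using ab carrier_matD[OF pick_block_carrier[OF assms(2,1)]] by auto
  have "mat_adjoint (pick_block j k) $$ (a, b) = cnj (z j) * z k / (cnj (z j) - z k) * (cnj (W j $$ (b, a)) - W k $$ (a, b))"
    using ab' c by (simp add: pick_block_def)
  also have "\<dots> = z k * cnj (z j) / (z k - cnj (z j)) * (W k $$ (a, b) - cnj (W j $$ (b, a)))"
    unfolding e by (simp only: minus_mult_commute minus_diff_eq)
  also have "\<dots> = pick_block k j $$ (a, b)" using ab' c by (simp add: pick_block_def)
  finally show "mat_adjoint (pick_block j k) $$ (a, b) = pick_block k j $$ (a, b)" .
qed (use carrier_matD[OF pick_block_carrier[OF assms]] carrier_matD[OF pick_block_carrier[OF assms(2,1)]] in simp_all)

lemma pick_mat_eq: "pick_mat m z W n = block_mat m n n pick_block"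
proof -
  define Z where "Z = block_diag m n z"
  have T: "T_mat m z n = block_diag m n (\<lambda>j. inverse (z j))"
  proof (rule eq_matI)
    fix i k assume "i < dim_row (block_diag m n (\<lambda>j. inverse (z j)))" "k < dim_col (block_diag m n (\<lambda>j. inverse (z j)))"
    then have ik: "i < n * m" "k < n * m" by simp_all
    have "i = k \<longleftrightarrow> i div m = k div m \<and> i mod m = k mod m" by (metis div_mod_decomp)
    then show "T_mat m z n $$ (i, k) = block_diag m n (\<lambda>j. inverse (z j)) $$ (i, k)"
      using ik by (simp add: T_mat_def block_mat_index block_diag_def mat_diag_def block_index)
  qed (simp_all add: T_mat_def)
  have "T_mat m z n * Z = 1\<^sub>m (n * m)"
    unfolding T Z_def block_diag_def mat_diag_diag using z_nonzero by (simp add: mat_diag_def one_mat_def)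
  then have inv: "minv (T_mat m z n) = Z"
    by (intro minv_eqI[of _ "n * m"]) (simp_all add: Z_def T)
  have Za: "mat_adjoint Z = block_diag m n (\<lambda>j. cnj (z j))"
    unfolding Z_def by (rule eq_matI) (simp_all add: block_diag_def mat_diag_def)
  show ?thesis
    unfolding pick_mat_def inv Za unfolding Z_def
    by (rule eq_matI) (simp_all add: block_diag_mult[of _ n m "n * m"] mult_block_diag[of _ "n * m"] block_mat_index
        pick_block_def block_index carrier_matD[OF W_carrier])
qed

abbreviation "Pm n \<equiv> pick_mat m z W n"

lemma Pm_carrier [simp]: "Pm n \<in> carrier_mat (n * m) (n * m)"
  and dim_Pm [simp]: "dim_row (Pm n) = n * m" "dim_col (Pm n) = n * m"
  by (simp_all add: pick_mat_eq)

lemma Pm_hermitian: "hermitian_mat (n * m) (Pm n)"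
  unfolding hermitian_mat_def
proof (intro conjI eq_matI)
  fix i k assume "i < dim_row (Pm n)" "k < dim_col (Pm n)"
  then have ik: "i < n * m" "k < n * m" by simp_all
  have "pick_block (Suc (i div m)) (Suc (k div m)) $$ (i mod m, k mod m) = mat_adjoint (pick_block (Suc (k div m)) (Suc (i div m))) $$ (i mod m, k mod m)"
    by (simp add: pick_block_adjoint)
  also have "\<dots> = cnj (pick_block (Suc (k div m)) (Suc (i div m)) $$ (k mod m, i mod m))"
    using ik by (intro index_mat_adjoint) (simp_all add: block_index carrier_matD[OF pick_block_carrier])
  finally show "mat_adjoint (Pm n) $$ (i, k) = Pm n $$ (i, k)"
    using ik by (simp add: pick_mat_eq block_mat_index)
qed simp_all

abbreviation "pick_col n \<equiv> coln m n (\<lambda>j. pick_block j (Suc n))"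

lemma Pm_Suc: "Pm (Suc n) = four_block_mat (Pm n) (pick_col n) (mat_adjoint (pick_col n)) (pick_block (Suc n) (Suc n))"
proof (rule eq_matI)
  fix i k assume "i < dim_row (four_block_mat (Pm n) (pick_col n) (mat_adjoint (pick_col n)) (pick_block (Suc n) (Suc n)))"
    "k < dim_col (four_block_mat (Pm n) (pick_col n) (mat_adjoint (pick_col n)) (pick_block (Suc n) (Suc n)))"
  then have ik: "i < Suc n * m" "k < Suc n * m" "i < n * m + m" "k < n * m + m"
    by (simp_all add: carrier_matD[OF pick_block_carrier] add.commute)
  have lhs: "Pm (Suc n) $$ (i, k) = pick_block (Suc (i div m)) (Suc (k div m)) $$ (i mod m, k mod m)"
    using ik by (simp add: pick_mat_eq block_mat_index del: mult_Suc)
  have adj: "cnj (pick_block (Suc (k div m)) (Suc n) $$ (k mod m, b)) = pick_block (Suc n) (Suc (k div m)) $$ (b, k mod m)" if "b < m" for b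
  proof -
    have "k mod m < m" using that by simp
    then show ?thesis using that
      by (subst pick_block_adjoint[symmetric, of "Suc (k div m)"]) (simp_all add: carrier_matD[OF pick_block_carrier])
  qed
  have rhs: "four_block_mat (Pm n) (pick_col n) (mat_adjoint (pick_col n)) (pick_block (Suc n) (Suc n)) $$ (i, k)
     = (if i < n * m then if k < n * m then Pm n $$ (i, k) else pick_col n $$ (i, k - n * m)
        else if k < n * m then mat_adjoint (pick_col n) $$ (i - n * m, k) else pick_block (Suc n) (Suc n) $$ (i - n * m, k - n * m))"
    using ik by (subst index_mat_four_block(1)) (simp_all add: carrier_matD[OF pick_block_carrier])
  show "Pm (Suc n) $$ (i, k) = four_block_mat (Pm n) (pick_col n) (mat_adjoint (pick_col n)) (pick_block (Suc n) (Suc n)) $$ (i, k)"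
    unfolding lhs rhs using ik block_index_last[of i n m] block_index_last[of k n m] adj
    by (cases "i < n * m"; cases "k < n * m")
      (simp_all add: coln_index carrier_matD[OF pick_block_carrier] pick_mat_eq block_mat_index)
qed (simp_all add: carrier_matD[OF pick_block_carrier] add.commute)

text \<open>With the empty matrix as start, the recursions over the number of nodes begin at \<open>0\<close> and treat the first node like all others.\<close>

lemma Pm_0: "pd_mat (0 * m) (Pm 0)"
  using Pm_hermitian[of 0] unfolding pd_mat_def by (auto intro!: eq_vecI)

text \<open>The index is shifted by one: step \<open>n\<close> adds the node with number \<open>n + 1\<close>. So \<open>Kh n\<close> is the matrix \<open>K_hat\<close> with index \<open>n + 1\<close>, \<open>res n f\<close> is the last block of \<open>col(f)\<close> after elimination of the first \<open>n\<close> blocks, and \<open>hat n f\<close> is that block normalized.\<close>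

definition Gram :: "nat \<Rightarrow> (nat \<Rightarrow> complex mat) \<Rightarrow> (nat \<Rightarrow> complex mat) \<Rightarrow> complex mat" where
  "Gram n f g = mat_adjoint (coln m n f) * (minv (Pm n) * coln m n g)"

definition res :: "nat \<Rightarrow> (nat \<Rightarrow> complex mat) \<Rightarrow> complex mat" where
  "res n f = f (Suc n) - mat_adjoint (pick_col n) * (minv (Pm n) * coln m n f)"

definition Kh :: "nat \<Rightarrow> complex mat" where
  "Kh n = pick_block (Suc n) (Suc n) - mat_adjoint (pick_col n) * (minv (Pm n) * pick_col n)"

definition hat :: "nat \<Rightarrow> (nat \<Rightarrow> complex mat) \<Rightarrow> complex mat" where
  "hat n f = inv_sqrt_mat m (Kh n) * res n f"

definition fam :: "(nat \<Rightarrow> complex mat) \<Rightarrow> bool" where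
  "fam f \<longleftrightarrow> (\<forall>j\<ge>1. f j \<in> carrier_mat m m)"

lemma famD: "fam f \<Longrightarrow> 1 \<le> j \<Longrightarrow> f j \<in> carrier_mat m m"
  by (simp add: fam_def)

lemma fam_W: "fam W" and fam_one: "fam (\<lambda>_. 1\<^sub>m m)"
  using W_carrier by (simp_all add: fam_def)

lemma fam_smult: "fam f \<Longrightarrow> fam (\<lambda>j. d j \<cdot>\<^sub>m f j)"
  and fam_diff: "fam f \<Longrightarrow> fam g \<Longrightarrow> fam (\<lambda>j. f j - g j)"
  and fam_mult: "fam f \<Longrightarrow> X \<in> carrier_mat m m \<Longrightarrow> fam (\<lambda>j. f j * X)"
  by (auto simp: fam_def intro!: minus_carrier_mat)

end

locale pd_nodes = nodes +
  assumes pd_Pm: "\<And>n. 1 \<le> n \<Longrightarrow> pd_mat (n * m) (pick_mat m z W n)"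
begin

lemma pd_P: "pd_mat (n * m) (Pm n)"
  using pd_Pm[of n] Pm_0 by (cases "n = 0") auto

lemma Pi_carrier [simp]: "minv (Pm n) \<in> carrier_mat (n * m) (n * m)"
  and dim_Pi [simp]: "dim_row (minv (Pm n)) = n * m" "dim_col (minv (Pm n)) = n * m"
  using minv_carrier[OF Pm_carrier pd_det[OF pd_P]] by auto

lemma Pi_adjoint [simp]: "mat_adjoint (minv (Pm n)) = minv (Pm n)"
  by (rule minv_hermitian[OF Pm_hermitian pd_det[OF pd_P]])

lemma pick_block_hermitian: "hermitian_mat m (pick_block (Suc n) (Suc n))"
  by (simp add: hermitian_mat_def pick_block_adjoint)

lemma Kh_pd: "pd_mat m (Kh n)"
  unfolding Kh_def
proof (rule pd_schur_complement[OF pd_P coln_carrier pick_block_hermitian])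
  show "pd_mat (n * m + m) (four_block_mat (Pm n) (pick_col n) (mat_adjoint (pick_col n)) (pick_block (Suc n) (Suc n)))"
    using pd_P[of "Suc n"] unfolding Pm_Suc by (simp add: add.commute)
qed

lemma Gram_carrier [simp]: "Gram n f g \<in> carrier_mat m m"
  and dim_Gram [simp]: "dim_row (Gram n f g) = m" "dim_col (Gram n f g) = m"
  unfolding Gram_def by (simp_all add: mult_carrier_mat[of _ _ "n * m"])

lemma res_carrier [simp]: "fam f \<Longrightarrow> res n f \<in> carrier_mat m m"
  unfolding res_def by (intro minus_carrier_mat) (simp add: carrier_matI)

lemma hat_carrier [simp]: "fam f \<Longrightarrow> hat n f \<in> carrier_mat m m"
  unfolding hat_def by (rule mult_carrier_mat[OF pd_carrier[OF inv_sqrt_pd[OF Kh_pd]] res_carrier])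

lemma dim_hat: "fam f \<Longrightarrow> dim_row (hat n f) = m" "fam f \<Longrightarrow> dim_col (hat n f) = m"
  using hat_carrier by blast+

lemma Gram_0: "Gram 0 f g = 0\<^sub>m m m"
  unfolding Gram_def by (rule eq_matI) (simp_all add: scalar_prod_def)

text \<open>The inverse of the Schur complement \<open>Kh n\<close> is the square of \<open>inv_sqrt_mat m (Kh n)\<close>, and each factor is absorbed into one of the two residuals.\<close>

lemma Gram_Suc:
  assumes "fam f" "fam g"
  shows "Gram (Suc n) f g = Gram n f g + mat_adjoint (hat n f) * hat n g"
proof -
  define S where "S = inv_sqrt_mat m (Kh n)"
  have S: "S \<in> carrier_mat m m" "mat_adjoint S = S" "S * S = minv (Kh n)"
    unfolding S_def using pd_carrier[OF inv_sqrt_pd[OF Kh_pd]] pd_adjoint[OF inv_sqrt_pd[OF Kh_pd]] inv_sqrt_square[OF Kh_pd]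
    by simp_all
  have "Gram (Suc n) f g = Gram n f g + mat_adjoint (res n f) * (minv (Kh n) * res n g)"
    unfolding Gram_def coln_Suc[where f = f and n = n, OF famD[OF assms(1), of "Suc n", simplified]]
      coln_Suc[where f = g and n = n, OF famD[OF assms(2), of "Suc n", simplified]]
      Pm_Suc res_def Kh_def
    by (rule gram_schur_complement[OF pd_P coln_carrier pick_block_hermitian Kh_pd[unfolded Kh_def] coln_carrier
          famD[OF assms(1), of "Suc n", simplified] coln_carrier famD[OF assms(2), of "Suc n", simplified]])
  also have "mat_adjoint (res n f) * (minv (Kh n) * res n g) = mat_adjoint (hat n f) * hat n g"
    unfolding hat_def S_def[symmetric] S(3)[symmetric]
    using S(1) carrier_matD[OF res_carrier[OF assms(1)]] carrier_matD[OF res_carrier[OF assms(2)]]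
    by (simp add: mat_adjoint_mult S(2) mat_mult_assoc)
  finally show ?thesis .
qed

lemma Gram_adjoint: "mat_adjoint (Gram n f g) = Gram n g f"
  unfolding Gram_def by (simp add: mat_adjoint_mult mat_mult_assoc)

lemma Gram_cong: "(\<And>j. 1 \<le> j \<Longrightarrow> f j = f' j) \<Longrightarrow> (\<And>j. 1 \<le> j \<Longrightarrow> g j = g' j) \<Longrightarrow> Gram n f g = Gram n f' g'"
  unfolding Gram_def using coln_cong[of n f f' m] coln_cong[of n g g' m] by simp

lemma Gram_diff_right: "fam f \<Longrightarrow> fam g \<Longrightarrow> Gram n h (\<lambda>j. f j - g j) = Gram n h f - Gram n h g"
  unfolding Gram_def by (simp add: coln_diff famD mat_mult_minus)

lemma Gram_diff_left: "fam f \<Longrightarrow> fam g \<Longrightarrow> Gram n (\<lambda>j. f j - g j) h = Gram n f h - Gram n g h"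
  unfolding Gram_def by (simp add: coln_diff famD mat_minus_mult mat_adjoint_minus)

lemma Gram_mult_right: "fam f \<Longrightarrow> X \<in> carrier_mat m m \<Longrightarrow> Gram n h (\<lambda>j. f j * X) = Gram n h f * X"
  unfolding Gram_def by (simp add: coln_mult famD mat_mult_assoc)

lemma Gram_mult_left: "fam f \<Longrightarrow> X \<in> carrier_mat m m \<Longrightarrow> Gram n (\<lambda>j. f j * X) h = mat_adjoint X * Gram n f h"
  unfolding Gram_def by (simp add: coln_mult famD mat_mult_assoc mat_adjoint_mult)

lemma Gram_smult_right: "fam f \<Longrightarrow> Gram n h (\<lambda>j. c \<cdot>\<^sub>m f j) = c \<cdot>\<^sub>m Gram n h f"
  unfolding Gram_def by (simp add: coln_smult famD mat_mult_smult)

lemma Gram_smult_left: "fam f \<Longrightarrow> Gram n (\<lambda>j. c \<cdot>\<^sub>m f j) h = cnj c \<cdot>\<^sub>m Gram n f h"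
  unfolding Gram_def by (simp add: coln_smult famD mat_smult_mult mat_adjoint_smult)

lemma hat_mult: "fam f \<Longrightarrow> X \<in> carrier_mat m m \<Longrightarrow> hat n (\<lambda>j. f j * X) = hat n f * X"
  and hat_diff: "fam f \<Longrightarrow> fam g \<Longrightarrow> hat n (\<lambda>j. f j - g j) = hat n f - hat n g"
proof -
  have d: "dim_row (inv_sqrt_mat m (Kh n)) = m" "dim_col (inv_sqrt_mat m (Kh n)) = m"
    using pd_carrier[OF inv_sqrt_pd[OF Kh_pd]] by auto
  show "hat n (\<lambda>j. f j * X) = hat n f * X" if f: "fam f" and X: "X \<in> carrier_mat m m"
  proof -
    have "res n (\<lambda>j. f j * X) = res n f * X"
      unfolding res_def using X carrier_matD[OF famD[OF f, of "Suc n"]]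
      by (simp add: coln_mult famD[OF f] mat_expand)
    then show ?thesis unfolding hat_def using X carrier_matD[OF res_carrier[OF f]] d by (simp add: mat_mult_assoc)
  qed
  show "hat n (\<lambda>j. f j - g j) = hat n f - hat n g" if f: "fam f" and g: "fam g"
  proof -
    have "res n (\<lambda>j. f j - g j) = res n f - res n g"
      unfolding res_def using carrier_matD[OF famD[OF f, of "Suc n"]] carrier_matD[OF famD[OF g, of "Suc n"]]
      by (simp add: coln_diff famD[OF f] famD[OF g] mat_expand)
        (rule eq_matI, simp_all del: index_mult_mat(1))
    then show ?thesis unfolding hat_def
      using carrier_matD[OF res_carrier[OF f]] carrier_matD[OF res_carrier[OF g]] d by (simp add: mat_mult_minus)
  qed
qed

lemma hat_cong: "(\<And>j. 1 \<le> j \<Longrightarrow> f j = g j) \<Longrightarrow> hat n f = hat n g"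
  unfolding hat_def res_def using coln_cong[of n f g m] by simp

section \<open>Intertwining relations\<close>

text \<open>Block by block this is the displacement equation \<open>D P - P E = col(a) col(b)\<^sup>* - col(c) col(g)\<^sup>*\<close> for \<open>D = diag(d)\<close>, \<open>E = diag(e)\<close>: the scalar \<open>d\<^sub>j - e\<^sub>k\<close> cancels the denominator of the Pick matrix.\<close>

definition intertwine where
  "intertwine d e a b c g \<longleftrightarrow> (\<forall>j\<ge>1. \<forall>k\<ge>1.
     (d j - e k) \<cdot>\<^sub>m pick_block j k = a j * mat_adjoint (b k) - c j * mat_adjoint (g k))"

lemma intertwine_Pm:
  assumes it: "intertwine d e a b c g" and f: "fam a" "fam b" "fam c" "fam g"
  shows "block_diag m n d * Pm n - Pm n * block_diag m n e
    = coln m n a * mat_adjoint (coln m n b) - coln m n c * mat_adjoint (coln m n g)"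
proof (rule eq_matI)
  fix i k assume "i < dim_row (coln m n a * mat_adjoint (coln m n b) - coln m n c * mat_adjoint (coln m n g))"
    "k < dim_col (coln m n a * mat_adjoint (coln m n b) - coln m n c * mat_adjoint (coln m n g))"
  then have ik: "i < n * m" "k < n * m" by simp_all
  let ?j = "Suc (i div m)" and ?k = "Suc (k div m)"
  have "(block_diag m n d * Pm n - Pm n * block_diag m n e) $$ (i, k) = ((d ?j - e ?k) \<cdot>\<^sub>m pick_block ?j ?k) $$ (i mod m, k mod m)"
    using ik by (simp add: block_diag_mult[OF Pm_carrier] mult_block_diag[OF Pm_carrier] del: index_mult_mat(1))
      (simp add: pick_mat_eq block_mat_index block_index carrier_matD[OF pick_block_carrier] algebra_simps)
  also have "\<dots> = (a ?j * mat_adjoint (b ?k) - c ?j * mat_adjoint (g ?k)) $$ (i mod m, k mod m)"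
    using it by (simp add: intertwine_def)
  also have "\<dots> = (coln m n a * mat_adjoint (coln m n b) - coln m n c * mat_adjoint (coln m n g)) $$ (i, k)"
    using ik carrier_matD[OF famD[OF f(2), of ?k]] carrier_matD[OF famD[OF f(3), of ?j]] carrier_matD[OF famD[OF f(4), of ?k]]
    by (simp add: coln_mult_adjoint_index[where a = a and b = b, OF famD[OF f(1)] famD[OF f(2)]]
      coln_mult_adjoint_index[where a = c and b = g, OF famD[OF f(3)] famD[OF f(4)]] block_index del: index_mult_mat(1))
  finally show "(block_diag m n d * Pm n - Pm n * block_diag m n e) $$ (i, k)
    = (coln m n a * mat_adjoint (coln m n b) - coln m n c * mat_adjoint (coln m n g)) $$ (i, k)" .
qed simp_all

lemma intertwine_pick_col:
  assumes it: "intertwine d e a b c g" and f: "fam a" "fam b" "fam c" "fam g"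
  shows "d (Suc n) \<cdot>\<^sub>m mat_adjoint (pick_col n) - mat_adjoint (pick_col n) * block_diag m n e
    = a (Suc n) * mat_adjoint (coln m n b) - c (Suc n) * mat_adjoint (coln m n g)"
proof (rule eq_matI)
  note dims = carrier_matD[OF famD[OF f(1), of "Suc n"]] carrier_matD[OF famD[OF f(3), of "Suc n"]]
  fix i k assume "i < dim_row (a (Suc n) * mat_adjoint (coln m n b) - c (Suc n) * mat_adjoint (coln m n g))"
    "k < dim_col (a (Suc n) * mat_adjoint (coln m n b) - c (Suc n) * mat_adjoint (coln m n g))"
  then have ik: "i < m" "k < n * m" using dims by simp_all
  let ?k = "Suc (k div m)"
  have Bk: "mat_adjoint (pick_col n) $$ (i, k) = pick_block (Suc n) ?k $$ (i, k mod m)"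
  proof -
    have "pick_block (Suc n) ?k $$ (i, k mod m) = mat_adjoint (pick_block ?k (Suc n)) $$ (i, k mod m)" by (simp add: pick_block_adjoint)
    then show ?thesis using ik by (simp add: coln_index block_index carrier_matD[OF pick_block_carrier])
  qed
  have prod: "(x * mat_adjoint (coln m n y)) $$ (i, k) = (x * mat_adjoint (y ?k)) $$ (i, k mod m)"
    if "x \<in> carrier_mat m m" "fam y" for x y
  proof -
    have "(x * mat_adjoint (coln m n y)) $$ (i, k) = (\<Sum>t<m. x $$ (i, t) * mat_adjoint (coln m n y) $$ (t, k))"
      using that ik by (intro mat_mult_entry[of _ m m _ "n * m"]) simp_all
    also have "\<dots> = (\<Sum>t<m. x $$ (i, t) * mat_adjoint (y ?k) $$ (t, k mod m))"
      using ik carrier_matD[OF famD[OF that(2), of ?k]] by (intro sum.cong) (simp_all add: coln_index block_index)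
    also have "\<dots> = (x * mat_adjoint (y ?k)) $$ (i, k mod m)"
      using that ik famD[OF that(2), of ?k] by (intro mat_mult_entry[symmetric, of _ m m _ m]) (simp_all add: block_index)
    finally show ?thesis .
  qed
  have "(d (Suc n) \<cdot>\<^sub>m mat_adjoint (pick_col n) - mat_adjoint (pick_col n) * block_diag m n e) $$ (i, k)
      = d (Suc n) * mat_adjoint (pick_col n) $$ (i, k) - mat_adjoint (pick_col n) $$ (i, k) * e ?k"
    using ik by (simp add: mult_block_diag[of _ m] del: index_mat_adjoint)
  also have "\<dots> = ((d (Suc n) - e ?k) \<cdot>\<^sub>m pick_block (Suc n) ?k) $$ (i, k mod m)"
    unfolding Bk using ik by (simp add: block_index carrier_matD[OF pick_block_carrier] algebra_simps)
  also have "\<dots> = (a (Suc n) * mat_adjoint (b ?k) - c (Suc n) * mat_adjoint (g ?k)) $$ (i, k mod m)"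
    using it by (simp add: intertwine_def)
  also have "\<dots> = (a (Suc n) * mat_adjoint (coln m n b) - c (Suc n) * mat_adjoint (coln m n g)) $$ (i, k)"
    using ik dims carrier_matD[OF famD[OF f(4), of ?k]] carrier_matD[OF famD[OF f(2), of ?k]]
      prod[OF famD[OF f(1), of "Suc n"] f(2)] prod[OF famD[OF f(3), of "Suc n"] f(4)]
    by (simp add: block_index del: index_mult_mat(1))
  finally show "(d (Suc n) \<cdot>\<^sub>m mat_adjoint (pick_col n) - mat_adjoint (pick_col n) * block_diag m n e) $$ (i, k)
    = (a (Suc n) * mat_adjoint (coln m n b) - c (Suc n) * mat_adjoint (coln m n g)) $$ (i, k)" .
qed (use carrier_matD[OF famD[OF f(1), of "Suc n"]] carrier_matD[OF famD[OF f(3), of "Suc n"]] in simp_all)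

text \<open>The displacement equation of \<open>P\<close>, multiplied by the inverse of \<open>P\<close> from both sides.\<close>

lemma intertwine_Pi:
  assumes it: "intertwine d e a b c g" and f: "fam a" "fam b" "fam c" "fam g"
  shows "minv (Pm n) * block_diag m n d = block_diag m n e * minv (Pm n)
    + (minv (Pm n) * coln m n a) * (mat_adjoint (coln m n b) * minv (Pm n))
    - (minv (Pm n) * coln m n c) * (mat_adjoint (coln m n g) * minv (Pm n))" (is "?l = ?r")
proof -
  define X where "X = coln m n a * mat_adjoint (coln m n b) - coln m n c * mat_adjoint (coln m n g)"
  have X: "X \<in> carrier_mat (n * m) (n * m)" unfolding X_def by (intro minus_carrier_mat carrier_matI) simp_all
  let ?D = "block_diag m n d" and ?E = "block_diag m n e" and ?P = "Pm n" and ?Pi = "minv (Pm n)"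
  have "?Pi * X * ?Pi = ?Pi * ((?D * ?P - ?P * ?E) * ?Pi)"
    unfolding X_def intertwine_Pm[OF assms, symmetric] by (simp add: mat_mult_assoc)
  also have "\<dots> = ?Pi * (?D * (?P * ?Pi)) - ?Pi * (?P * (?E * ?Pi))"
    by (simp add: mat_minus_mult mat_mult_minus mat_mult_assoc)
  also have "?P * ?Pi = 1\<^sub>m (n * m)" by (rule minv_right[OF Pm_carrier pd_det[OF pd_P]])
  also have "?Pi * (?P * (?E * ?Pi)) = ?E * ?Pi"
    using minv_cancel(1)[OF Pm_carrier pd_det[OF pd_P], of "?E * ?Pi" n "n * m"] by (simp add: carrier_matI)
  finally have eq: "?Pi * X * ?Pi = ?Pi * ?D - ?E * ?Pi" by simp
  have "?l = ?E * ?Pi + (?Pi * ?D - ?E * ?Pi)" by (simp add: mat_add_minus_cancel)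
  also have "\<dots> = ?E * ?Pi + ?Pi * X * ?Pi" unfolding eq ..
  also have "?Pi * X * ?Pi = (?Pi * coln m n a) * (mat_adjoint (coln m n b) * ?Pi)
      - (?Pi * coln m n c) * (mat_adjoint (coln m n g) * ?Pi)"
    unfolding X_def by (simp add: mat_minus_mult mat_mult_minus mat_mult_assoc)
  also have "?E * ?Pi + ((?Pi * coln m n a) * (mat_adjoint (coln m n b) * ?Pi)
      - (?Pi * coln m n c) * (mat_adjoint (coln m n g) * ?Pi)) = ?r"
    by (rule eq_matI) (simp_all del: index_mult_mat(1))
  finally show ?thesis .
qed

lemma block_diag_fam: "fam f \<Longrightarrow> coln m n (\<lambda>j. d j \<cdot>\<^sub>m f j) = block_diag m n d * coln m n f"
  by (rule block_diag_coln[symmetric]) (rule famD)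

lemma block_diag_adjoint: "mat_adjoint (block_diag m n d) = block_diag m n (\<lambda>j. cnj (d j))"
  by (rule eq_matI) (simp_all add: block_diag_def mat_diag_def)

lemma Gram_intertwine:
  assumes it: "intertwine d e a b c g" and f: "fam a" "fam b" "fam c" "fam g" and fh: "fam f" "fam h"
  shows "Gram n f (\<lambda>j. d j \<cdot>\<^sub>m h j) = Gram n (\<lambda>j. cnj (e j) \<cdot>\<^sub>m f j) h + Gram n f a * Gram n b h - Gram n f c * Gram n g h"
proof -
  have "Gram n f (\<lambda>j. d j \<cdot>\<^sub>m h j) = mat_adjoint (coln m n f) * ((minv (Pm n) * block_diag m n d) * coln m n h)"
    unfolding Gram_def block_diag_fam[OF fh(2)] by (simp add: mat_mult_assoc)
  also have "\<dots> = mat_adjoint (coln m n f) * (block_diag m n e * (minv (Pm n) * coln m n h))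
     + Gram n f a * Gram n b h - Gram n f c * Gram n g h"
    unfolding intertwine_Pi[OF it f] Gram_def
    by (simp add: mat_minus_mult mat_mult_minus mat_mult_assoc mat_mult_add mat_add_mult)
  also have "mat_adjoint (coln m n f) * (block_diag m n e * (minv (Pm n) * coln m n h))
      = Gram n (\<lambda>j. cnj (e j) \<cdot>\<^sub>m f j) h"
    unfolding Gram_def block_diag_fam[OF fh(1)]
    by (simp add: mat_mult_assoc mat_adjoint_mult block_diag_adjoint)
  finally show ?thesis .
qed

text \<open>Multiplication by \<open>d\<close> acts on the coordinates \<open>hat\<close> as a lower triangular operator with diagonal \<open>d\<close>: by \<open>mnorm_Gram_le\<close> the Gram matrices on the right only involve the coordinates of \<open>h\<close> with index less than \<open>n\<close>. The proof inserts the displacement equation for the first \<open>n\<close> nodes and the one for the last row into the residual.\<close>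

lemma hat_intertwine:
  assumes it: "intertwine d e a b c g" and f: "fam a" "fam b" "fam c" "fam g" and h: "fam h"
  shows "hat n (\<lambda>j. d j \<cdot>\<^sub>m h j) = d (Suc n) \<cdot>\<^sub>m hat n h + hat n a * Gram n b h - hat n c * Gram n g h"
proof -
  let ?Pi = "minv (Pm n)" and ?B = "mat_adjoint (pick_col n)" and ?H = "coln m n h"
  note dims = carrier_matD[OF famD[OF f(1), of "Suc n"]] carrier_matD[OF famD[OF f(3), of "Suc n"]]
    carrier_matD[OF famD[OF h, of "Suc n"]]
  have "?B * (?Pi * coln m n (\<lambda>j. d j \<cdot>\<^sub>m h j)) = ?B * ((?Pi * block_diag m n d) * ?H)"
    unfolding block_diag_fam[OF h] by (simp add: mat_mult_assoc)
  also have "\<dots> = (?B * block_diag m n e) * (?Pi * ?H)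
      + ?B * (?Pi * coln m n a) * Gram n b h - ?B * (?Pi * coln m n c) * Gram n g h"
    unfolding intertwine_Pi[OF it f] Gram_def
    by (simp add: mat_minus_mult mat_mult_minus mat_mult_assoc mat_mult_add mat_add_mult)
  also have "?B * block_diag m n e = d (Suc n) \<cdot>\<^sub>m ?B
      - (a (Suc n) * mat_adjoint (coln m n b) - c (Suc n) * mat_adjoint (coln m n g))"
    unfolding intertwine_pick_col[OF it f, symmetric] by (rule eq_matI) (simp_all del: index_mult_mat(1))
  also have "\<dots> * (?Pi * ?H) = d (Suc n) \<cdot>\<^sub>m (?B * (?Pi * ?H)) - (a (Suc n) * Gram n b h - c (Suc n) * Gram n g h)"
    unfolding Gram_def using dims by (simp add: mat_minus_mult mat_mult_assoc mat_smult_mult)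
  finally have eq: "?B * (?Pi * coln m n (\<lambda>j. d j \<cdot>\<^sub>m h j))
    = d (Suc n) \<cdot>\<^sub>m (?B * (?Pi * ?H)) - (a (Suc n) * Gram n b h - c (Suc n) * Gram n g h)
      + ?B * (?Pi * coln m n a) * Gram n b h - ?B * (?Pi * coln m n c) * Gram n g h" .
  have "res n (\<lambda>j. d j \<cdot>\<^sub>m h j) = d (Suc n) \<cdot>\<^sub>m res n h + res n a * Gram n b h - res n c * Gram n g h"
    unfolding res_def eq using dims
    by (simp add: mat_minus_mult)
      (rule eq_matI, simp_all add: algebra_simps del: index_mult_mat(1))
  moreover have "dim_row (inv_sqrt_mat m (Kh n)) = m" "dim_col (inv_sqrt_mat m (Kh n)) = m"
    using pd_carrier[OF inv_sqrt_pd[OF Kh_pd]] by auto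
  ultimately show ?thesis
    unfolding hat_def
    using carrier_matD[OF res_carrier[OF f(1)]] carrier_matD[OF res_carrier[OF f(3)]] carrier_matD[OF res_carrier[OF h]]
    by (simp add: mat_mult_minus mat_mult_add mat_mult_smult mat_mult_assoc)
qed

section \<open>The rational functions of the first and second kind at the origin\<close>

lemma B_mat_eq: "B_mat m z W (Suc n) = pick_col n"
  and C_mat_eq: "C_mat m z W (Suc n) = pick_block (Suc n) (Suc n)"
proof -
  have split: "split_block (Pm (Suc n)) (n * m) (n * m) = (Pm n, pick_col n, mat_adjoint (pick_col n), pick_block (Suc n) (Suc n))"
    unfolding Pm_Suc split_block_def Let_def prod.inject
    by (intro conjI eq_matI) (simp_all add: carrier_matD[OF pick_block_carrier])
  show "B_mat m z W (Suc n) = pick_col n" "C_mat m z W (Suc n) = pick_block (Suc n) (Suc n)"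
    unfolding B_mat_def C_mat_def by (simp_all add: split)
qed

lemma K_hat_eq: "K_hat m z W (Suc n) = Kh n"
proof (cases "n = 0")
  case True
  have "mat_adjoint (pick_col 0) * (minv (Pm 0) * pick_col 0) = 0\<^sub>m m m"
    by (rule eq_matI) (simp_all add: scalar_prod_def)
  moreover have "pick_mat m z W 1 = pick_block 1 1"
    by (rule eq_matI) (simp_all add: pick_mat_eq block_mat_index carrier_matD[OF pick_block_carrier])
  moreover have "pick_block 1 1 - 0\<^sub>m m m = pick_block 1 1" by (rule eq_matI) (simp_all add: carrier_matD[OF pick_block_carrier])
  ultimately show ?thesis using True by (simp add: K_hat_def Kh_def)
next
  case False
  then show ?thesis by (simp add: K_hat_def Kh_def mat_mult_assoc B_mat_eq C_mat_eq)
qed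

lemma L_row_coln:
  assumes "fam f"
  shows "L_row m z W (Suc n) * coln m (Suc n) f = res n f"
proof (cases "n = 0")
  case True
  have 1: "coln m (Suc 0) f = f (Suc 0)"
    by (rule eq_matI) (simp_all add: coln_index carrier_matD[OF famD[OF assms]])
  have "mat_adjoint (pick_col 0) * (minv (Pm 0) * coln m 0 f) = 0\<^sub>m m m"
    by (rule eq_matI) (simp_all add: scalar_prod_def)
  then have "res 0 f = f (Suc 0)"
    unfolding res_def by (intro eq_matI) (simp_all add: carrier_matD[OF famD[OF assms]])
  then show ?thesis using True by (simp add: L_row_def 1 carrier_matD[OF famD[OF assms]])
next
  case False
  have L: "L_row m z W (Suc n)
      = four_block_mat (- (mat_adjoint (pick_col n) * minv (Pm n))) (1\<^sub>m m) (0\<^sub>m 0 (n * m)) (0\<^sub>m 0 m)"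
    using False by (simp add: L_row_def B_mat_eq)
  have c: "- (mat_adjoint (pick_col n) * minv (Pm n)) \<in> carrier_mat m (n * m)" by (intro carrier_matI) simp_all
  note fc = famD[OF assms, of "Suc n", simplified]
  have "L_row m z W (Suc n) * coln m (Suc n) f
     = four_block_mat (- (mat_adjoint (pick_col n) * minv (Pm n)) * coln m n f + 1\<^sub>m m * f (Suc n)) (0\<^sub>m m 0) (0\<^sub>m 0 m) (0\<^sub>m 0 0)"
    unfolding L coln_Suc[of f, OF fc] append_rows_def
    by (subst mult_four_block_mat[OF c, of _ m _ 0 _ _ m _ 0]) (use fc in \<open>simp_all add: mat_zero_simps\<close>)
  also have "\<dots> = - (mat_adjoint (pick_col n) * minv (Pm n)) * coln m n f + 1\<^sub>m m * f (Suc n)"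
    using fc by (intro eq_matI) (simp_all del: index_mult_mat(1))
  also have "\<dots> = res n f"
    unfolding res_def using carrier_matD[OF fc] by (simp add: mat_mult_assoc mat_uminus_add)
  finally show ?thesis .
qed

text \<open>At the origin the resolvent disappears, so that only the normalized residuals of the two block columns remain.\<close>

lemma R_mat_0: "R_mat m z n 0 = 1\<^sub>m (n * m)"
proof -
  have "1\<^sub>m (n * m) - 0 \<cdot>\<^sub>m T_mat m z n = 1\<^sub>m (n * m)"
    by (rule eq_matI) (simp_all add: T_mat_def)
  then show ?thesis unfolding R_mat_def by (simp add: minv_eqI[of _ "n * m"])
qed

lemma L_row_carrier: "L_row m z W (Suc n) \<in> carrier_mat m (Suc n * m)"
  by (auto simp: L_row_def B_mat_eq intro!: carrier_matI)

lemma P_fun_0: "P_fun m z W (Suc n) 0 = hat n (\<lambda>_. 1\<^sub>m m)"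
proof -
  have "v_mat m (Suc n) = coln m (Suc n) (\<lambda>_. 1\<^sub>m m)" by (simp add: v_mat_def coln_def)
  then show ?thesis
    unfolding P_fun_def R_mat_0 K_hat_eq hat_def L_row_coln[OF fam_one, symmetric]
    using carrier_matD[OF L_row_carrier] carrier_matD[OF pd_carrier[OF inv_sqrt_pd[OF Kh_pd]]] by (simp add: mat_mult_assoc)
qed

lemma Q_fun_0: "Q_fun m z W (Suc n) 0 = - hat n W"
proof -
  have "u_mat m W (Suc n) = coln m (Suc n) W" by (simp add: u_mat_def coln_def)
  then show ?thesis
    unfolding Q_fun_def R_mat_0 K_hat_eq hat_def L_row_coln[OF fam_W, symmetric]
    using carrier_matD[OF L_row_carrier] carrier_matD[OF pd_carrier[OF inv_sqrt_pd[OF Kh_pd]]] by (simp add: mat_mult_assoc)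
qed

end

section \<open>The entry sum norm\<close>

lemma mnorm_eq: "A \<in> carrier_mat n k \<Longrightarrow> mnorm A = (\<Sum>i<n. \<Sum>j<k. cmod (A $$ (i, j)))"
  unfolding mnorm_def by simp

lemma mnorm_add:
  assumes "dim_row A = dim_row B" "dim_col A = dim_col B"
  shows "mnorm (A + B) \<le> mnorm A + mnorm B"
proof -
  have "mnorm (A + B) = (\<Sum>i<dim_row B. \<Sum>j<dim_col B. cmod (A $$ (i, j) + B $$ (i, j)))"
    unfolding mnorm_def using assms by simp
  also have "\<dots> \<le> (\<Sum>i<dim_row B. \<Sum>j<dim_col B. cmod (A $$ (i, j)) + cmod (B $$ (i, j)))"
    by (intro sum_mono norm_triangle_ineq)
  also have "\<dots> = mnorm A + mnorm B" unfolding mnorm_def using assms by (simp add: sum.distrib)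
  finally show ?thesis .
qed

lemma mnorm_minus:
  assumes "dim_row A = dim_row B" "dim_col A = dim_col B"
  shows "mnorm (A - B) \<le> mnorm A + mnorm B"
proof -
  have "mnorm (A - B) = (\<Sum>i<dim_row B. \<Sum>j<dim_col B. cmod (A $$ (i, j) - B $$ (i, j)))"
    unfolding mnorm_def using assms by simp
  also have "\<dots> \<le> (\<Sum>i<dim_row B. \<Sum>j<dim_col B. cmod (A $$ (i, j)) + cmod (B $$ (i, j)))"
    by (intro sum_mono norm_triangle_ineq4)
  also have "\<dots> = mnorm A + mnorm B" unfolding mnorm_def using assms by (simp add: sum.distrib)
  finally show ?thesis .
qed

lemma mnorm_smult: "mnorm (c \<cdot>\<^sub>m A) = cmod c * mnorm A"
  by (simp add: mnorm_def norm_mult sum_distrib_left)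

lemma mnorm_adjoint: "mnorm (mat_adjoint A) = mnorm A"
  by (simp add: mnorm_def) (rule sum.swap)

lemma mnorm_mult:
  assumes "A \<in> carrier_mat n k" "B \<in> carrier_mat k l"
  shows "mnorm (A * B) \<le> mnorm A * mnorm B"
proof -
  have AB: "A * B \<in> carrier_mat n l" using assms by simp
  have row: "(\<Sum>j<l. cmod (B $$ (t, j))) \<le> mnorm B" if "t < k" for t
    using that member_le_sum[of t "{..<k}" "\<lambda>t. \<Sum>j<l. cmod (B $$ (t, j))"]
    by (simp add: mnorm_eq[OF assms(2)] sum_nonneg)
  have "mnorm (A * B) \<le> (\<Sum>i<n. \<Sum>j<l. \<Sum>t<k. cmod (A $$ (i, t)) * cmod (B $$ (t, j)))"
    unfolding mnorm_eq[OF AB]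
  proof (intro sum_mono)
    fix i j assume "i \<in> {..<n}" "j \<in> {..<l}"
    then have ij: "i < n" "j < l" by auto
    show "cmod ((A * B) $$ (i, j)) \<le> (\<Sum>t<k. cmod (A $$ (i, t)) * cmod (B $$ (t, j)))"
      unfolding mat_mult_entry[OF assms ij] by (intro sum_norm_le) (simp add: norm_mult)
  qed
  also have "\<dots> = (\<Sum>i<n. \<Sum>t<k. cmod (A $$ (i, t)) * (\<Sum>j<l. cmod (B $$ (t, j))))"
    unfolding sum_distrib_left by (intro sum.cong refl sum.swap)
  also have "\<dots> \<le> (\<Sum>i<n. \<Sum>t<k. cmod (A $$ (i, t)) * mnorm B)"
    by (intro sum_mono mult_left_mono row) auto
  also have "\<dots> = mnorm A * mnorm B" by (simp add: mnorm_eq[OF assms(1)] sum_distrib_right)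
  finally show ?thesis .
qed

lemma trace_gram:
  assumes "A \<in> carrier_mat n k"
  shows "(\<Sum>a<k. Re ((mat_adjoint A * A) $$ (a, a))) = (\<Sum>a<k. \<Sum>t<n. (cmod (A $$ (t, a)))\<^sup>2)"
proof (intro sum.cong refl)
  fix a assume "a \<in> {..<k}"
  then have a: "a < k" by simp
  have "(mat_adjoint A * A) $$ (a, a) = (\<Sum>t<n. cnj (A $$ (t, a)) * A $$ (t, a))"
    using assms a by (subst mat_mult_entry[of _ k n _ k]) auto
  also have "\<dots> = of_real (\<Sum>t<n. (cmod (A $$ (t, a)))\<^sup>2)"
    by (simp only: of_real_sum complex_norm_square mult.commute)
  finally show "Re ((mat_adjoint A * A) $$ (a, a)) = (\<Sum>t<n. (cmod (A $$ (t, a)))\<^sup>2)"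
    by (simp only: Re_complex_of_real)
qed

text \<open>Each entry is bounded by the root of the trace, and there are \<open>n k\<close> entries.\<close>

lemma mnorm_square_le:
  assumes "A \<in> carrier_mat n k"
  shows "(mnorm A)\<^sup>2 \<le> (real n * real k)\<^sup>2 * (\<Sum>a<k. Re ((mat_adjoint A * A) $$ (a, a)))"
proof -
  define F where "F = (\<Sum>a<k. \<Sum>t<n. (cmod (A $$ (t, a)))\<^sup>2)"
  have F0: "0 \<le> F" by (simp add: F_def sum_nonneg)
  have "cmod (A $$ (t, a)) \<le> sqrt F" if "t < n" "a < k" for t a
  proof -
    have "(cmod (A $$ (t, a)))\<^sup>2 \<le> (\<Sum>t<n. (cmod (A $$ (t, a)))\<^sup>2)"
      using that member_le_sum[of t "{..<n}" "\<lambda>t. (cmod (A $$ (t, a)))\<^sup>2"] by simp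
    also have "\<dots> \<le> F" unfolding F_def
      using that member_le_sum[of a "{..<k}" "\<lambda>a. \<Sum>t<n. (cmod (A $$ (t, a)))\<^sup>2"] by (simp add: sum_nonneg)
    finally show ?thesis by (rule real_le_rsqrt)
  qed
  then have "mnorm A \<le> (\<Sum>t<n. \<Sum>a<k. sqrt F)"
    unfolding mnorm_eq[OF assms] by (intro sum_mono) simp
  also have "\<dots> = real n * real k * sqrt F" by simp
  finally have "(mnorm A)\<^sup>2 \<le> (real n * real k * sqrt F)\<^sup>2" by (intro power_mono) auto
  also have "\<dots> = (real n * real k)\<^sup>2 * F" using F0 by (simp add: power_mult_distrib)
  finally show ?thesis unfolding F_def trace_gram[OF assms] .
qed

lemma gram_entry_le:
  assumes "A \<in> carrier_mat n k" "B \<in> carrier_mat n l" "a < k" "b < l"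
  shows "cmod ((mat_adjoint A * B) $$ (a, b)) \<le> mnorm A * mnorm B"
proof -
  have "cmod ((mat_adjoint A * B) $$ (a, b)) \<le> mnorm (mat_adjoint A * B)"
    using assms by (intro entry_le_mnorm) auto
  also have "\<dots> \<le> mnorm A * mnorm B"
    using mnorm_mult[of "mat_adjoint A" k n B l] assms by (simp add: mnorm_adjoint)
  finally show ?thesis .
qed

section \<open>A discrete Gronwall inequality\<close>

text \<open>The numbers \<open>y n = 1 + t \<Sum>k<n. \<alpha> k * x k\<close> satisfy \<open>y (n + 1) \<le> (1 + c t (\<alpha> n)\<^sup>2) y n\<close>.\<close>

lemma gronwall_volterra:
  fixes x \<alpha> :: "nat \<Rightarrow> real"
  assumes le: "\<And>n. x n \<le> c * (\<alpha> n + t * \<alpha> n * (\<Sum>k<n. \<alpha> k * x k))"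
    and nonneg: "\<And>n. 0 \<le> \<alpha> n" "\<And>n. 0 \<le> x n" "0 \<le> c" "0 \<le> t"
  shows "x n \<le> c * exp (c * t * (\<Sum>k<n. (\<alpha> k)\<^sup>2)) * \<alpha> n"
proof -
  define y where "y n = 1 + t * (\<Sum>k<n. \<alpha> k * x k)" for n
  have xy: "x n \<le> c * \<alpha> n * y n" for n using le[of n] by (simp add: y_def algebra_simps)
  have "y n \<le> exp (c * t * (\<Sum>k<n. (\<alpha> k)\<^sup>2))" for n
  proof (induction n)
    case (Suc n)
    have y0: "0 \<le> y n" unfolding y_def using nonneg by (simp add: sum_nonneg)
    have "y (Suc n) = y n + t * \<alpha> n * x n" by (simp add: y_def algebra_simps)
    also have "\<dots> \<le> y n + t * \<alpha> n * (c * \<alpha> n * y n)"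
      using nonneg by (intro add_left_mono mult_left_mono xy) auto
    also have "\<dots> = y n * (1 + c * t * (\<alpha> n)\<^sup>2)" by (simp add: algebra_simps power2_eq_square)
    also have "\<dots> \<le> y n * exp (c * t * (\<alpha> n)\<^sup>2)" using y0 by (intro mult_left_mono) auto
    also have "\<dots> \<le> exp (c * t * (\<Sum>k<n. (\<alpha> k)\<^sup>2)) * exp (c * t * (\<alpha> n)\<^sup>2)"
      by (intro mult_right_mono Suc.IH) auto
    also have "\<dots> = exp (c * t * (\<Sum>k<Suc n. (\<alpha> k)\<^sup>2))" by (simp add: algebra_simps flip: exp_add)
    finally show ?case .
  qed (simp add: y_def)
  then have "c * \<alpha> n * y n \<le> c * \<alpha> n * exp (c * t * (\<Sum>k<n. (\<alpha> k)\<^sup>2))"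
    using nonneg by (intro mult_left_mono) auto
  then show ?thesis using xy[of n] by (simp add: mult.assoc mult.commute mult.left_commute)
qed

context pd_nodes begin

text \<open>Square summability of the coordinates of a family; by \<open>Gram_Suc\<close> it means that the increasing sequence \<open>Gram n f f\<close> is bounded.\<close>

definition l2 :: "(nat \<Rightarrow> complex mat) \<Rightarrow> bool" where
  "l2 f \<longleftrightarrow> summable (\<lambda>n. (mnorm (hat n f))\<^sup>2)"

lemma hat_smult: assumes "fam f" shows "hat n (\<lambda>j. c \<cdot>\<^sub>m f j) = c \<cdot>\<^sub>m hat n f"
proof -
  have "hat n (\<lambda>j. c \<cdot>\<^sub>m f j) = hat n (\<lambda>j. f j * (c \<cdot>\<^sub>m 1\<^sub>m m))"
    by (rule hat_cong) (simp add: mat_mult_smult carrier_matD[OF famD[OF assms]] right_mult_one_mat[OF famD[OF assms]])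
  also have "\<dots> = hat n f * (c \<cdot>\<^sub>m 1\<^sub>m m)" by (rule hat_mult[OF assms]) simp
  also have "\<dots> = c \<cdot>\<^sub>m hat n f"
    by (simp add: mat_mult_smult dim_hat[OF assms] right_mult_one_mat[OF hat_carrier[OF assms]])
  finally show ?thesis .
qed

lemma l2_smult: "fam f \<Longrightarrow> l2 f \<Longrightarrow> l2 (\<lambda>j. c \<cdot>\<^sub>m f j)"
  by (simp add: l2_def hat_smult mnorm_smult power_mult_distrib summable_mult)

lemma sum_square_le: "(a + b)\<^sup>2 \<le> 2 * a\<^sup>2 + 2 * b\<^sup>2" for a b :: real
proof -
  have "0 \<le> (a - b)\<^sup>2" by simp
  then show ?thesis by (simp add: power2_eq_square algebra_simps)
qed

lemma summable_square_add:
  fixes a b :: "nat \<Rightarrow> real"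
  assumes "summable (\<lambda>n. (a n)\<^sup>2)" "summable (\<lambda>n. (b n)\<^sup>2)"
  shows "summable (\<lambda>n. (a n + b n)\<^sup>2)"
proof (rule summable_comparison_test')
  show "summable (\<lambda>n. 2 * (a n)\<^sup>2 + 2 * (b n)\<^sup>2)" using assms by (intro summable_add summable_mult)
qed (use sum_square_le in simp)

lemma l2_diff: assumes "fam f" "fam g" "l2 f" "l2 g" shows "l2 (\<lambda>j. f j - g j)"
  unfolding l2_def
proof (rule summable_comparison_test')
  show "summable (\<lambda>n. (mnorm (hat n f) + mnorm (hat n g))\<^sup>2)"
    using assms(3,4) unfolding l2_def by (rule summable_square_add)
  show "norm ((mnorm (hat n (\<lambda>j. f j - g j)))\<^sup>2) \<le> (mnorm (hat n f) + mnorm (hat n g))\<^sup>2" for n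
    using mnorm_minus[of "hat n f" "hat n g"] assms(1,2)
    by (simp add: hat_diff dim_hat power_mono)
qed

lemma l2_mult: assumes "fam f" "X \<in> carrier_mat m m" "l2 f" shows "l2 (\<lambda>j. f j * X)"
  unfolding l2_def
proof (rule summable_comparison_test')
  show "summable (\<lambda>n. (mnorm (hat n f))\<^sup>2 * (mnorm X)\<^sup>2)"
    using assms(3) unfolding l2_def by (rule summable_mult2)
  show "norm ((mnorm (hat n (\<lambda>j. f j * X)))\<^sup>2) \<le> (mnorm (hat n f))\<^sup>2 * (mnorm X)\<^sup>2" for n
    unfolding hat_mult[OF assms(1,2)] power_mult_distrib[symmetric]
    using mnorm_mult[OF hat_carrier[OF assms(1)] assms(2)] by (simp add: power_mono)
qed

lemma Gram_entry:
  assumes "fam f" "fam g" "a < m" "b < m"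
  shows "Gram n f g $$ (a, b) = (\<Sum>k<n. (mat_adjoint (hat k f) * hat k g) $$ (a, b))"
proof (induction n)
  case 0
  then show ?case using assms by (simp add: Gram_0)
next
  case (Suc n)
  have "Gram (Suc n) f g $$ (a, b) = Gram n f g $$ (a, b) + (mat_adjoint (hat n f) * hat n g) $$ (a, b)"
    unfolding Gram_Suc[OF assms(1,2)] using assms by (subst index_add_mat) (simp_all add: dim_hat)
  then show ?case using Suc by simp
qed

lemma mnorm_Gram_le:
  assumes "fam f" "fam g"
  shows "mnorm (Gram n f g) \<le> (\<Sum>k<n. mnorm (hat k f) * mnorm (hat k g))"
proof (induction n)
  case 0
  then show ?case by (simp add: Gram_0 mnorm_def)
next
  case (Suc n)
  have "mnorm (Gram (Suc n) f g) \<le> mnorm (Gram n f g) + mnorm (mat_adjoint (hat n f) * hat n g)"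
    unfolding Gram_Suc[OF assms] using assms by (intro mnorm_add) (simp_all add: dim_hat)
  also have "mnorm (mat_adjoint (hat n f) * hat n g) \<le> mnorm (hat n f) * mnorm (hat n g)"
    using mnorm_mult[of "mat_adjoint (hat n f)" m m "hat n g" m] assms by (simp add: mnorm_adjoint)
  finally show ?case using Suc by simp
qed

lemma trace_Gram:
  assumes "fam f"
  shows "(\<Sum>a<m. Re (Gram n f f $$ (a, a))) = (\<Sum>k<n. \<Sum>a<m. Re ((mat_adjoint (hat k f) * hat k f) $$ (a, a)))"
proof -
  have "(\<Sum>a<m. Re (Gram n f f $$ (a, a))) = (\<Sum>a<m. \<Sum>k<n. Re ((mat_adjoint (hat k f) * hat k f) $$ (a, a)))"
    by (intro sum.cong refl) (simp add: Gram_entry[OF assms assms] del: index_mult_mat(1))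
  also have "\<dots> = (\<Sum>k<n. \<Sum>a<m. Re ((mat_adjoint (hat k f) * hat k f) $$ (a, a)))" by (rule sum.swap)
  finally show ?thesis .
qed

text \<open>The trace of \<open>Gram n f f\<close> is the sum of the squared coordinates.\<close>

lemma l2_if_bounded:
  assumes "fam f" "\<And>n. (\<Sum>a<m. Re (Gram n f f $$ (a, a))) \<le> C"
  shows "l2 f"
  unfolding l2_def
proof (rule bounded_imp_summable)
  fix n
  have "(\<Sum>k\<le>n. (mnorm (hat k f))\<^sup>2)
      \<le> (\<Sum>k<Suc n. (real m * real m)\<^sup>2 * (\<Sum>a<m. Re ((mat_adjoint (hat k f) * hat k f) $$ (a, a))))"
    unfolding lessThan_Suc_atMost by (intro sum_mono mnorm_square_le hat_carrier assms)
  also have "\<dots> = (real m * real m)\<^sup>2 * (\<Sum>a<m. Re (Gram (Suc n) f f $$ (a, a)))"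
    unfolding trace_Gram[OF assms(1)] sum_distrib_left ..
  also have "\<dots> \<le> (real m * real m)\<^sup>2 * C" by (intro mult_left_mono assms) simp
  finally show "(\<Sum>k\<le>n. (mnorm (hat k f))\<^sup>2) \<le> (real m * real m)\<^sup>2 * C" .
qed simp

lemma l2_gram_summable:
  assumes "fam f" "fam g" "l2 f" "l2 g" "a < m" "b < m"
  shows "summable (\<lambda>k. (mat_adjoint (hat k f) * hat k g) $$ (a, b))"
proof (rule summable_comparison_test')
  show "summable (\<lambda>k. (mnorm (hat k f))\<^sup>2 + (mnorm (hat k g))\<^sup>2)"
    using assms(3,4) unfolding l2_def by (rule summable_add)
  show "norm ((mat_adjoint (hat k f) * hat k g) $$ (a, b)) \<le> (mnorm (hat k f))\<^sup>2 + (mnorm (hat k g))\<^sup>2" for k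
  proof -
    have "cmod ((mat_adjoint (hat k f) * hat k g) $$ (a, b)) \<le> mnorm (hat k f) * mnorm (hat k g)"
      using assms by (intro gram_entry_le[of _ m m _ m]) simp_all
    also have "\<dots> \<le> (mnorm (hat k f))\<^sup>2 + (mnorm (hat k g))\<^sup>2"
      using sum_squares_bound[of "mnorm (hat k f)" "mnorm (hat k g)"] mult_nonneg_nonneg[OF mnorm_nonneg mnorm_nonneg, of "hat k f" "hat k g"]
      by linarith
    finally show ?thesis by simp
  qed
qed

lemma series_converges_iff_l2:
  assumes "fam f"
  shows "(\<forall>a<m. \<forall>b<m. summable (\<lambda>k. (mat_adjoint (hat k f) * hat k f) $$ (a, b))) \<longleftrightarrow> l2 f"
proof
  assume *: "\<forall>a<m. \<forall>b<m. summable (\<lambda>k. (mat_adjoint (hat k f) * hat k f) $$ (a, b))"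
  have "summable (\<lambda>k. \<Sum>a<m. Re ((mat_adjoint (hat k f) * hat k f) $$ (a, a)))"
    using * by (intro summable_sum summable_Re) (simp del: index_mult_mat(1))
  then have s: "summable (\<lambda>k. (real m * real m)\<^sup>2 * (\<Sum>a<m. Re ((mat_adjoint (hat k f) * hat k f) $$ (a, a))))"
    by (rule summable_mult)
  show "l2 f" unfolding l2_def
  proof (rule summable_comparison_test'[OF s])
    show "norm ((mnorm (hat k f))\<^sup>2) \<le> (real m * real m)\<^sup>2 * (\<Sum>a<m. Re ((mat_adjoint (hat k f) * hat k f) $$ (a, a)))" for k
      using mnorm_square_le[OF hat_carrier[OF assms]] by (simp del: index_mult_mat(1))
  qed
qed (use l2_gram_summable assms in blast)

text \<open>By \<open>hat_intertwine\<close> the coordinates of \<open>h\<close> satisfy a Volterra inequality whose inhomogeneity consists of the coordinates of \<open>d h\<close> and whose kernel is a product of square summable sequences, so that \<open>gronwall_volterra\<close> bounds them by a constant multiple of \<open>\<alpha>\<close>, the sum of all sequences that are known to be square summable.\<close>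

lemma l2_volterra:
  assumes it: "intertwine d e a b c g" and f: "fam a" "fam b" "fam c" "fam g" and h: "fam h"
    and l2: "l2 a" "l2 b" "l2 c" "l2 g" "l2 (\<lambda>j. d j \<cdot>\<^sub>m h j)"
    and \<delta>: "0 < \<delta>" "\<And>j. 1 \<le> j \<Longrightarrow> \<delta> \<le> cmod (d j)"
  shows "l2 h"
proof -
  let ?r = "\<lambda>j. d j \<cdot>\<^sub>m h j"
  define \<alpha> where "\<alpha> n = mnorm (hat n a) + (mnorm (hat n b) + (mnorm (hat n c) + (mnorm (hat n g) + mnorm (hat n ?r))))" for n
  have \<alpha>0: "0 \<le> \<alpha> n" for n by (simp add: \<alpha>_def)
  have \<alpha>sum: "summable (\<lambda>n. (\<alpha> n)\<^sup>2)"
    using l2 unfolding l2_def \<alpha>_def by (intro summable_square_add)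
  define x where "x n = mnorm (hat n h)" for n
  have Gb: "mnorm (hat n s) * mnorm (Gram n t h) \<le> \<alpha> n * (\<Sum>k<n. \<alpha> k * x k)"
    if "fam t" "mnorm (hat n s) \<le> \<alpha> n" "\<And>k. mnorm (hat k t) \<le> \<alpha> k" for n s t
  proof (intro mult_mono that(2) \<alpha>0)
    show "mnorm (Gram n t h) \<le> (\<Sum>k<n. \<alpha> k * x k)"
      using mnorm_Gram_le[OF that(1) h, of n]
      by (rule order_trans) (intro sum_mono mult_mono that(3), auto simp: x_def \<alpha>0)
  qed simp
  have step: "x n \<le> (1 / \<delta>) * (\<alpha> n + 2 * \<alpha> n * (\<Sum>k<n. \<alpha> k * x k))" for n
  proof -
    have eq: "d (Suc n) \<cdot>\<^sub>m hat n h = hat n ?r - (hat n a * Gram n b h - hat n c * Gram n g h)"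
      unfolding hat_intertwine[OF it f h]
      by (rule eq_matI) (simp_all add: dim_hat f h del: index_mult_mat(1))
    have "\<delta> * x n \<le> cmod (d (Suc n)) * x n" using \<delta>(2)[of "Suc n"] by (intro mult_right_mono) (auto simp: x_def)
    also have "\<dots> = mnorm (hat n ?r - (hat n a * Gram n b h - hat n c * Gram n g h))"
      unfolding x_def mnorm_smult[symmetric] eq ..
    also have "\<dots> \<le> mnorm (hat n ?r) + mnorm (hat n a * Gram n b h - hat n c * Gram n g h)"
      by (intro mnorm_minus) (simp_all add: dim_hat f h fam_smult)
    also have "mnorm (hat n a * Gram n b h - hat n c * Gram n g h) \<le> mnorm (hat n a * Gram n b h) + mnorm (hat n c * Gram n g h)"
      by (intro mnorm_minus) (simp_all add: dim_hat f h)
    also have "mnorm (hat n a * Gram n b h) \<le> mnorm (hat n a) * mnorm (Gram n b h)"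
      by (rule mnorm_mult[OF hat_carrier[OF f(1)] Gram_carrier])
    also have "mnorm (hat n c * Gram n g h) \<le> mnorm (hat n c) * mnorm (Gram n g h)"
      by (rule mnorm_mult[OF hat_carrier[OF f(3)] Gram_carrier])
    also have "mnorm (hat n a) * mnorm (Gram n b h) \<le> \<alpha> n * (\<Sum>k<n. \<alpha> k * x k)"
      by (rule Gb[OF f(2)]) (simp_all add: \<alpha>_def)
    also have "mnorm (hat n c) * mnorm (Gram n g h) \<le> \<alpha> n * (\<Sum>k<n. \<alpha> k * x k)"
      by (rule Gb[OF f(4)]) (simp_all add: \<alpha>_def)
    also have "mnorm (hat n ?r) \<le> \<alpha> n" by (simp add: \<alpha>_def)
    finally show ?thesis using \<delta>(1) by (simp add: field_simps)
  qed
  define C where "C = 1 / \<delta> * exp (1 / \<delta> * 2 * (\<Sum>k. (\<alpha> k)\<^sup>2))"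
  have "x n \<le> C * \<alpha> n" for n
  proof -
    have "x n \<le> 1 / \<delta> * exp (1 / \<delta> * 2 * (\<Sum>k<n. (\<alpha> k)\<^sup>2)) * \<alpha> n"
      using step \<alpha>0 \<delta>(1) by (intro gronwall_volterra) (auto simp: x_def)
    also have "\<dots> \<le> C * \<alpha> n"
    proof -
      have "1 / \<delta> * 2 * (\<Sum>k<n. (\<alpha> k)\<^sup>2) \<le> 1 / \<delta> * 2 * (\<Sum>k. (\<alpha> k)\<^sup>2)"
        using \<delta>(1) by (intro mult_left_mono sum_le_suminf \<alpha>sum) auto
      then show ?thesis
        unfolding C_def using \<delta>(1) by (intro mult_right_mono mult_left_mono \<alpha>0) auto
    qed
    finally show ?thesis .
  qed
  then have "norm ((mnorm (hat n h))\<^sup>2) \<le> C\<^sup>2 * (\<alpha> n)\<^sup>2" for n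
    unfolding power_mult_distrib[symmetric] x_def by (simp add: power_mono)
  then show ?thesis unfolding l2_def by (rule summable_comparison_test'[OF summable_mult[OF \<alpha>sum]])
qed

section \<open>Transport of square summability between the origin and other points\<close>

text \<open>Since \<open>ev x j = (1 - x / z\<^sub>j)\<^sup>-\<^sup>1\<close>, the families \<open>vf x\<close> and \<open>uf x\<close> consist of the blocks of \<open>R\<^sub>T(x) v\<close> and \<open>R\<^sub>T(x) u\<close>; at \<open>x = 0\<close> they are \<open>1\<close> and \<open>W\<close>.\<close>

definition ev :: "complex \<Rightarrow> nat \<Rightarrow> complex" where "ev x j = z j / (z j - x)"
definition vf :: "complex \<Rightarrow> nat \<Rightarrow> complex mat" where "vf x j = ev x j \<cdot>\<^sub>m 1\<^sub>m m"
definition uf :: "complex \<Rightarrow> nat \<Rightarrow> complex mat" where "uf x j = ev x j \<cdot>\<^sub>m W j"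

lemma vf_fun: "vf x = (\<lambda>j. ev x j \<cdot>\<^sub>m 1\<^sub>m m)" and uf_fun: "uf x = (\<lambda>j. ev x j \<cdot>\<^sub>m W j)"
  by (auto simp: vf_def uf_def)

lemma fam_vf [simp]: "fam (vf x)" and fam_uf [simp]: "fam (uf x)"
  using W_carrier by (simp_all add: fam_def vf_def uf_def)

text \<open>All four families are scalar multiples of \<open>1\<close> or \<open>W\<close>, and then both sides of the displacement equation are multiples of \<open>W\<^sub>j - W\<^sub>k\<^sup>*\<close>: only an identity between the scalars is left.\<close>

lemma intertwine_scalar:
  assumes "\<And>j k. 1 \<le> j \<Longrightarrow> 1 \<le> k \<Longrightarrow> (d j - e k) * (z j * cnj (z k)) = - (s * da j * cnj (db k)) * (z j - cnj (z k))"
  shows "intertwine d e (\<lambda>j. s \<cdot>\<^sub>m (da j \<cdot>\<^sub>m 1\<^sub>m m)) (\<lambda>j. db j \<cdot>\<^sub>m W j) (\<lambda>j. s \<cdot>\<^sub>m (da j \<cdot>\<^sub>m W j)) (\<lambda>j. db j \<cdot>\<^sub>m 1\<^sub>m m)"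
  unfolding intertwine_def
proof (intro allI impI)
  fix j k :: nat assume jk: "1 \<le> j" "1 \<le> k"
  note c = W_carrier[OF jk(1)] W_carrier[OF jk(2)]
  note d = carrier_matD[OF c(1)] carrier_matD[OF c(2)]
  have ne: "z j - cnj (z k) \<noteq> 0" using z_cnj[OF jk] by simp
  have e: "(d j - e k) * (z j * cnj (z k) / (z j - cnj (z k))) = - (s * da j * cnj (db k))"
    using assms[OF jk] ne by (simp add: field_simps)
  have l: "(d j - e k) \<cdot>\<^sub>m pick_block j k = (- (s * da j * cnj (db k))) \<cdot>\<^sub>m (W j - mat_adjoint (W k))"
    unfolding pick_block_def mat_smult_smult e ..
  have r1: "s \<cdot>\<^sub>m (da j \<cdot>\<^sub>m 1\<^sub>m m) * mat_adjoint (db k \<cdot>\<^sub>m W k) = (s * da j * cnj (db k)) \<cdot>\<^sub>m mat_adjoint (W k)"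
    using d by (simp add: mat_expand ac_simps)
  have r2: "s \<cdot>\<^sub>m (da j \<cdot>\<^sub>m W j) * mat_adjoint (db k \<cdot>\<^sub>m 1\<^sub>m m) = (s * da j * cnj (db k)) \<cdot>\<^sub>m W j"
    using d by (simp add: mat_expand ac_simps)
  show "(d j - e k) \<cdot>\<^sub>m pick_block j k = s \<cdot>\<^sub>m (da j \<cdot>\<^sub>m 1\<^sub>m m) * mat_adjoint (db k \<cdot>\<^sub>m W k)
      - s \<cdot>\<^sub>m (da j \<cdot>\<^sub>m W j) * mat_adjoint (db k \<cdot>\<^sub>m 1\<^sub>m m)"
    unfolding l r1 r2 using d by (intro eq_matI) (simp_all add: algebra_simps)
qed

lemma intertwine_resolvent:
  assumes "\<And>j. 1 \<le> j \<Longrightarrow> z j \<noteq> x" "\<And>j. 1 \<le> j \<Longrightarrow> z j \<noteq> cnj x"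
  shows "intertwine (ev x) (\<lambda>k. cnj (ev (cnj x) k)) (\<lambda>j. x \<cdot>\<^sub>m vf x j) (uf (cnj x)) (\<lambda>j. x \<cdot>\<^sub>m uf x j) (vf (cnj x))"
  unfolding vf_fun uf_fun
proof (rule intertwine_scalar[where s = x and da = "ev x" and db = "ev (cnj x)"])
  fix j k :: nat assume jk: "1 \<le> j" "1 \<le> k"
  have "z j - x \<noteq> 0" "cnj (z k) - x \<noteq> 0" using assms(1)[OF jk(1)] assms(2)[OF jk(2)] by auto
  then have "z j / (z j - x) - cnj (z k) / (cnj (z k) - x) = - (x * (z j - cnj (z k))) / ((z j - x) * (cnj (z k) - x))"
  proof -
    assume ne: "z j - x \<noteq> 0" "cnj (z k) - x \<noteq> 0"
    have "z j * (cnj (z k) - x) - cnj (z k) * (z j - x) = - (x * (z j - cnj (z k)))"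
      by (simp add: algebra_simps)
    then show ?thesis unfolding diff_frac_eq[OF ne] by (simp only:)
  qed
  then show "(ev x j - cnj (ev (cnj x) k)) * (z j * cnj (z k)) = - (x * ev x j * cnj (ev (cnj x) k)) * (z j - cnj (z k))"
    by (simp add: ev_def)
qed

lemma intertwine_inverse_resolvent:
  "intertwine (\<lambda>j. 1 - x / z j) (\<lambda>k. 1 - x / cnj (z k)) (\<lambda>j. (- x) \<cdot>\<^sub>m vf 0 j) (uf 0) (\<lambda>j. (- x) \<cdot>\<^sub>m uf 0 j) (vf 0)"
  unfolding vf_fun uf_fun
proof (rule intertwine_scalar[where s = "- x" and da = "ev 0" and db = "ev 0"])
  fix j k :: nat assume jk: "1 \<le> j" "1 \<le> k"
  then have "z j \<noteq> 0" "z k \<noteq> 0" using z_nonzero by auto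
  then show "((1 - x / z j) - (1 - x / cnj (z k))) * (z j * cnj (z k)) = - (- x * ev 0 j * cnj (ev 0 k)) * (z j - cnj (z k))"
    by (simp add: ev_def field_simps)
qed

lemma l2_cong: "(\<And>j. 1 \<le> j \<Longrightarrow> f j = g j) \<Longrightarrow> l2 f \<longleftrightarrow> l2 g"
  unfolding l2_def using hat_cong[of f g] by simp

text \<open>Multiplication by \<open>1 - x / z\<^sub>j\<close> maps the families at \<open>x\<close> to those at the origin, and it intertwines through the families at the origin alone.\<close>

lemma l2_from_origin:
  assumes "l2 (vf 0)" "l2 (uf 0)"
    and \<delta>: "0 < \<delta>" "\<And>j. 1 \<le> j \<Longrightarrow> \<delta> \<le> cmod (1 - x / z j)"
  shows "l2 (vf x)" "l2 (uf x)"
proof -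
  have ev: "(1 - x / z j) * ev x j = ev 0 j" if "1 \<le> j" for j
  proof -
    have "z j \<noteq> 0" using z_nonzero[OF that] .
    moreover have "1 - x / z j \<noteq> 0" using \<delta>(2)[OF that] \<delta>(1) by (metis norm_zero not_less)
    then have "z j - x \<noteq> 0" using \<open>z j \<noteq> 0\<close> by (metis diff_self divide_self eq_iff_diff_eq_0)
    ultimately show ?thesis by (simp add: ev_def field_simps)
  qed
  have V: "l2 h" if "fam h" "l2 (\<lambda>j. (1 - x / z j) \<cdot>\<^sub>m h j)" for h
    by (rule l2_volterra[OF intertwine_inverse_resolvent[of x] _ _ _ _ that(1) _ _ _ _ that(2) \<delta>])
      (simp_all add: fam_smult l2_smult assms(1,2))
  have "l2 (\<lambda>j. (1 - x / z j) \<cdot>\<^sub>m vf x j)"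
    using assms(1) by (subst l2_cong[of _ "vf 0"]) (simp_all only: vf_def mat_smult_smult ev)
  then show "l2 (vf x)" by (rule V[rotated]) simp
  have "l2 (\<lambda>j. (1 - x / z j) \<cdot>\<^sub>m uf x j)"
    using assms(2) by (subst l2_cong[of _ "uf 0"]) (simp_all only: uf_def mat_smult_smult ev)
  then show "l2 (uf x)" by (rule V[rotated]) simp
qed

text \<open>Multiplication by \<open>ev x\<close> maps the families at the origin to those at \<open>x\<close>. It intertwines through the families at \<open>x\<close> on one side and at \<open>cnj x\<close> on the other, whence the four hypotheses.\<close>

lemma l2_to_origin:
  assumes "l2 (vf x)" "l2 (uf x)" "l2 (vf (cnj x))" "l2 (uf (cnj x))"
    and ne: "\<And>j. 1 \<le> j \<Longrightarrow> z j \<noteq> x" "\<And>j. 1 \<le> j \<Longrightarrow> z j \<noteq> cnj x"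
    and \<delta>: "0 < \<delta>" "\<And>j. 1 \<le> j \<Longrightarrow> \<delta> \<le> cmod (ev x j)"
  shows "l2 (vf 0)" "l2 (uf 0)"
proof -
  have ev: "ev x j * ev 0 j = ev x j" if "1 \<le> j" for j
    using z_nonzero[OF that] by (simp add: ev_def)
  have V: "l2 h" if "fam h" "l2 (\<lambda>j. ev x j \<cdot>\<^sub>m h j)" for h
    by (rule l2_volterra[OF intertwine_resolvent[OF ne] _ _ _ _ that(1) _ _ _ _ that(2) \<delta>])
      (simp_all add: fam_smult l2_smult assms(1-4))
  have "l2 (\<lambda>j. ev x j \<cdot>\<^sub>m vf 0 j)"
    using assms(1) by (subst l2_cong[of _ "vf x"]) (simp_all only: vf_def mat_smult_smult ev)
  then show "l2 (vf 0)" by (rule V[rotated]) simp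
  have "l2 (\<lambda>j. ev x j \<cdot>\<^sub>m uf 0 j)"
    using assms(2) by (subst l2_cong[of _ "uf x"]) (simp_all only: uf_def mat_smult_smult ev)
  then show "l2 (uf 0)" by (rule V[rotated]) simp
qed

end

section \<open>The Nevanlinna kernel is positive\<close>

text \<open>The value that the normalized Cauchy integral of \<open>f\<close> over the circle with centre \<open>c\<close> and radius \<open>\<rho>\<close> takes at \<open>\<xi>\<close>. The outer part is its value at the mirror image of \<open>\<eta>\<close> in that circle; the mirror image of the centre is the point at infinity, where the integral vanishes.\<close>

definition inner_part :: "(complex \<Rightarrow> complex) \<Rightarrow> complex \<Rightarrow> real \<Rightarrow> complex \<Rightarrow> complex" where
  "inner_part f c \<rho> \<xi> = (if cmod (\<xi> - c) < \<rho> then f \<xi> else 0)"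

definition outer_part :: "(complex \<Rightarrow> complex) \<Rightarrow> complex \<Rightarrow> real \<Rightarrow> complex \<Rightarrow> complex" where
  "outer_part f c \<rho> \<eta> = (if \<eta> = c then 0 else inner_part f c \<rho> (c + of_real (\<rho>\<^sup>2) / cnj (\<eta> - c)))"

lemma cauchy_circle:
  assumes "continuous_on (cball c \<rho>) f" "f holomorphic_on ball c \<rho>" "0 < \<rho>" "cmod (\<xi> - c) \<noteq> \<rho>"
  shows "((\<lambda>\<tau>. f \<tau> / (\<tau> - \<xi>)) has_contour_integral (2 * of_real pi * \<i> * inner_part f c \<rho> \<xi>)) (circlepath c \<rho>)"
proof (cases "cmod (\<xi> - c) < \<rho>")
  case True
  then show ?thesis using Cauchy_integral_circlepath[OF assms(1,2) True] by (simp add: inner_part_def)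
next
  case False
  then have far: "\<rho> < cmod (\<xi> - c)" using assms(4) by simp
  have ne: "\<tau> \<noteq> \<xi>" if "\<tau> \<in> cball c \<rho>" for \<tau>
    using that far by (auto simp: dist_norm norm_minus_commute)
  have "((\<lambda>\<tau>. f \<tau> / (\<tau> - \<xi>)) has_contour_integral 0) (circlepath c \<rho>)"
  proof (rule Cauchy_theorem_disc[where K = "{}" and a = c and e = \<rho>])
    show "continuous_on (cball c \<rho>) (\<lambda>\<tau>. f \<tau> / (\<tau> - \<xi>))"
      using ne by (intro continuous_intros assms(1)) auto
    show "(\<lambda>\<tau>. f \<tau> / (\<tau> - \<xi>)) field_differentiable at x" if "x \<in> ball c \<rho> - {}" for x
    proof -
      have "(\<lambda>\<tau>. f \<tau> / (\<tau> - \<xi>)) holomorphic_on ball c \<rho>"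
        using ne by (intro holomorphic_intros assms(2)) (auto simp: less_imp_le)
      then show ?thesis using that holomorphic_on_imp_differentiable_at by blast
    qed
  qed (use assms(3) in auto)
  then show ?thesis using False by (simp add: inner_part_def)
qed

text \<open>On the circle \<open>cnj (\<tau> - c) = \<rho>\<^sup>2 / (\<tau> - c)\<close>, so that the integrand is \<open>f\<close> times a rational function with poles at \<open>\<xi>\<close> and at the mirror image of \<open>\<eta>\<close>; partial fractions separate them.\<close>

lemma circle_kernel_integral:
  assumes f: "continuous_on (cball c \<rho>) f" "f holomorphic_on ball c \<rho>" and \<rho>: "0 < \<rho>"
    and ne: "cmod (\<xi> - c) \<noteq> \<rho>" "cmod (\<eta> - c) \<noteq> \<rho>" "of_real (\<rho>\<^sup>2) \<noteq> cnj (\<eta> - c) * (\<xi> - c)"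
  shows "((\<lambda>t. f (circlepath c \<rho> t) / ((circlepath c \<rho> t - \<xi>) * cnj (circlepath c \<rho> t - \<eta>))) has_integral
     ((inner_part f c \<rho> \<xi> - outer_part f c \<rho> \<eta>) / (of_real (\<rho>\<^sup>2) - cnj (\<eta> - c) * (\<xi> - c)))) {0..1}"
proof -
  define D where "D = of_real (\<rho>\<^sup>2) - cnj (\<eta> - c) * (\<xi> - c)"
  have D: "D \<noteq> 0" using ne(3) by (simp add: D_def)
  define h where "h \<tau> = cnj (\<eta> - c) / (of_real (\<rho>\<^sup>2) - cnj (\<eta> - c) * (\<tau> - c))" for \<tau>
  have second: "((\<lambda>\<tau>. f \<tau> * h \<tau>) has_contour_integral (- (2 * of_real pi * \<i> * outer_part f c \<rho> \<eta>))) (circlepath c \<rho>)"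
  proof (cases "\<eta> = c")
    case True
    then show ?thesis by (simp add: h_def outer_part_def has_contour_integral_0)
  next
    case False
    define p where "p = c + of_real (\<rho>\<^sup>2) / cnj (\<eta> - c)"
    have c0: "cnj (\<eta> - c) \<noteq> 0" using False by (simp add: complex_cnj_cancel_iff)
    have "cmod (p - c) = \<rho>\<^sup>2 / cmod (\<eta> - c)"
      unfolding p_def by (simp add: norm_divide norm_power del: complex_cnj_diff)
    moreover have "\<rho>\<^sup>2 / cmod (\<eta> - c) \<noteq> \<rho>"
      using ne(2) \<rho> False by (auto simp: field_simps power2_eq_square)
    ultimately have "cmod (p - c) \<noteq> \<rho>" by simp
    from cauchy_circle[OF f \<rho> this]
    have "((\<lambda>\<tau>. - (f \<tau> / (\<tau> - p))) has_contour_integral - (2 * of_real pi * \<i> * inner_part f c \<rho> p)) (circlepath c \<rho>)"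
      by (rule has_contour_integral_neg)
    moreover have "- (f \<tau> / (\<tau> - p)) = f \<tau> * h \<tau>" for \<tau>
    proof -
      have "of_real (\<rho>\<^sup>2) - cnj (\<eta> - c) * (\<tau> - c) = - (cnj (\<eta> - c) * (\<tau> - p))"
        unfolding p_def using c0 by (simp add: field_simps)
      then have "h \<tau> = - (cnj (\<eta> - c) / (cnj (\<eta> - c) * (\<tau> - p)))" unfolding h_def by simp
      also have "\<dots> = - (1 / (\<tau> - p))" using c0 by simp
      finally show ?thesis by simp
    qed
    ultimately show ?thesis using False by (simp add: outer_part_def p_def)
  qed
  have "((\<lambda>\<tau>. (f \<tau> / (\<tau> - \<xi>) + f \<tau> * h \<tau>) / D) has_contour_integral
      (2 * of_real pi * \<i> * inner_part f c \<rho> \<xi> + - (2 * of_real pi * \<i> * outer_part f c \<rho> \<eta>)) / D) (circlepath c \<rho>)"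
    by (intro has_contour_integral_div has_contour_integral_add cauchy_circle[OF f \<rho> ne(1)] second)
  then have int: "((\<lambda>t. (f (circlepath c \<rho> t) / (circlepath c \<rho> t - \<xi>) + f (circlepath c \<rho> t) * h (circlepath c \<rho> t)) / D
       * vector_derivative (circlepath c \<rho>) (at t)) has_integral
      (2 * of_real pi * \<i> * inner_part f c \<rho> \<xi> + - (2 * of_real pi * \<i> * outer_part f c \<rho> \<eta>)) / D) {0..1}"
    unfolding has_contour_integral .
  define k where "k = 2 * complex_of_real pi * \<i>"
  have k0: "k \<noteq> 0" by (simp add: k_def)
  have val: "1 / k * ((k * inner_part f c \<rho> \<xi> + - (k * outer_part f c \<rho> \<eta>)) / D)
     = (inner_part f c \<rho> \<xi> - outer_part f c \<rho> \<eta>) / D"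
  proof -
    have "k * inner_part f c \<rho> \<xi> + - (k * outer_part f c \<rho> \<eta>) = k * (inner_part f c \<rho> \<xi> - outer_part f c \<rho> \<eta>)"
      by (simp add: algebra_simps)
    then show "1 / k * ((k * inner_part f c \<rho> \<xi> + - (k * outer_part f c \<rho> \<eta>)) / D)
     = (inner_part f c \<rho> \<xi> - outer_part f c \<rho> \<eta>) / D" using k0 by simp
  qed
  have pt: "1 / k * ((f (circlepath c \<rho> t) / (circlepath c \<rho> t - \<xi>) + f (circlepath c \<rho> t) * h (circlepath c \<rho> t)) / D
       * vector_derivative (circlepath c \<rho>) (at t))
     = f (circlepath c \<rho> t) / ((circlepath c \<rho> t - \<xi>) * cnj (circlepath c \<rho> t - \<eta>))" for t
  proof -
    define \<tau> where "\<tau> = circlepath c \<rho> t"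
    define \<sigma> where "\<sigma> = \<tau> - c"
    have \<sigma>: "\<sigma> = of_real \<rho> * exp (2 * of_real pi * \<i> * of_real t)" by (simp add: \<sigma>_def \<tau>_def circlepath)
    have vd: "vector_derivative (circlepath c \<rho>) (at t) = k * \<sigma>"
      unfolding vector_derivative_circlepath \<sigma> k_def by simp
    have mod: "cmod \<sigma> = \<rho>" unfolding \<sigma> using \<rho> by (simp add: norm_mult)
    have s2: "\<sigma> * cnj \<sigma> = of_real (\<rho>\<^sup>2)" unfolding complex_norm_square[symmetric] mod ..
    have \<sigma>0: "\<sigma> \<noteq> 0" using mod \<rho> by auto
    have n1: "\<tau> - \<xi> \<noteq> 0" using mod ne(1) by (auto simp: \<sigma>_def)
    have n2: "cnj (\<tau> - \<eta>) \<noteq> 0" using mod ne(2) by (auto simp: \<sigma>_def complex_cnj_cancel_iff)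
    have \<tau>: "\<tau> = \<sigma> + c" by (simp add: \<sigma>_def)
    have den: "of_real (\<rho>\<^sup>2) - cnj (\<eta> - c) * (\<tau> - c) = \<sigma> * cnj (\<tau> - \<eta>)"
      unfolding s2[symmetric] \<tau> by (simp add: algebra_simps)
    have uf: "1 / (\<tau> - \<xi>) + h \<tau> = D / ((\<tau> - \<xi>) * (\<sigma> * cnj (\<tau> - \<eta>)))"
    proof -
      have "h \<tau> = cnj (\<eta> - c) / (\<sigma> * cnj (\<tau> - \<eta>))" unfolding h_def den ..
      moreover have "\<sigma> * cnj (\<tau> - \<eta>) + cnj (\<eta> - c) * (\<tau> - \<xi>) = D"
        unfolding D_def s2[symmetric] \<tau> by (simp add: algebra_simps)
      ultimately show ?thesis
        using n1 n2 \<sigma>0 add_frac_eq[of "\<tau> - \<xi>" "\<sigma> * cnj (\<tau> - \<eta>)" 1 "cnj (\<eta> - c)"] by simp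
    qed
    have "f \<tau> / (\<tau> - \<xi>) + f \<tau> * h \<tau> = f \<tau> * (1 / (\<tau> - \<xi>) + h \<tau>)" by (simp add: algebra_simps)
    also have "\<dots> / D * \<sigma> = f \<tau> / ((\<tau> - \<xi>) * cnj (\<tau> - \<eta>))" unfolding uf using D \<sigma>0 by simp
    finally have "(f \<tau> / (\<tau> - \<xi>) + f \<tau> * h \<tau>) / D * \<sigma> = f \<tau> / ((\<tau> - \<xi>) * cnj (\<tau> - \<eta>))" .
    moreover have "1 / k * ((f \<tau> / (\<tau> - \<xi>) + f \<tau> * h \<tau>) / D * (k * \<sigma>))
       = (f \<tau> / (\<tau> - \<xi>) + f \<tau> * h \<tau>) / D * \<sigma>" using k0 by simp
    ultimately show ?thesis unfolding vd \<tau>_def by simp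
  qed
  show ?thesis
    using has_integral_mult_right[OF int, of "1 / k"] unfolding k_def[symmetric] val pt unfolding D_def .
qed

lemma nevanlinna_im_form:
  assumes w: "w \<in> nevanlinna_class m" and \<tau>: "\<tau> \<in> upper_half"
  shows "0 \<le> Re (\<Sum>a<m. \<Sum>b<m. cnj (y a) * ((w \<tau> $$ (a, b) - cnj (w \<tau> $$ (b, a))) / (2 * \<i>)) * y b)"
proof -
  define M where "M = (1 / (2 * \<i>)) \<cdot>\<^sub>m (w \<tau> - mat_adjoint (w \<tau>))"
  have M: "psd_mat m M" using w \<tau> by (simp add: nevanlinna_class_def M_def)
  have c: "w \<tau> \<in> carrier_mat m m" using w \<tau> by (simp add: nevanlinna_class_def)
  have "0 \<le> Re ((M *\<^sub>v vec m y) \<bullet>c vec m y)" using M by (simp add: psd_mat_def)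
  also have "(M *\<^sub>v vec m y) \<bullet>c vec m y = (\<Sum>a<m. \<Sum>b<m. cnj (y a) * ((w \<tau> $$ (a, b) - cnj (w \<tau> $$ (b, a))) / (2 * \<i>)) * y b)"
    unfolding cscalar_form[OF psd_carrier[OF M] vec_carrier vec_carrier]
    using carrier_matD[OF c] by (intro sum.cong refl) (simp add: M_def)
  finally show ?thesis .
qed

lemma sum_indicator_collapse:
  fixes G q :: "nat \<Rightarrow> complex"
  assumes "\<And>k. k < n \<Longrightarrow> a k < m"
  shows "(\<Sum>b<m. G b * (\<Sum>k<n. if a k = b then q k else 0)) = (\<Sum>k<n. G (a k) * q k)"
proof -
  have "(\<Sum>b<m. G b * (\<Sum>k<n. if a k = b then q k else 0)) = (\<Sum>b<m. \<Sum>k<n. if a k = b then G b * q k else 0)"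
    by (simp add: sum_distrib_left if_distrib cong: if_cong)
  also have "\<dots> = (\<Sum>k<n. \<Sum>b<m. if a k = b then G b * q k else 0)" by (rule sum.swap)
  also have "\<dots> = (\<Sum>k<n. G (a k) * q k)" using assms by (intro sum.cong) auto
  finally show ?thesis .
qed

text \<open>The form of \<open>M\<close> at a vector whose entry \<open>b\<close> collects all \<open>q k\<close> with \<open>a k = b\<close>. It allows several points to address the same row of a matrix function.\<close>

lemma form_collapse:
  fixes M :: "nat \<Rightarrow> nat \<Rightarrow> complex" and p q :: "nat \<Rightarrow> complex"
  assumes a: "\<And>k. k < n \<Longrightarrow> a k < m"
  shows "(\<Sum>b<m. \<Sum>b'<m. (\<Sum>i<n. if a i = b then p i else 0) * M b b' * (\<Sum>k<n. if a k = b' then q k else 0))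
     = (\<Sum>i<n. \<Sum>k<n. p i * M (a i) (a k) * q k)"
proof -
  have "(\<Sum>b<m. \<Sum>b'<m. (\<Sum>i<n. if a i = b then p i else 0) * M b b' * (\<Sum>k<n. if a k = b' then q k else 0))
     = (\<Sum>b<m. (\<Sum>k<n. M b (a k) * q k) * (\<Sum>i<n. if a i = b then p i else 0))"
  proof (rule sum.cong[OF refl])
    fix b
    have "(\<Sum>b'<m. (\<Sum>i<n. if a i = b then p i else 0) * M b b' * (\<Sum>k<n. if a k = b' then q k else 0))
      = (\<Sum>i<n. if a i = b then p i else 0) * (\<Sum>b'<m. M b b' * (\<Sum>k<n. if a k = b' then q k else 0))"
      by (simp add: sum_distrib_left mult.assoc)
    also have "(\<Sum>b'<m. M b b' * (\<Sum>k<n. if a k = b' then q k else 0)) = (\<Sum>k<n. M b (a k) * q k)"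
      by (rule sum_indicator_collapse[OF a])
    finally show "(\<Sum>b'<m. (\<Sum>i<n. if a i = b then p i else 0) * M b b' * (\<Sum>k<n. if a k = b' then q k else 0))
      = (\<Sum>k<n. M b (a k) * q k) * (\<Sum>i<n. if a i = b then p i else 0)" by (simp only: mult.commute)
  qed
  also have "\<dots> = (\<Sum>i<n. (\<Sum>k<n. M (a i) (a k) * q k) * p i)" by (rule sum_indicator_collapse[OF a])
  also have "\<dots> = (\<Sum>i<n. \<Sum>k<n. p i * M (a i) (a k) * q k)"
    by (simp add: sum_distrib_left sum_distrib_right ac_simps)
  finally show ?thesis .
qed

text \<open>At every point \<open>\<tau>\<close> of the circle the imaginary part of \<open>w \<tau>\<close> is tested with the vector that is the sum of \<open>V\<^sub>k / cnj (\<tau> - s\<^sub>k)\<close> times the unit vector \<open>a k\<close>. Integration over the circle replaces each entry by its Cauchy integrals.\<close>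

lemma kernel_circle_nonneg:
  fixes n :: nat and a :: "nat \<Rightarrow> nat" and s V :: "nat \<Rightarrow> complex"
  assumes w: "w \<in> nevanlinna_class m" and \<rho>: "0 < \<rho>" and sub: "cball c \<rho> \<subseteq> upper_half"
    and a: "\<And>i. i < n \<Longrightarrow> a i < m" and s: "\<And>i. i < n \<Longrightarrow> cmod (s i - c) \<noteq> \<rho>"
    and ne: "\<And>i k. i < n \<Longrightarrow> k < n \<Longrightarrow> of_real (\<rho>\<^sup>2) \<noteq> cnj (s k - c) * (s i - c)"
  shows "0 \<le> Re (\<Sum>i<n. \<Sum>k<n. cnj (V i) * V k / (2 * \<i>)
     * ((inner_part (\<lambda>\<tau>. w \<tau> $$ (a i, a k)) c \<rho> (s i) - outer_part (\<lambda>\<tau>. w \<tau> $$ (a i, a k)) c \<rho> (s k)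
       - cnj (inner_part (\<lambda>\<tau>. w \<tau> $$ (a k, a i)) c \<rho> (s k) - outer_part (\<lambda>\<tau>. w \<tau> $$ (a k, a i)) c \<rho> (s i)))
       / (of_real (\<rho>\<^sup>2) - cnj (s k - c) * (s i - c))))"
proof -
  define \<tau> where "\<tau> t = circlepath c \<rho> t" for t
  have hol: "(\<lambda>\<tau>. w \<tau> $$ (i, k)) holomorphic_on upper_half" if "i < m" "k < m" for i k
    using w that by (simp add: nevanlinna_class_def)
  define I where "I f i k = (inner_part f c \<rho> (s i) - outer_part f c \<rho> (s k)) / (of_real (\<rho>\<^sup>2) - cnj (s k - c) * (s i - c))" for f i k
  have J: "((\<lambda>t. w (\<tau> t) $$ (b, b') / ((\<tau> t - s i) * cnj (\<tau> t - s k))) has_integral I (\<lambda>\<tau>. w \<tau> $$ (b, b')) i k) {0..1}"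
    if "b < m" "b' < m" "i < n" "k < n" for b b' i k
  proof -
    have "continuous_on (cball c \<rho>) (\<lambda>\<tau>. w \<tau> $$ (b, b'))"
      by (rule continuous_on_subset[OF holomorphic_on_imp_continuous_on[OF hol[OF that(1,2)]] sub])
    moreover have "(\<lambda>\<tau>. w \<tau> $$ (b, b')) holomorphic_on ball c \<rho>"
      by (rule holomorphic_on_subset[OF hol[OF that(1,2)] order_trans[OF ball_subset_cball sub]])
    ultimately show ?thesis unfolding \<tau>_def I_def
      by (rule circle_kernel_integral[OF _ _ \<rho> s[OF that(3)] s[OF that(4)] ne[OF that(3,4)]])
  qed
  have T: "((\<lambda>t. cnj (V i) * V k / (2 * \<i>) *
       (w (\<tau> t) $$ (a i, a k) / ((\<tau> t - s i) * cnj (\<tau> t - s k)) - cnj (w (\<tau> t) $$ (a k, a i) / ((\<tau> t - s k) * cnj (\<tau> t - s i)))))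
     has_integral (cnj (V i) * V k / (2 * \<i>) * (I (\<lambda>\<tau>. w \<tau> $$ (a i, a k)) i k - cnj (I (\<lambda>\<tau>. w \<tau> $$ (a k, a i)) k i)))) {0..1}"
    if "i < n" "k < n" for i k
    using that has_integral_linear[OF J[OF a a, of k i k i] bounded_linear_cnj, unfolded o_def]
    by (intro has_integral_mult_right has_integral_diff J a) auto
  have int: "((\<lambda>t. \<Sum>i<n. \<Sum>k<n. cnj (V i) * V k / (2 * \<i>) *
       (w (\<tau> t) $$ (a i, a k) / ((\<tau> t - s i) * cnj (\<tau> t - s k)) - cnj (w (\<tau> t) $$ (a k, a i) / ((\<tau> t - s k) * cnj (\<tau> t - s i)))))
     has_integral (\<Sum>i<n. \<Sum>k<n. cnj (V i) * V k / (2 * \<i>) * (I (\<lambda>\<tau>. w \<tau> $$ (a i, a k)) i k - cnj (I (\<lambda>\<tau>. w \<tau> $$ (a k, a i)) k i)))) {0..1}"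
    using T by (intro has_integral_sum) auto
  have pos: "0 \<le> Re (\<Sum>i<n. \<Sum>k<n. cnj (V i) * V k / (2 * \<i>) *
       (w (\<tau> t) $$ (a i, a k) / ((\<tau> t - s i) * cnj (\<tau> t - s k)) - cnj (w (\<tau> t) $$ (a k, a i) / ((\<tau> t - s k) * cnj (\<tau> t - s i)))))"
    if "t \<in> {0..1}" for t
  proof -
    have "\<tau> t \<in> cball c \<rho>" unfolding \<tau>_def using \<rho> by (simp add: circlepath dist_norm norm_mult)
    then have up: "\<tau> t \<in> upper_half" using sub by blast
    define M where "M b b' = (w (\<tau> t) $$ (b, b') - cnj (w (\<tau> t) $$ (b', b))) / (2 * \<i>)" for b b'
    define q where "q k = V k / cnj (\<tau> t - s k)" for k
    define y where "y b = (\<Sum>k<n. if a k = b then q k else 0)" for b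
    have "0 \<le> Re (\<Sum>b<m. \<Sum>b'<m. cnj (y b) * M b b' * y b')"
      unfolding M_def by (rule nevanlinna_im_form[OF w up])
    note pos = this
    have cy: "cnj (y b) = (\<Sum>k<n. if a k = b then cnj (q k) else 0)" for b
      unfolding y_def cnj_sum by (intro sum.cong) auto
    have "(\<Sum>b<m. \<Sum>b'<m. cnj (y b) * M b b' * y b') = (\<Sum>i<n. \<Sum>k<n. cnj (q i) * M (a i) (a k) * q k)"
      unfolding cy unfolding y_def
      by (rule form_collapse[where p = "\<lambda>i. cnj (q i)" and a = a and M = M and q = q]) (rule a)
    also have "\<dots> = (\<Sum>i<n. \<Sum>k<n. cnj (V i) * V k / (2 * \<i>) *
       (w (\<tau> t) $$ (a i, a k) / ((\<tau> t - s i) * cnj (\<tau> t - s k)) - cnj (w (\<tau> t) $$ (a k, a i) / ((\<tau> t - s k) * cnj (\<tau> t - s i)))))"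
      by (intro sum.cong refl) (simp add: q_def M_def diff_divide_distrib algebra_simps)
    finally show ?thesis using pos by simp
  qed
  have "0 \<le> Re (\<Sum>i<n. \<Sum>k<n. cnj (V i) * V k / (2 * \<i>) * (I (\<lambda>\<tau>. w \<tau> $$ (a i, a k)) i k - cnj (I (\<lambda>\<tau>. w \<tau> $$ (a k, a i)) k i)))"
    by (rule has_integral_nonneg[OF has_integral_linear[OF int bounded_linear_Re, unfolded o_def]]) (rule pos)
  moreover have "I (\<lambda>\<tau>. w \<tau> $$ (a i, a k)) i k - cnj (I (\<lambda>\<tau>. w \<tau> $$ (a k, a i)) k i)
     = (inner_part (\<lambda>\<tau>. w \<tau> $$ (a i, a k)) c \<rho> (s i) - outer_part (\<lambda>\<tau>. w \<tau> $$ (a i, a k)) c \<rho> (s k)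
       - cnj (inner_part (\<lambda>\<tau>. w \<tau> $$ (a k, a i)) c \<rho> (s k) - outer_part (\<lambda>\<tau>. w \<tau> $$ (a k, a i)) c \<rho> (s i)))
       / (of_real (\<rho>\<^sup>2) - cnj (s k - c) * (s i - c))" for i k
  proof -
    have "cnj (I (\<lambda>\<tau>. w \<tau> $$ (a k, a i)) k i) = cnj (inner_part (\<lambda>\<tau>. w \<tau> $$ (a k, a i)) c \<rho> (s k) - outer_part (\<lambda>\<tau>. w \<tau> $$ (a k, a i)) c \<rho> (s i))
      / (of_real (\<rho>\<^sup>2) - cnj (s k - c) * (s i - c))"
      unfolding I_def by (simp add: mult.commute)
    then show ?thesis unfolding I_def by (simp only: diff_divide_distrib)
  qed
  ultimately show ?thesis by simp
qed

text \<open>The discs with centre \<open>\<i> S\<close> and radius \<open>sqrt (S\<^sup>2 - 1)\<close> exhaust the half-plane as \<open>S\<close> tends to infinity, and mirror images in their boundaries tend to complex conjugates.\<close>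

lemma inner_outer_limits:
  assumes f: "f holomorphic_on upper_half" and s: "Im s \<noteq> 0"
  defines "\<rho> \<equiv> \<lambda>S. sqrt (S\<^sup>2 - 1)" and "c \<equiv> \<lambda>S. \<i> * complex_of_real S"
  shows "((\<lambda>S. inner_part f (c S) (\<rho> S) s) \<longlongrightarrow> (if 0 < Im s then f s else 0)) at_top"
    and "((\<lambda>S. outer_part f (c S) (\<rho> S) s) \<longlongrightarrow> (if 0 < Im s then 0 else f (cnj s))) at_top"
    and "eventually (\<lambda>S. cmod (s - c S) \<noteq> \<rho> S) at_top"
proof -
  have dist: "(cmod (s - c S))\<^sup>2 = (cmod s)\<^sup>2 - 2 * S * Im s + S\<^sup>2" for S
    unfolding c_def cmod_power2 by (simp add: power2_eq_square algebra_simps)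
  (* For such S the point s and its mirror image lie on the sides of the circle that they have in the limit. *)
  have big: "eventually (\<lambda>S. 1 < S \<and> (cmod s)\<^sup>2 + 1 < 2 * S * \<bar>Im s\<bar>) at_top"
  proof (rule eventually_mono[OF eventually_gt_at_top[of "1 + ((cmod s)\<^sup>2 + 1) / (2 * \<bar>Im s\<bar>)"]])
    fix S assume S: "1 + ((cmod s)\<^sup>2 + 1) / (2 * \<bar>Im s\<bar>) < S"
    have "0 \<le> ((cmod s)\<^sup>2 + 1) / (2 * \<bar>Im s\<bar>)" by simp
    then have "1 < S" "((cmod s)\<^sup>2 + 1) / (2 * \<bar>Im s\<bar>) < S" using S by linarith+
    then show "1 < S \<and> (cmod s)\<^sup>2 + 1 < 2 * S * \<bar>Im s\<bar>" using s by (simp add: field_simps)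
  qed
  have sq: "(\<rho> S)\<^sup>2 = S\<^sup>2 - 1" "0 \<le> \<rho> S" "0 < \<rho> S" if "1 < S" for S
    using that by (auto simp: \<rho>_def power2_eq_square mult_ge1_I) (smt (verit) mult_less_cancel_left1)+
  have side: "(cmod (s - c S) < \<rho> S \<longleftrightarrow> 0 < Im s) \<and> cmod (s - c S) \<noteq> \<rho> S"
    if S: "1 < S \<and> (cmod s)\<^sup>2 + 1 < 2 * S * \<bar>Im s\<bar>" for S
  proof (cases "0 < Im s")
    case True
    then have "(cmod (s - c S))\<^sup>2 < (\<rho> S)\<^sup>2" using S dist[of S] sq(1)[of S] by auto
    then have "cmod (s - c S) < \<rho> S" using sq(2)[of S] S by (meson power2_less_imp_less)
    then show ?thesis using True by simp
  next
    case False
    then have "(\<rho> S)\<^sup>2 < (cmod (s - c S))\<^sup>2"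
    proof -
      have "(cmod s)\<^sup>2 + 1 < - (2 * S * Im s)" using S False by (auto simp: abs_if split: if_splits)
      then show ?thesis using dist[of S] sq(1)[of S] S zero_le_power2[of "cmod s"] by linarith
    qed
    then have "\<rho> S < cmod (s - c S)" by (meson power2_less_imp_less norm_ge_zero)
    then show ?thesis using False by simp
  qed
  show "eventually (\<lambda>S. cmod (s - c S) \<noteq> \<rho> S) at_top"
    using big by eventually_elim (use side in blast)
  have "eventually (\<lambda>S. inner_part f (c S) (\<rho> S) s = (if 0 < Im s then f s else 0)) at_top"
    using big by eventually_elim (use side in \<open>auto simp: inner_part_def\<close>)
  then show "((\<lambda>S. inner_part f (c S) (\<rho> S) s) \<longlongrightarrow> (if 0 < Im s then f s else 0)) at_top"
    by (rule tendsto_eventually)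
  define p where "p S = c S + of_real ((\<rho> S)\<^sup>2) / cnj (s - c S)" for S
  have pdist: "cmod (p S - c S) = (\<rho> S)\<^sup>2 / cmod (s - c S)" for S
    by (simp add: p_def norm_divide norm_power del: complex_cnj_diff)
  have pside: "cmod (p S - c S) < \<rho> S \<longleftrightarrow> \<not> 0 < Im s"
    if S: "1 < S \<and> (cmod s)\<^sup>2 + 1 < 2 * S * \<bar>Im s\<bar>" "s \<noteq> c S" for S
  proof -
    have "0 < \<rho> S" "0 < cmod (s - c S)" using S sq(3) by auto
    then have "cmod (p S - c S) < \<rho> S \<longleftrightarrow> \<rho> S < cmod (s - c S)"
      unfolding pdist by (simp add: divide_less_eq power2_eq_square)
    then show ?thesis using side[OF S(1)] by auto
  qed
  show "((\<lambda>S. outer_part f (c S) (\<rho> S) s) \<longlongrightarrow> (if 0 < Im s then 0 else f (cnj s))) at_top"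
  proof (cases "0 < Im s")
    case True
    have "eventually (\<lambda>S. outer_part f (c S) (\<rho> S) s = 0) at_top"
      using big by eventually_elim (use pside True in \<open>auto simp: outer_part_def inner_part_def p_def\<close>)
    then show ?thesis using True by (simp add: tendsto_eventually)
  next
    case False
    then have neg: "Im s < 0" using s by simp
    have ne: "eventually (\<lambda>S. s \<noteq> c S) at_top"
      by (rule eventually_mono[OF eventually_gt_at_top[of 0]]) (use neg in \<open>auto simp: c_def\<close>)
    have "eventually (\<lambda>S. f (p S) = outer_part f (c S) (\<rho> S) s) at_top"
      using big ne by eventually_elim (use pside False in \<open>auto simp: outer_part_def inner_part_def p_def\<close>)
    moreover have "((\<lambda>S. f (p S)) \<longlongrightarrow> f (cnj s)) at_top"
    proof -
      have up: "cnj s \<in> upper_half" using neg by (simp add: upper_half_def)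
      have "eventually (\<lambda>S. (\<i> * cnj s - 1 / of_real S) / (cnj s / of_real S + \<i>) = p S) at_top"
        using big ne
      proof eventually_elim
        fix S assume S: "1 < S \<and> (cmod s)\<^sup>2 + 1 < 2 * S * \<bar>Im s\<bar>" "s \<noteq> c S"
        have d: "cnj (s - c S) = cnj s + \<i> * of_real S" by (simp add: c_def)
        have d0: "cnj s + \<i> * of_real S \<noteq> 0" using S(2) unfolding d[symmetric] by simp
        have "p S = (c S * (cnj s + \<i> * of_real S) + of_real ((\<rho> S)\<^sup>2)) / (cnj s + \<i> * of_real S)"
          unfolding p_def d using d0 by (simp add: field_simps)
        also have "c S * (cnj s + \<i> * of_real S) + of_real ((\<rho> S)\<^sup>2) = \<i> * of_real S * cnj s - 1"
        proof -
          have "complex_of_real ((\<rho> S)\<^sup>2) = of_real S * of_real S - 1"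
            using S by (simp only: sq(1)) (simp add: power2_eq_square)
          then show ?thesis by (simp only:) (simp add: c_def algebra_simps)
        qed
        also have "(\<i> * of_real S * cnj s - 1) / (cnj s + \<i> * of_real S)
            = ((\<i> * of_real S * cnj s - 1) / of_real S) / ((cnj s + \<i> * of_real S) / of_real S)" using S by simp
        also have "\<dots> = (\<i> * cnj s - 1 / of_real S) / (cnj s / of_real S + \<i>)"
          using S by (simp add: diff_divide_distrib add_divide_distrib)
        finally show "(\<i> * cnj s - 1 / of_real S) / (cnj s / of_real S + \<i>) = p S" by simp
      qed
      moreover have "((\<lambda>S. (\<i> * cnj s - 1 / complex_of_real S) / (cnj s / of_real S + \<i>)) \<longlongrightarrow> (\<i> * cnj s - 0) / (0 + \<i>)) at_top"
      proof -
        have "((\<lambda>S. complex_of_real (1 / S)) \<longlongrightarrow> of_real 0) at_top"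
          by (intro tendsto_of_real) real_asymp
        then have 0: "((\<lambda>S. 1 / complex_of_real S) \<longlongrightarrow> 0) at_top" by simp
        have "((\<lambda>S. cnj s * (1 / complex_of_real S)) \<longlongrightarrow> cnj s * 0) at_top"
          by (intro tendsto_mult tendsto_const 0)
        then have "((\<lambda>S. cnj s / complex_of_real S) \<longlongrightarrow> 0) at_top" by simp
        with 0 show ?thesis by (intro tendsto_divide tendsto_diff tendsto_add tendsto_const) auto
      qed
      ultimately have p: "(p \<longlongrightarrow> cnj s) at_top" by (simp add: tendsto_cong)
      have "eventually (\<lambda>S. p S \<in> upper_half) at_top"
        by (rule topological_tendstoD[OF p _ up]) (simp add: upper_half_def open_halfspace_Im_gt)
      then show ?thesis
        by (rule continuous_on_tendsto_compose[OF holomorphic_on_imp_continuous_on[OF f] p up])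
    qed
    ultimately show ?thesis using False by (simp add: tendsto_cong)
  qed
qed

text \<open>The continuation of \<open>w\<close> to the lower half-plane by reflection, entry by entry.\<close>

definition reflected_entry :: "(complex \<Rightarrow> complex mat) \<Rightarrow> complex \<Rightarrow> nat \<Rightarrow> nat \<Rightarrow> complex" where
  "reflected_entry w s a b = (if 0 < Im s then w s $$ (a, b) else cnj (w (cnj s) $$ (b, a)))"

text \<open>The limit of \<open>kernel_circle_nonneg\<close> for discs that exhaust the half-plane: \<open>S\<close> times the kernel of the disc tends to a constant multiple of the kernel of the half-plane. The points may lie in either half-plane, which is needed for the node \<open>cnj x\<close>.\<close>

lemma nevanlinna_kernel_nonneg:
  fixes n :: nat and a :: "nat \<Rightarrow> nat" and s V :: "nat \<Rightarrow> complex"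
  assumes w: "w \<in> nevanlinna_class m"
    and a: "\<And>i. i < n \<Longrightarrow> a i < m" and s: "\<And>i. i < n \<Longrightarrow> Im (s i) \<noteq> 0"
    and ne: "\<And>i k. i < n \<Longrightarrow> k < n \<Longrightarrow> s i \<noteq> cnj (s k)"
  shows "0 \<le> Re (\<Sum>i<n. \<Sum>k<n. cnj (V i) * V k
     * ((reflected_entry w (s i) (a i) (a k) - cnj (reflected_entry w (s k) (a k) (a i))) / (s i - cnj (s k))))"
proof -
  define \<rho> where "\<rho> S = sqrt (S\<^sup>2 - 1)" for S :: real
  define c where "c S = \<i> * complex_of_real S" for S
  have hol: "(\<lambda>\<tau>. w \<tau> $$ (i, k)) holomorphic_on upper_half" if "i < m" "k < m" for i k
    using w that by (simp add: nevanlinna_class_def)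
  define N where "N S i k = inner_part (\<lambda>\<tau>. w \<tau> $$ (a i, a k)) (c S) (\<rho> S) (s i) - outer_part (\<lambda>\<tau>. w \<tau> $$ (a i, a k)) (c S) (\<rho> S) (s k)
       - cnj (inner_part (\<lambda>\<tau>. w \<tau> $$ (a k, a i)) (c S) (\<rho> S) (s k) - outer_part (\<lambda>\<tau>. w \<tau> $$ (a k, a i)) (c S) (\<rho> S) (s i))" for S i k
  define D where "D S i k = of_real ((\<rho> S)\<^sup>2) - cnj (s k - c S) * (s i - c S)" for S i k
  have Deq: "D S i k = (- 1 / of_real S - cnj (s k) * s i / of_real S - \<i> * (s i - cnj (s k))) * of_real S" if "1 < S" for S i k
  proof -
    have "complex_of_real ((\<rho> S)\<^sup>2) = of_real S * of_real S - 1"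
    proof -
      have "1 \<le> S\<^sup>2" using that by (simp add: one_le_power)
      then have "(\<rho> S)\<^sup>2 = S * S - 1" by (simp add: \<rho>_def power2_eq_square)
      then show ?thesis by simp
    qed
    then have "D S i k = - 1 - cnj (s k) * s i - \<i> * (s i - cnj (s k)) * of_real S"
      unfolding D_def by (simp only:) (simp add: c_def algebra_simps)
    then show ?thesis using that by (simp add: left_diff_distrib)
  qed
  have inv0: "((\<lambda>S. 1 / complex_of_real S) \<longlongrightarrow> 0) at_top"
  proof -
    have "((\<lambda>S. complex_of_real (1 / S)) \<longlongrightarrow> of_real 0) at_top"
      by (intro tendsto_of_real) real_asymp
    then show ?thesis by simp
  qed
  have Dlim: "((\<lambda>S. D S i k / of_real S) \<longlongrightarrow> - \<i> * (s i - cnj (s k))) at_top" for i k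
  proof -
    have "((\<lambda>S. - (1 / of_real S) - cnj (s k) * s i * (1 / of_real S) - \<i> * (s i - cnj (s k))) \<longlongrightarrow> - 0 - cnj (s k) * s i * 0 - \<i> * (s i - cnj (s k))) at_top"
      by (intro tendsto_diff tendsto_minus tendsto_mult tendsto_const inv0)
    moreover have "eventually (\<lambda>S. - (1 / of_real S) - cnj (s k) * s i * (1 / of_real S) - \<i> * (s i - cnj (s k)) = D S i k / of_real S) at_top"
      by (rule eventually_mono[OF eventually_gt_at_top[of 1]]) (simp add: Deq)
    ultimately show ?thesis by (simp add: tendsto_cong)
  qed
  have Nlim: "((\<lambda>S. N S i k) \<longlongrightarrow> reflected_entry w (s i) (a i) (a k) - cnj (reflected_entry w (s k) (a k) (a i))) at_top"
    if ik: "i < n" "k < n" for i k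
  proof -
    note L = inner_outer_limits[OF hol[OF a[OF ik(1)] a[OF ik(2)]], folded \<rho>_def c_def]
      and L' = inner_outer_limits[OF hol[OF a[OF ik(2)] a[OF ik(1)]], folded \<rho>_def c_def]
    have "((\<lambda>S. N S i k) \<longlongrightarrow> (if 0 < Im (s i) then w (s i) $$ (a i, a k) else 0) - (if 0 < Im (s k) then 0 else w (cnj (s k)) $$ (a i, a k))
      - cnj ((if 0 < Im (s k) then w (s k) $$ (a k, a i) else 0) - (if 0 < Im (s i) then 0 else w (cnj (s i)) $$ (a k, a i)))) at_top"
      unfolding N_def by (intro tendsto_diff tendsto_cnj L L' s ik)
    then show ?thesis by (simp add: reflected_entry_def algebra_simps split: if_splits)
  qed
  have lim: "((\<lambda>S. \<Sum>i<n. \<Sum>k<n. cnj (V i) * V k / \<i> * (N S i k / (D S i k / of_real S))) \<longlongrightarrow>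
     (\<Sum>i<n. \<Sum>k<n. cnj (V i) * V k / \<i> * ((reflected_entry w (s i) (a i) (a k) - cnj (reflected_entry w (s k) (a k) (a i))) / (- \<i> * (s i - cnj (s k)))))) at_top"
    using ne by (intro tendsto_sum tendsto_mult tendsto_const tendsto_divide Nlim Dlim) auto
  have "0 \<le> Re (\<Sum>i<n. \<Sum>k<n. cnj (V i) * V k / \<i> * ((reflected_entry w (s i) (a i) (a k) - cnj (reflected_entry w (s k) (a k) (a i))) / (- \<i> * (s i - cnj (s k)))))"
  proof (rule tendsto_lowerbound[OF tendsto_Re[OF lim]])
    have far: "eventually (\<lambda>S. \<forall>i\<in>{..<n}. cmod (s i - c S) \<noteq> \<rho> S) at_top"
    proof (rule eventually_ball_finite)
      show "\<forall>i\<in>{..<n}. eventually (\<lambda>S. cmod (s i - c S) \<noteq> \<rho> S) at_top"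
        using inner_outer_limits(3)[OF holomorphic_on_const s] unfolding \<rho>_def c_def by blast
    qed simp
    have den: "eventually (\<lambda>S. \<forall>i\<in>{..<n}. \<forall>k\<in>{..<n}. D S i k / of_real S \<noteq> 0) at_top"
    proof (intro eventually_ball_finite ballI finite_lessThan)
      fix i k assume "i \<in> {..<n}" "k \<in> {..<n}"
      then have "- \<i> * (s i - cnj (s k)) \<noteq> 0" using ne by simp
      then show "eventually (\<lambda>S. D S i k / of_real S \<noteq> 0) at_top" by (rule tendsto_imp_eventually_ne[OF Dlim])
    qed
    show "eventually (\<lambda>S. 0 \<le> Re (\<Sum>i<n. \<Sum>k<n. cnj (V i) * V k / \<i> * (N S i k / (D S i k / of_real S)))) at_top"
      using far den eventually_gt_at_top[of 1]
    proof eventually_elim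
      fix S :: real
      assume far: "\<forall>i\<in>{..<n}. cmod (s i - c S) \<noteq> \<rho> S" and den: "\<forall>i\<in>{..<n}. \<forall>k\<in>{..<n}. D S i k / of_real S \<noteq> 0" and S: "1 < S"
      have r: "0 < \<rho> S" "\<rho> S < S" using S by (auto simp: \<rho>_def power2_eq_square intro!: real_less_lsqrt mult_strict_mono less_1_mult)
      have sub: "cball (c S) (\<rho> S) \<subseteq> upper_half"
      proof
        fix x assume "x \<in> cball (c S) (\<rho> S)"
        then have "cmod (c S - x) < S" using r by (simp add: dist_norm)
        then have "\<bar>Im (c S - x)\<bar> < S" using abs_Im_le_cmod[of "c S - x"] by linarith
        then show "x \<in> upper_half" by (simp add: c_def upper_half_def)
      qed
      have "0 \<le> Re (\<Sum>i<n. \<Sum>k<n. cnj (V i) * V k / (2 * \<i>) * (N S i k / D S i k))"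
        unfolding N_def D_def by (rule kernel_circle_nonneg[OF w r(1) sub a]) (use far den in \<open>auto simp: D_def\<close>)
      then have "0 \<le> 2 * S * Re (\<Sum>i<n. \<Sum>k<n. cnj (V i) * V k / (2 * \<i>) * (N S i k / D S i k))" using S by simp
      also have "\<dots> = Re (of_real (2 * S) * (\<Sum>i<n. \<Sum>k<n. cnj (V i) * V k / (2 * \<i>) * (N S i k / D S i k)))" by simp
      also have "of_real (2 * S) * (\<Sum>i<n. \<Sum>k<n. cnj (V i) * V k / (2 * \<i>) * (N S i k / D S i k))
         = (\<Sum>i<n. \<Sum>k<n. cnj (V i) * V k / \<i> * (N S i k / (D S i k / of_real S)))"
        unfolding sum_distrib_left by (intro sum.cong refl) simp
      finally show "0 \<le> Re (\<Sum>i<n. \<Sum>k<n. cnj (V i) * V k / \<i> * (N S i k / (D S i k / of_real S)))" .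
    qed
  qed simp
  also have "(\<Sum>i<n. \<Sum>k<n. cnj (V i) * V k / \<i> * ((reflected_entry w (s i) (a i) (a k) - cnj (reflected_entry w (s k) (a k) (a i))) / (- \<i> * (s i - cnj (s k)))))
     = (\<Sum>i<n. \<Sum>k<n. cnj (V i) * V k * ((reflected_entry w (s i) (a i) (a k) - cnj (reflected_entry w (s k) (a k) (a i))) / (s i - cnj (s k))))"
    by (intro sum.cong refl) simp
  finally show ?thesis .
qed

theorem (in nodes) pick_mat_psd:
  assumes w: "w \<in> nevanlinna_class m" and Im: "\<And>j. 1 \<le> j \<Longrightarrow> Im (z j) \<noteq> 0"
    and val: "\<And>j. 1 \<le> j \<Longrightarrow> j \<le> n \<Longrightarrow> W j = (if 0 < Im (z j) then w (z j) else mat_adjoint (w (cnj (z j))))"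
  shows "psd_mat (n * m) (pick_mat m z W n)"
  unfolding psd_mat_def
proof (intro conjI ballI)
  show "hermitian_mat (n * m) (pick_mat m z W n)" by (rule Pm_hermitian)
  fix v :: "complex vec" assume v: "v \<in> carrier_vec (n * m)"
  define j where "j i = Suc (i div m)" for i
  define V where "V i = cnj (z (j i)) * (v $ i)" for i
  have wc: "w s \<in> carrier_mat m m" if "0 < Im s" for s
    using w that by (simp add: nevanlinna_class_def upper_half_def)
  have jb: "1 \<le> j i" "j i \<le> n" "i mod m < m" if "i < n * m" for i
    using block_index[OF that] by (auto simp: j_def)
  have ent: "reflected_entry w (z (j i)) (i mod m) b = W (j i) $$ (i mod m, b)" if "i < n * m" "b < m" for i b
  proof (cases "0 < Im (z (j i))")
    case False
    then have "0 < Im (cnj (z (j i)))" using Im[OF jb(1)[OF that(1)]] by simp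
    from carrier_matD[OF wc[OF this]] show ?thesis
      using False val[OF jb(1,2)[OF that(1)]] that jb(3)[OF that(1)] by (simp add: reflected_entry_def)
  qed (use val[OF jb(1,2)[OF that(1)]] in \<open>simp add: reflected_entry_def\<close>)
  have "0 \<le> Re (\<Sum>i<n * m. \<Sum>k<n * m. cnj (V i) * V k
     * ((reflected_entry w (z (j i)) (i mod m) (k mod m) - cnj (reflected_entry w (z (j k)) (k mod m) (i mod m))) / (z (j i) - cnj (z (j k)))))"
    by (rule nevanlinna_kernel_nonneg[OF w]) (use jb Im z_cnj in auto)
  also have "(\<Sum>i<n * m. \<Sum>k<n * m. cnj (V i) * V k
     * ((reflected_entry w (z (j i)) (i mod m) (k mod m) - cnj (reflected_entry w (z (j k)) (k mod m) (i mod m))) / (z (j i) - cnj (z (j k)))))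
     = (\<Sum>i<n * m. \<Sum>k<n * m. cnj (v $ i) * pick_mat m z W n $$ (i, k) * (v $ k))"
  proof (intro sum.cong refl)
    fix i k assume "i \<in> {..<n * m}" "k \<in> {..<n * m}"
    then have ik: "i < n * m" "k < n * m" by auto
    have "pick_mat m z W n $$ (i, k) = z (j i) * cnj (z (j k)) / (z (j i) - cnj (z (j k))) * (W (j i) $$ (i mod m, k mod m) - cnj (W (j k) $$ (k mod m, i mod m)))"
      using ik jb carrier_matD[OF W_carrier[OF jb(1)[OF ik(1)]]] carrier_matD[OF W_carrier[OF jb(1)[OF ik(2)]]]
      by (simp add: pick_mat_eq block_mat_index pick_block_def block_index flip: j_def)
    then show "cnj (V i) * V k
     * ((reflected_entry w (z (j i)) (i mod m) (k mod m) - cnj (reflected_entry w (z (j k)) (k mod m) (i mod m))) / (z (j i) - cnj (z (j k))))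
     = cnj (v $ i) * pick_mat m z W n $$ (i, k) * (v $ k)"
      using ik jb by (simp add: ent V_def)
  qed
  also have "\<dots> = (pick_mat m z W n *\<^sub>v v) \<bullet>c v"
    using cscalar_form[OF Pm_carrier v v] by simp
  finally show "0 \<le> Re ((pick_mat m z W n *\<^sub>v v) \<bullet>c v)" .
qed

section \<open>Rational Nevanlinna functions and the truncated problem\<close>

lemma hermitian_form_real:
  assumes "hermitian_mat n A" "v \<in> carrier_vec n"
  shows "Im ((A *\<^sub>v v) \<bullet>c v) = 0"
proof -
  note A = hermitian_carrier[OF assms(1)]
  have "cnj ((A *\<^sub>v v) \<bullet>c v) = (\<Sum>i<n. \<Sum>k<n. v $ i * cnj (A $$ (i, k)) * cnj (v $ k))"
    unfolding cscalar_form[OF A assms(2,2)] by simp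
  also have "\<dots> = (\<Sum>i<n. \<Sum>k<n. cnj (v $ k) * A $$ (k, i) * v $ i)"
  proof (intro sum.cong refl)
    fix i k assume "i \<in> {..<n}" "k \<in> {..<n}"
    then have "cnj (A $$ (i, k)) = A $$ (k, i)" using hermitian_entry[OF assms(1), of k i] by simp
    then show "v $ i * cnj (A $$ (i, k)) * cnj (v $ k) = cnj (v $ k) * A $$ (k, i) * v $ i"
      by (simp only: ac_simps)
  qed
  also have "\<dots> = (\<Sum>k<n. \<Sum>i<n. cnj (v $ k) * A $$ (k, i) * v $ i)" by (rule sum.swap)
  also have "\<dots> = (A *\<^sub>v v) \<bullet>c v" unfolding cscalar_form[OF A assms(2,2)] ..
  finally show ?thesis by (simp add: complex_eq_iff)
qed

lemma det_holomorphic: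
  assumes "\<And>z. A z \<in> carrier_mat n n" "\<And>i j. i < n \<Longrightarrow> j < n \<Longrightarrow> (\<lambda>z. A z $$ (i, j)) holomorphic_on S"
  shows "(\<lambda>z. det (A z)) holomorphic_on S"
  unfolding det_def'[OF assms(1)]
  by (intro holomorphic_on_sum holomorphic_on_mult holomorphic_on_prod holomorphic_on_const assms(2))
     (auto simp: permutes_in_image)

lemma cofactor_holomorphic:
  assumes A: "\<And>z. A z \<in> carrier_mat n n" and hol: "\<And>i j. i < n \<Longrightarrow> j < n \<Longrightarrow> (\<lambda>z. A z $$ (i, j)) holomorphic_on S"
    and ij: "i < n" "j < n"
  shows "(\<lambda>z. cofactor (A z) i j) holomorphic_on S"
  unfolding cofactor_def
proof (intro holomorphic_on_mult holomorphic_on_const det_holomorphic[where n = "n - 1"])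
  show "(\<lambda>z. mat_delete (A z) i j $$ (i', j')) holomorphic_on S" if "i' < n - 1" "j' < n - 1" for i' j'
    using that carrier_matD[OF A] unfolding mat_delete_def by (auto intro!: hol)
qed (use A mat_delete_carrier in blast)

text \<open>For \<open>R = (H - z Y)\<^sup>-\<^sup>1\<close> the resolvent identity gives \<open>R - R\<^sup>* = (z - cnj z) R\<^sup>* Y R\<close>, so that the imaginary part is a congruence of \<open>Y\<close>.\<close>

lemma resolvent_nevanlinna:
  assumes H: "hermitian_mat n H" and Y: "pd_mat n Y" and u: "u \<in> carrier_mat n m"
  shows "(\<lambda>z. mat_adjoint u * (minv (H - z \<cdot>\<^sub>m Y) * u)) \<in> nevanlinna_class m"
    and "\<And>z. 0 < Im z \<Longrightarrow> det (H - z \<cdot>\<^sub>m Y) \<noteq> 0"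
proof -
  note Hc = hermitian_carrier[OF H] and Yc = pd_carrier[OF Y]
  have Mc: "H - z \<cdot>\<^sub>m Y \<in> carrier_mat n n" for z using Yc by (intro minus_carrier_mat) simp
  show det: "det (H - z \<cdot>\<^sub>m Y) \<noteq> 0" if z: "0 < Im z" for z
  proof (rule det_nonzeroI[OF Mc])
    fix v :: "complex vec" assume v: "v \<in> carrier_vec n" "v \<noteq> 0\<^sub>v n"
    have mv: "(H - z \<cdot>\<^sub>m Y) = H + (- z) \<cdot>\<^sub>m Y" using Hc Yc by (intro eq_matI) auto
    have "((H - z \<cdot>\<^sub>m Y) *\<^sub>v v) \<bullet>c v = (H *\<^sub>v v) \<bullet>c v + (- z) * ((Y *\<^sub>v v) \<bullet>c v)"
      unfolding mv using Hc Yc v by (subst form_add[of _ n]) (simp_all add: form_smult[OF Yc v(1)])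
    then have "Im (((H - z \<cdot>\<^sub>m Y) *\<^sub>v v) \<bullet>c v) = - (Im z * Re ((Y *\<^sub>v v) \<bullet>c v))"
      using hermitian_form_real[OF H v(1)] hermitian_form_real[OF pd_hermitian[OF Y] v(1)] by simp
    moreover have "0 < Re ((Y *\<^sub>v v) \<bullet>c v)" using Y v by (auto simp: pd_mat_def)
    ultimately have "((H - z \<cdot>\<^sub>m Y) *\<^sub>v v) \<bullet>c v \<noteq> 0" using z by auto
    then show "(H - z \<cdot>\<^sub>m Y) *\<^sub>v v \<noteq> 0\<^sub>v n" using v by auto
  qed
  show "(\<lambda>z. mat_adjoint u * (minv (H - z \<cdot>\<^sub>m Y) * u)) \<in> nevanlinna_class m"
    unfolding nevanlinna_class_def mem_Collect_eq
  proof (intro conjI ballI allI impI)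
    fix z assume z: "z \<in> upper_half"
    then have z': "0 < Im z" by (simp add: upper_half_def)
    define R where "R = minv (H - z \<cdot>\<^sub>m Y)"
    note Rw = minv_works[OF Mc det[OF z'], folded R_def]
    show wc: "mat_adjoint u * (minv (H - z \<cdot>\<^sub>m Y) * u) \<in> carrier_mat m m"
      unfolding R_def[symmetric] using Rw(1) u by (intro carrier_matI) auto
    have adjM: "mat_adjoint (H - z \<cdot>\<^sub>m Y) = H - cnj z \<cdot>\<^sub>m Y"
      using Hc Yc by (simp add: mat_adjoint_minus mat_adjoint_smult hermitian_adjoint[OF H] pd_adjoint[OF Y])
    have Ra: "mat_adjoint R \<in> carrier_mat n n" using Rw(1) by simp
    have RaM: "mat_adjoint R * (H - cnj z \<cdot>\<^sub>m Y) = 1\<^sub>m n"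
    proof -
      have "mat_adjoint ((H - z \<cdot>\<^sub>m Y) * R) = mat_adjoint R * mat_adjoint (H - z \<cdot>\<^sub>m Y)"
        using carrier_matD[OF Mc] carrier_matD[OF Rw(1)] by (intro mat_adjoint_mult) simp
      then show ?thesis unfolding Rw(2) adjM by simp
    qed
    have "R - mat_adjoint R = (z - cnj z) \<cdot>\<^sub>m (mat_adjoint R * (Y * R))"
    proof -
      have "(z - cnj z) \<cdot>\<^sub>m (mat_adjoint R * (Y * R)) = mat_adjoint R * (((z - cnj z) \<cdot>\<^sub>m Y) * R)"
        using Rw(1) Yc by (simp add: mat_expand)
      also have "(z - cnj z) \<cdot>\<^sub>m Y = (H - cnj z \<cdot>\<^sub>m Y) - (H - z \<cdot>\<^sub>m Y)"
        using Hc Yc by (intro eq_matI) (auto simp: algebra_simps)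
      also have "mat_adjoint R * (((H - cnj z \<cdot>\<^sub>m Y) - (H - z \<cdot>\<^sub>m Y)) * R)
          = (mat_adjoint R * (H - cnj z \<cdot>\<^sub>m Y)) * R - mat_adjoint R * ((H - z \<cdot>\<^sub>m Y) * R)"
        using Rw(1) Mc[of z] Mc[of "cnj z"] Ra
        by (simp only: mat_minus_mult mat_mult_minus mat_mult_assoc carrier_matD dim_mat_adjoint index_mult_mat(2,3))
      also have "\<dots> = R - mat_adjoint R" unfolding RaM Rw(2) using Rw(1) Ra by simp
      finally show ?thesis ..
    qed
    note diff = this
    have "(1 / (2 * \<i>)) \<cdot>\<^sub>m (mat_adjoint u * (R * u) - mat_adjoint (mat_adjoint u * (R * u)))
        = (1 / (2 * \<i>)) \<cdot>\<^sub>m (mat_adjoint u * ((R - mat_adjoint R) * u))"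
      using Rw(1) u by (simp add: mat_expand)
    also have "\<dots> = complex_of_real (Im z) \<cdot>\<^sub>m (mat_adjoint (R * u) * Y * (R * u))"
    proof -
      define k where "k = 1 / (2 * \<i>)"
      have zz: "k * (z - cnj z) = complex_of_real (Im z)" by (simp add: k_def complex_diff_cnj complex_eq_iff)
      show ?thesis unfolding diff k_def[symmetric] using Rw(1) u Yc by (simp add: mat_expand zz)
    qed
    finally show "psd_mat m ((1 / (2 * \<i>)) \<cdot>\<^sub>m (mat_adjoint u * (minv (H - z \<cdot>\<^sub>m Y) * u) - mat_adjoint (mat_adjoint u * (minv (H - z \<cdot>\<^sub>m Y) * u))))"
      unfolding R_def[symmetric] using psd_smult[OF psd_congruence[OF pd_imp_psd[OF Y] mult_carrier_mat[OF Rw(1) u]], of "Im z"] z'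
      by simp
  next
    fix a b assume ab: "a < m" "b < m"
    have ent: "(mat_adjoint u * (minv (H - z \<cdot>\<^sub>m Y) * u)) $$ (a, b)
       = (\<Sum>i<n. cnj (u $$ (i, a)) * (\<Sum>k<n. cofactor (H - z \<cdot>\<^sub>m Y) k i / det (H - z \<cdot>\<^sub>m Y) * u $$ (k, b)))"
      if z: "z \<in> upper_half" for z
    proof -
      have z': "0 < Im z" using z by (simp add: upper_half_def)
      note Rw = minv_works[OF Mc det[OF z']]
      have "(mat_adjoint u * (minv (H - z \<cdot>\<^sub>m Y) * u)) $$ (a, b)
         = (\<Sum>i<n. mat_adjoint u $$ (a, i) * (minv (H - z \<cdot>\<^sub>m Y) * u) $$ (i, b))"
        using u ab Rw(1) by (intro mat_mult_entry[of _ m n _ m]) (auto intro: mult_carrier_mat)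
      also have "\<dots> = (\<Sum>i<n. cnj (u $$ (i, a)) * (\<Sum>k<n. cofactor (H - z \<cdot>\<^sub>m Y) k i / det (H - z \<cdot>\<^sub>m Y) * u $$ (k, b)))"
        using u ab by (intro sum.cong refl) (simp add: mat_mult_entry[OF Rw(1) u] minv_entry[OF Mc det[OF z']] del: index_mult_mat(1))
      finally show ?thesis .
    qed
    have entM: "(\<lambda>z. (H - z \<cdot>\<^sub>m Y) $$ (i, j)) holomorphic_on upper_half" if "i < n" "j < n" for i j
      using that Hc Yc by (auto intro!: holomorphic_intros)
    have "(\<lambda>z. \<Sum>i<n. cnj (u $$ (i, a)) * (\<Sum>k<n. cofactor (H - z \<cdot>\<^sub>m Y) k i / det (H - z \<cdot>\<^sub>m Y) * u $$ (k, b))) holomorphic_on upper_half"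
      by (intro holomorphic_on_sum holomorphic_on_mult holomorphic_on_const holomorphic_on_divide
          det_holomorphic[OF Mc entM] cofactor_holomorphic[OF Mc entM]) (auto simp: upper_half_def det)
    then show "(\<lambda>z. (mat_adjoint u * (minv (H - z \<cdot>\<^sub>m Y) * u)) $$ (a, b)) holomorphic_on upper_half"
      by (rule holomorphic_transform) (simp only: ent)
  qed
qed

text \<open>The interpolating function is \<open>w(x) = u\<^sup>* (H - x Y)\<^sup>-\<^sup>1 u\<close> with \<open>Y = T P T\<^sup>*\<close> and \<open>H = T P + u v\<^sup>*\<close>. The displacement equation of \<open>P\<close> makes \<open>H\<close> Hermitian, and the \<open>j\<close>-th block row of \<open>H - z\<^sub>j Y\<close> is \<open>u\<^sup>*\<close>, so that the inverse cancels.\<close>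

theorem (in nodes) pick_solution_exists:
  assumes pd: "pd_mat (n * m) (Pm n)" and up: "\<And>j. 1 \<le> j \<Longrightarrow> j \<le> n \<Longrightarrow> 0 < Im (z j)"
  shows "\<exists>w \<in> nevanlinna_class m. \<forall>j. 1 \<le> j \<and> j \<le> n \<longrightarrow> w (z j) = W j"
proof -
  define j where "j i = Suc (i div m)" for i
  have jb: "1 \<le> j i" "j i \<le> n" "i mod m < m" if "i < n * m" for i
    using block_index[OF that] by (auto simp: j_def)
  have j1 [simp]: "1 \<le> j i" "Suc 0 \<le> j i" for i by (simp_all add: j_def)
  have z0: "z (j i) \<noteq> 0" for i using z_nonzero by simp
  define N where "N = n * m"
  have PN: "Pm n $$ (i, k) = pick_block (j i) (j k) $$ (i mod m, k mod m)" if "i < N" "k < N" for i k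
    using that by (simp add: pick_mat_eq block_mat_index j_def N_def)
  define H where "H = mat N N (\<lambda>(i, k). Pm n $$ (i, k) / z (j i) + W (j i) $$ (i mod m, k mod m))"
  have H: "H \<in> carrier_mat N N" by (simp add: H_def)
  have swap: "Pm n $$ (i, k) / z (j i) + W (j i) $$ (i mod m, k mod m)
     = Pm n $$ (i, k) / cnj (z (j k)) + cnj (W (j k) $$ (k mod m, i mod m))" if ik: "i < N" "k < N" for i k
  proof -
    have b: "i mod m < m" "k mod m < m" using ik jb(3) by (auto simp: N_def)
    have d: "z (j i) - cnj (z (j k)) \<noteq> 0" using z_cnj[OF j1(1) j1(1)] by simp
    have "Pm n $$ (i, k) = z (j i) * cnj (z (j k)) / (z (j i) - cnj (z (j k))) * (W (j i) $$ (i mod m, k mod m) - cnj (W (j k) $$ (k mod m, i mod m)))"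
      unfolding PN[OF ik] using b carrier_matD[OF W_carrier[OF j1(1)]] by (simp add: pick_block_def)
    moreover have "x * y / (x - y) * (p - q) / x + p = x * y / (x - y) * (p - q) / y + q" if "x \<noteq> 0" "y \<noteq> 0" "x - y \<noteq> 0" for x y p q :: complex
      using that by (simp add: divide_simps) (simp add: algebra_simps)
    ultimately show ?thesis using d z0 by simp
  qed
  have Hh: "hermitian_mat N H"
    unfolding hermitian_mat_def
  proof (intro conjI eq_matI)
    fix i k assume "i < dim_row H" "k < dim_col H"
    then have ik: "i < N" "k < N" using H by auto
    have "mat_adjoint H $$ (i, k) = cnj (H $$ (k, i))" using ik H by simp
    also have "\<dots> = cnj (Pm n $$ (k, i)) / cnj (z (j k)) + cnj (W (j k) $$ (k mod m, i mod m))"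
      using ik by (simp add: H_def)
    also have "cnj (Pm n $$ (k, i)) = Pm n $$ (i, k)"
      using hermitian_entry[OF Pm_hermitian, of i n k] ik by (simp add: N_def)
    also have "Pm n $$ (i, k) / cnj (z (j k)) + cnj (W (j k) $$ (k mod m, i mod m)) = H $$ (i, k)"
      using ik by (simp add: H_def swap)
    finally show "mat_adjoint H $$ (i, k) = H $$ (i, k)" .
  qed (use H in auto)
  define X where "X = block_diag m n (\<lambda>j. 1 / cnj (z j))"
  have X: "X \<in> carrier_mat N N" by (simp add: X_def N_def)
  define Y where "Y = mat_adjoint X * Pm n * X"
  have Xa: "mat_adjoint X = block_diag m n (\<lambda>j. 1 / z j)"
    unfolding X_def by (rule eq_matI) (simp_all add: block_diag_def mat_diag_def)
  have Yent: "Y $$ (i, k) = Pm n $$ (i, k) / z (j i) / cnj (z (j k))" if "i < N" "k < N" for i k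
    unfolding Y_def Xa unfolding X_def
    using that by (simp add: block_diag_mult[OF Pm_carrier] mult_block_diag[of _ "n * m"] N_def j_def)
  have "X * block_diag m n (\<lambda>j. cnj (z j)) = 1\<^sub>m N"
    unfolding X_def N_def by (simp add: block_diag_def) (simp add: mat_diag_def one_mat_def z_nonzero)
  then have dX: "det X \<noteq> 0" using X by (intro det_nonzero_right_inverse(1)[of _ N]) (auto simp: N_def)
  have Y: "pd_mat N Y"
    unfolding Y_def N_def by (rule pd_congruence[OF pd X[unfolded N_def]]) (rule mat_vec_nonzero[OF X[unfolded N_def] dX])
  define u where "u = coln m n W"
  have u: "u \<in> carrier_mat N m" by (simp add: u_def N_def)
  define w where "w x = mat_adjoint u * (minv (H - x \<cdot>\<^sub>m Y) * u)" for x
  note res = resolvent_nevanlinna[OF Hh Y u]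
  have "w \<in> nevanlinna_class m" using res(1) unfolding w_def .
  moreover have "w (z l) = W l" if l: "1 \<le> l" "l \<le> n" for l
  proof -
    define M where "M = H - z l \<cdot>\<^sub>m Y"
    have M: "M \<in> carrier_mat N N" using Y pd_carrier[OF Y] unfolding M_def by (intro minus_carrier_mat) simp
    note Rw = minv_works[OF M, unfolded M_def, OF res(2)[OF up[OF l]], folded M_def]
    have Ru: "minv M * u \<in> carrier_mat N m" using Rw(1) u by simp
    have wl: "w (z l) = mat_adjoint u * (minv M * u)" by (simp add: w_def M_def)
    have idx: "(l - 1) * m + a < N" "j ((l - 1) * m + a) = l" "((l - 1) * m + a) mod m = a" if "a < m" for a
    proof -
      have "(l - 1) * m + a < (l - 1) * m + m" using that by simp
      also have "\<dots> = l * m" using l by (cases l) auto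
      also have "\<dots> \<le> N" using l by (simp add: N_def)
      finally show "(l - 1) * m + a < N" .
      show "j ((l - 1) * m + a) = l" "((l - 1) * m + a) mod m = a" using that l by (auto simp: j_def)
    qed
    show "w (z l) = W l"
    proof (rule eq_matI)
      fix a b assume "a < dim_row (W l)" "b < dim_col (W l)"
      then have ab: "a < m" "b < m" using carrier_matD[OF W_carrier[OF l(1)]] by auto
      define i where "i = (l - 1) * m + a"
      note ii = idx[OF ab(1), folded i_def]
      have row: "cnj (u $$ (k, a)) = M $$ (i, k)" if k: "k < N" for k
      proof -
        have "M $$ (i, k) = H $$ (i, k) - z l * Y $$ (i, k)"
          using M k ii(1) pd_carrier[OF Y] H by (auto simp: M_def)
        also have "\<dots> = H $$ (i, k) - Pm n $$ (i, k) / cnj (z (j k))"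
          unfolding Yent[OF ii(1) k] ii(2) using z_nonzero[OF l(1)] by simp
        also have "\<dots> = cnj (W (j k) $$ (k mod m, i mod m))"
          using ii(1) k swap[OF ii(1) k] by (simp add: H_def)
        also have "\<dots> = cnj (u $$ (k, a))"
          using k ab by (simp add: u_def coln_index N_def j_def ii(3))
        finally show ?thesis ..
      qed
      have "w (z l) $$ (a, b) = (\<Sum>k<N. mat_adjoint u $$ (a, k) * (minv M * u) $$ (k, b))"
        unfolding wl using u ab Ru by (intro mat_mult_entry[of _ m N _ m]) auto
      also have "\<dots> = (\<Sum>k<N. M $$ (i, k) * (minv M * u) $$ (k, b))"
        using u ab row by (intro sum.cong refl) simp
      also have "\<dots> = (M * (minv M * u)) $$ (i, b)" using mat_mult_entry[OF M Ru ii(1) ab(2)] by simp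
      also have "M * (minv M * u) = u"
        using minv_cancel(2)[OF M _ u] res(2)[OF up[OF l]] by (simp add: M_def)
      also have "u $$ (i, b) = W l $$ (a, b)" using ii ab by (simp add: u_def coln_index N_def j_def)
      finally show "w (z l) $$ (a, b) = W l $$ (a, b)" .
    qed (use u Ru carrier_matD[OF W_carrier[OF l(1)]] in \<open>auto simp: wl\<close>)
  qed
  ultimately show ?thesis by blast
qed

section \<open>Compactness of the Nevanlinna class\<close>

lemma psd_limit:
  assumes A: "\<And>k. psd_mat n (A k)" and L: "L \<in> carrier_mat n n" and F: "F \<noteq> bot"
    and lim: "\<And>i j. i < n \<Longrightarrow> j < n \<Longrightarrow> ((\<lambda>k. A k $$ (i, j)) \<longlongrightarrow> L $$ (i, j)) F"
  shows "psd_mat n L"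
  unfolding psd_mat_def hermitian_mat_def
proof (intro conjI ballI L eq_matI)
  fix i j assume "i < dim_row L" "j < dim_col L"
  then have ij: "i < n" "j < n" using L by auto
  have "((\<lambda>k. A k $$ (i, j)) \<longlongrightarrow> cnj (L $$ (j, i))) F"
    unfolding hermitian_entry[OF psd_hermitian[OF A] ij] by (intro tendsto_cnj lim ij)
  then have "L $$ (i, j) = cnj (L $$ (j, i))" using lim[OF ij] F tendsto_unique by blast
  then show "mat_adjoint L $$ (i, j) = L $$ (i, j)" using ij L by simp
next
  fix v :: "complex vec" assume v: "v \<in> carrier_vec n"
  have "((\<lambda>k. (A k *\<^sub>v v) \<bullet>c v) \<longlongrightarrow> (L *\<^sub>v v) \<bullet>c v) F"
    unfolding cscalar_form[OF psd_carrier[OF A] v v] cscalar_form[OF L v v]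
    by (intro tendsto_sum tendsto_mult tendsto_const lim) auto
  then show "0 \<le> Re ((L *\<^sub>v v) \<bullet>c v)"
    by (intro tendsto_lowerbound[OF tendsto_Re _ F]) (use A v in \<open>auto simp: psd_mat_def\<close>)
qed (use L in auto)

text \<open>The two-point Pick matrix for \<open>a\<close> and \<open>x\<close> is positive. Its form at the vector \<open>(- c, A + 1)\<close>, where \<open>c\<close> is the off-diagonal entry and \<open>A\<close> the first diagonal entry, gives \<open>|c|\<^sup>2 \<le> (A + 1) G\<close> with the second diagonal entry \<open>G = Im (f x) / Im x\<close>. This is quadratic in \<open>f x\<close> on the left and linear on the right.\<close>

lemma scalar_two_point_bound:
  assumes hol: "f holomorphic_on upper_half" and pos: "\<And>x. x \<in> upper_half \<Longrightarrow> 0 \<le> Im (f x)"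
    and a: "a \<in> upper_half" and x: "x \<in> upper_half"
  shows "cmod (f x) \<le> 2 * cmod (f a) + (Im (f a) / Im a + 1) * ((cmod (a - cnj x))\<^sup>2 / Im x)"
proof -
  define w where "w y = mat 1 1 (\<lambda>_. f y)" for y
  have w: "w \<in> nevanlinna_class 1"
    unfolding nevanlinna_class_def mem_Collect_eq
  proof (intro conjI ballI allI impI)
    fix y assume y: "y \<in> upper_half"
    define M where "M = (1 / (2 * \<i>)) \<cdot>\<^sub>m (w y - mat_adjoint (w y))"
    have M: "M = mat 1 1 (\<lambda>_. of_real (Im (f y)))"
      unfolding M_def w_def by (intro eq_matI) (auto simp: complex_eq_iff)
    have Mc: "M \<in> carrier_mat 1 1" by (simp add: M)
    have "psd_mat 1 M"
      unfolding psd_mat_def hermitian_mat_def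
    proof (intro conjI ballI Mc)
      show "mat_adjoint M = M" unfolding M by (intro eq_matI) auto
      fix v :: "complex vec" assume v: "v \<in> carrier_vec 1"
      have "(M *\<^sub>v v) \<bullet>c v = of_real (Im (f y)) * of_real ((cmod (v $ 0))\<^sup>2)"
        unfolding cscalar_form[OF Mc v v] by (simp add: M complex_norm_square mult.commute mult.left_commute del: of_real_power)
      then show "0 \<le> Re ((M *\<^sub>v v) \<bullet>c v)" using pos[OF y] by simp
    qed
    then show "psd_mat 1 ((1 / (2 * \<i>)) \<cdot>\<^sub>m (w y - mat_adjoint (w y)))" by (simp add: M_def)
  qed (use hol in \<open>auto simp: w_def\<close>)
  define p q where "p = f a" and "q = f x"
  have ia: "0 < Im a" "0 < Im x" using a x by (auto simp: upper_half_def)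
  define c where "c = (p - cnj q) / (a - cnj x)"
  define s where "s i = (if i = 0 then a else x)" for i :: nat
  define A where "A = Im p / Im a"
  define G where "G = Im q / Im x"
  have A0: "0 \<le> A" "0 \<le> G" using pos a x ia by (auto simp: A_def G_def p_def q_def)
  define V where "V i = (if i = 0 then - c else of_real (A + 1))" for i :: nat
  have ne: "a - cnj x \<noteq> 0" "x - cnj a \<noteq> 0" using ia by (auto simp: complex_eq_iff)
  have "0 \<le> Re (\<Sum>i<2. \<Sum>k<2. cnj (V i) * V k * ((reflected_entry w (s i) 0 0 - cnj (reflected_entry w (s k) 0 0)) / (s i - cnj (s k))))"
    by (rule nevanlinna_kernel_nonneg[OF w, of 2 "\<lambda>_. 0"]) (use ia in \<open>auto simp: s_def complex_eq_iff\<close>)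
  also have "(\<Sum>i<2. \<Sum>k<2. cnj (V i) * V k * ((reflected_entry w (s i) 0 0 - cnj (reflected_entry w (s k) 0 0)) / (s i - cnj (s k))))
     = cnj c * c * ((p - cnj p) / (a - cnj a)) + - (cnj c * of_real (A + 1) * c) + (- (of_real (A + 1) * c * ((q - cnj p) / (x - cnj a)))
       + of_real (A + 1) * of_real (A + 1) * ((q - cnj q) / (x - cnj x)))"
    using ia by (simp add: numeral_2_eq_2 reflected_entry_def s_def V_def w_def p_def q_def c_def)
  also have "(q - cnj p) / (x - cnj a) = cnj c"
  proof -
    have "cnj c = (- (q - cnj p)) / (- (x - cnj a))" by (simp add: c_def)
    then show ?thesis by (simp only: minus_divide_divide)
  qed
  also have "(p - cnj p) / (a - cnj a) = of_real A" using ia by (simp add: A_def complex_diff_cnj)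
  also have "(q - cnj q) / (x - cnj x) = of_real G" using ia by (simp add: G_def complex_diff_cnj)
  also have "cnj c * c * of_real A + - (cnj c * of_real (A + 1) * c) + (- (of_real (A + 1) * c * cnj c) + of_real (A + 1) * of_real (A + 1) * of_real G)
     = of_real ((cmod c)\<^sup>2 * A - 2 * (A + 1) * (cmod c)\<^sup>2 + (A + 1)\<^sup>2 * G)"
  proof -
    have cc: "c * cnj c = of_real ((cmod c)\<^sup>2)" by (simp add: complex_norm_square del: of_real_power)
    have "cnj c * c * of_real A + - (cnj c * of_real (A + 1) * c) + (- (of_real (A + 1) * c * cnj c) + of_real (A + 1) * of_real (A + 1) * of_real G)
      = (c * cnj c) * of_real A - 2 * of_real (A + 1) * (c * cnj c) + of_real (A + 1) * of_real (A + 1) * of_real G"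
      by (simp add: algebra_simps)
    then show ?thesis unfolding cc by (simp add: power2_eq_square)
  qed
  finally have "(A + 2) * (cmod c)\<^sup>2 \<le> (A + 1)\<^sup>2 * G" by (simp add: algebra_simps)
  also have "\<dots> \<le> (A + 2) * ((A + 1) * G)" using A0 by (simp add: power2_eq_square algebra_simps)
  finally have cG: "(cmod c)\<^sup>2 \<le> (A + 1) * G" using A0 by simp
  define K where "K = (A + 1) * ((cmod (a - cnj x))\<^sup>2 / Im x)"
  have K0: "0 \<le> K" using A0 ia by (simp add: K_def)
  have "(cmod (p - cnj q))\<^sup>2 = (cmod c)\<^sup>2 * (cmod (a - cnj x))\<^sup>2"
    using ne(1) by (simp add: c_def norm_divide power_divide)
  also have "\<dots> \<le> (A + 1) * G * (cmod (a - cnj x))\<^sup>2" by (intro mult_right_mono cG) simp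
  also have "\<dots> = K * Im q" using ia by (simp add: K_def G_def)
  also have "\<dots> \<le> K * cmod q" using K0 abs_Im_le_cmod[of q] by (intro mult_left_mono) auto
  finally have main: "(cmod (p - cnj q))\<^sup>2 \<le> K * cmod q" .
  have "cmod q \<le> 2 * cmod p + K"
  proof (cases "cmod q \<le> cmod p")
    case False
    have "cmod q - cmod p \<le> cmod (p - cnj q)" by (metis complex_mod_cnj norm_minus_commute norm_triangle_ineq2)
    then have "(cmod q - cmod p)\<^sup>2 \<le> (cmod (p - cnj q))\<^sup>2" using False by (intro power_mono) auto
    also note main
    finally have "cmod q * cmod q \<le> (2 * cmod p + K) * cmod q"
    proof -
      assume "(cmod q - cmod p)\<^sup>2 \<le> K * cmod q"
      moreover have "(cmod q - cmod p)\<^sup>2 = cmod q * cmod q - 2 * cmod p * cmod q + cmod p * cmod p"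
        by (simp add: power2_eq_square algebra_simps)
      ultimately show "cmod q * cmod q \<le> (2 * cmod p + K) * cmod q"
        using zero_le_square[of "cmod p"] unfolding distrib_right by linarith
    qed
    then show ?thesis using False norm_ge_zero[of p] by (smt (verit) mult_le_cancel_right)
  qed (use K0 norm_ge_zero[of p] in linarith)
  then show ?thesis by (simp add: p_def q_def K_def A_def)
qed

text \<open>Polarization: an entry is a combination of four values of the quadratic form.\<close>

lemma entry_from_forms:
  fixes M :: "complex mat" and m :: nat
  defines "F \<equiv> \<lambda>y. \<Sum>i<m. \<Sum>k<m. cnj (y i) * M $$ (i, k) * y k"
  assumes ab: "a < m" "b < m"
  shows "cmod (M $$ (a, b)) \<le> cmod (F (\<lambda>i. if i = a then 1 else 0)) + cmod (F (\<lambda>i. if i = b then 1 else 0))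
     + cmod (F (\<lambda>i. (if i = a then 1 else 0) + (if i = b then 1 else 0)))
     + cmod (F (\<lambda>i. (if i = a then 1 else 0) + (if i = b then \<i> else 0)))"
proof -
  have F: "F (\<lambda>i. (if i = a then s else 0) + (if i = b then t else 0))
     = cnj s * s * M $$ (a, a) + cnj s * t * M $$ (a, b) + cnj t * s * M $$ (b, a) + cnj t * t * M $$ (b, b)" for s t
  proof -
    have inner: "(\<Sum>k<m. y * M $$ (i, k) * ((if k = a then s else 0) + (if k = b then t else 0)))
       = y * (M $$ (i, a) * s + M $$ (i, b) * t)" for y i
    proof -
      have "(\<Sum>k<m. y * M $$ (i, k) * ((if k = a then s else 0) + (if k = b then t else 0)))
        = (\<Sum>k<m. (if k = a then y * M $$ (i, k) * s else 0) + (if k = b then y * M $$ (i, k) * t else 0))"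
        by (intro sum.cong) (auto simp: algebra_simps)
      then show ?thesis using ab by (simp add: sum.distrib algebra_simps)
    qed
    have "F (\<lambda>i. (if i = a then s else 0) + (if i = b then t else 0))
      = (\<Sum>i<m. (if i = a then cnj s * (M $$ (i, a) * s + M $$ (i, b) * t) else 0) + (if i = b then cnj t * (M $$ (i, a) * s + M $$ (i, b) * t) else 0))"
      unfolding F_def inner by (intro sum.cong) (auto simp: algebra_simps)
    then show ?thesis using ab by (simp add: sum.distrib algebra_simps)
  qed
  have da: "F (\<lambda>i. if i = a then 1 else 0) = M $$ (a, a)" using F[of 1 0] by (simp cong: if_cong)
  have db: "F (\<lambda>i. if i = b then 1 else 0) = M $$ (b, b)" using F[of 0 1] by (simp cong: if_cong)
  define S1 where "S1 = F (\<lambda>i. (if i = a then 1 else 0) + (if i = b then 1 else 0))"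
  define S2 where "S2 = F (\<lambda>i. (if i = a then 1 else 0) + (if i = b then \<i> else 0))"
  have S: "S1 = M $$ (a, a) + M $$ (a, b) + M $$ (b, a) + M $$ (b, b)" "S2 = M $$ (a, a) + \<i> * M $$ (a, b) - \<i> * M $$ (b, a) + M $$ (b, b)"
    unfolding S1_def S2_def F by simp_all
  have "2 * M $$ (a, b) = (S1 - M $$ (a, a) - M $$ (b, b)) - \<i> * (S2 - M $$ (a, a) - M $$ (b, b))"
    unfolding S by (simp add: algebra_simps)
  then have "cmod (2 * M $$ (a, b)) \<le> cmod (S1 - M $$ (a, a) - M $$ (b, b)) + cmod (\<i> * (S2 - M $$ (a, a) - M $$ (b, b)))"
    by (metis norm_triangle_ineq4)
  also have "\<dots> \<le> (cmod S1 + cmod (M $$ (a, a)) + cmod (M $$ (b, b))) + (cmod S2 + cmod (M $$ (a, a)) + cmod (M $$ (b, b)))"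
    unfolding norm_mult norm_ii mult_1
    by (intro add_mono order_trans[OF norm_triangle_ineq4] add_right_mono) auto
  finally have "2 * cmod (M $$ (a, b)) \<le> cmod S1 + cmod (M $$ (a, a)) + cmod (M $$ (b, b)) + (cmod S2 + cmod (M $$ (a, a)) + cmod (M $$ (b, b)))"
    unfolding norm_mult by simp
  then have "cmod (M $$ (a, b)) \<le> cmod (M $$ (a, a)) + cmod (M $$ (b, b)) + (cmod S1 + cmod S2) / 2"
    by argo
  also have "\<dots> \<le> cmod (M $$ (a, a)) + cmod (M $$ (b, b)) + (cmod S1 + cmod S2)" by simp
  finally show ?thesis by (simp add: da db S1_def S2_def)
qed

text \<open>The forms of \<open>w\<close> are scalar Nevanlinna functions, bounded on compact sets by their value at one point, and the entries are combinations of forms.\<close>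

lemma nevanlinna_locally_bounded:
  assumes a: "a \<in> upper_half" and K: "compact K" "K \<subseteq> upper_half"
  shows "\<exists>B. \<forall>w \<in> nevanlinna_class m. w a = A \<longrightarrow> (\<forall>x\<in>K. \<forall>i<m. \<forall>k<m. cmod (w x $$ (i, k)) \<le> B)"
proof -
  define F where "F M y = (\<Sum>i<m. \<Sum>k<m. cnj (y i) * M $$ (i, k) * y k)" for M :: "complex mat" and y :: "nat \<Rightarrow> complex"
  have "continuous_on K (\<lambda>x. (cmod (a - cnj x))\<^sup>2 / Im x)"
    using K(2) by (intro continuous_intros) (auto simp: upper_half_def)
  then have "compact ((\<lambda>x. (cmod (a - cnj x))\<^sup>2 / Im x) ` K)" using K(1) by (rule compact_continuous_image)
  then have "bounded ((\<lambda>x. (cmod (a - cnj x))\<^sup>2 / Im x) ` K)" by (rule compact_imp_bounded)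
  then obtain B where "\<forall>y \<in> (\<lambda>x. (cmod (a - cnj x))\<^sup>2 / Im x) ` K. norm y \<le> B"
    unfolding bounded_iff by (elim exE)
  then have B: "(cmod (a - cnj x))\<^sup>2 / Im x \<le> B" if "x \<in> K" for x
    using that by (fastforce dest: abs_le_D1)
  define c where "c y = 2 * cmod (F A y) + (Im (F A y) / Im a + 1) * max B 0" for y
  have bound: "cmod (F (w x) y) \<le> c y" if w: "w \<in> nevanlinna_class m" "w a = A" and x: "x \<in> K" for w x y
  proof -
    have holw: "(\<lambda>x. w x $$ (i, k)) holomorphic_on upper_half" if "i < m" "k < m" for i k
      using w(1) that by (simp add: nevanlinna_class_def)
    have hol: "(\<lambda>x. F (w x) y) holomorphic_on upper_half"
      unfolding F_def by (intro holomorphic_on_sum holomorphic_on_mult holomorphic_on_const holw) simp_all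
    have pos: "0 \<le> Im (F (w x) y)" if x: "x \<in> upper_half" for x
    proof -
      have "0 \<le> Re (\<Sum>i<m. \<Sum>k<m. cnj (y i) * ((w x $$ (i, k) - cnj (w x $$ (k, i))) / (2 * \<i>)) * y k)"
        by (rule nevanlinna_im_form[OF w(1) x])
      also have "(\<Sum>i<m. \<Sum>k<m. cnj (y i) * ((w x $$ (i, k) - cnj (w x $$ (k, i))) / (2 * \<i>)) * y k)
         = (F (w x) y - cnj (F (w x) y)) / (2 * \<i>)"
      proof -
        have "cnj (F (w x) y) = (\<Sum>i<m. \<Sum>k<m. y i * cnj (w x $$ (i, k)) * cnj (y k))" by (simp add: F_def)
        also have "\<dots> = (\<Sum>k<m. \<Sum>i<m. y i * cnj (w x $$ (i, k)) * cnj (y k))" by (rule sum.swap)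
        finally have cj: "cnj (F (w x) y) = (\<Sum>i<m. \<Sum>k<m. cnj (y i) * cnj (w x $$ (k, i)) * y k)"
          by (simp add: mult.commute mult.left_commute)
        have t: "cnj (y i) * ((w x $$ (i, k) - cnj (w x $$ (k, i))) / (2 * \<i>)) * y k
           = (cnj (y i) * w x $$ (i, k) * y k - cnj (y i) * cnj (w x $$ (k, i)) * y k) / (2 * \<i>)" for i k
          by (simp add: algebra_simps diff_divide_distrib)
        show ?thesis unfolding cj unfolding F_def t by (simp only: sum_subtractf sum_divide_distrib[symmetric])
      qed
      also have "Re ((F (w x) y - cnj (F (w x) y)) / (2 * \<i>)) = Im (F (w x) y)"
        by (simp add: complex_diff_cnj)
      finally show ?thesis .
    qed
    have xu: "x \<in> upper_half" using K(2) x by (rule subsetD)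
    have ia: "0 < Im a" using a by (simp add: upper_half_def)
    have "cmod (F (w x) y) \<le> 2 * cmod (F (w a) y) + (Im (F (w a) y) / Im a + 1) * ((cmod (a - cnj x))\<^sup>2 / Im x)"
      using scalar_two_point_bound[where f = "\<lambda>x. F (w x) y" and a = a and x = x, OF hol pos a xu] .
    also have "\<dots> \<le> c y"
      unfolding c_def w(2)[symmetric]
    proof (intro add_left_mono mult_left_mono)
      show "(cmod (a - cnj x))\<^sup>2 / Im x \<le> max B 0" using B[OF x] by simp
      show "0 \<le> Im (F (w a) y) / Im a + 1" using pos[OF a] ia by simp
    qed
    finally show ?thesis .
  qed
  define e where "e i = (\<lambda>t. if t = i then 1 else 0 :: complex)" for i :: nat
  define C where "C i k = c (e i) + c (e k) + c (\<lambda>t. (if t = i then 1 else 0) + (if t = k then 1 else 0))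
     + c (\<lambda>t. (if t = i then 1 else 0) + (if t = k then \<i> else 0))" for i k :: nat
  have c0: "0 \<le> C i k" if w: "w \<in> nevanlinna_class m" "w a = A" "x \<in> K" for w x i k
  proof -
    have "0 \<le> c y" for y by (rule order_trans[OF norm_ge_zero bound[OF w]])
    then show ?thesis by (simp add: C_def)
  qed
  have "cmod (w x $$ (i, k)) \<le> (\<Sum>i<m. \<Sum>k<m. C i k)"
    if w: "w \<in> nevanlinna_class m" "w a = A" "x \<in> K" and ik: "i < m" "k < m" for w x i k
  proof -
    have "cmod (w x $$ (i, k)) \<le> cmod (F (w x) (e i)) + cmod (F (w x) (e k))
       + cmod (F (w x) (\<lambda>t. (if t = i then 1 else 0) + (if t = k then 1 else 0)))
       + cmod (F (w x) (\<lambda>t. (if t = i then 1 else 0) + (if t = k then \<i> else 0)))"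
      unfolding F_def e_def by (rule entry_from_forms[OF ik])
    also have "\<dots> \<le> C i k" unfolding C_def by (intro add_mono bound[OF w])
    also have "\<dots> \<le> (\<Sum>k<m. C i k)"
      using ik c0[OF w] member_le_sum[of k "{..<m}" "C i"] by simp
    also have "\<dots> \<le> (\<Sum>i<m. \<Sum>k<m. C i k)"
      using ik c0[OF w] member_le_sum[of i "{..<m}" "\<lambda>i. \<Sum>k<m. C i k"] by (simp add: sum_nonneg)
    finally show ?thesis .
  qed
  then show ?thesis by (intro exI[of _ "\<Sum>i<m. \<Sum>k<m. C i k"] ballI impI allI)
qed

text \<open>Montel's theorem for one entry after the other, with subsequences of subsequences. The value at one point is prescribed because Nevanlinna functions are only bounded in terms of such a value.\<close>

theorem nevanlinna_compact:
  assumes w: "\<And>n. w n \<in> nevanlinna_class m" and a: "a \<in> upper_half" and A: "\<And>n. w n a = A"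
  obtains r g where "strict_mono (r :: nat \<Rightarrow> nat)" "g \<in> nevanlinna_class m"
    "\<And>x i k. x \<in> upper_half \<Longrightarrow> i < m \<Longrightarrow> k < m \<Longrightarrow> (\<lambda>n. w (r n) x $$ (i, k)) \<longlonglongrightarrow> g x $$ (i, k)"
proof -
  have op: "open upper_half" by (simp add: upper_half_def open_halfspace_Im_gt)
  have "\<exists>r g. strict_mono (r :: nat \<Rightarrow> nat) \<and> (\<forall>p\<in>Q. g p holomorphic_on upper_half \<and>
      (\<forall>x\<in>upper_half. (\<lambda>n. w (r n) x $$ p) \<longlonglongrightarrow> g p x))"
    if "finite Q" "Q \<subseteq> {..<m} \<times> {..<m}" for Q
    using that
  proof (induction Q rule: finite_induct)
    case empty
    show ?case by (rule exI[of _ "\<lambda>n. n"]) (simp add: strict_mono_def)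
  next
    case (insert p Q)
    from insert.prems have "Q \<subseteq> {..<m} \<times> {..<m}" by blast
    from insert.IH[OF this] obtain r g where r: "strict_mono (r :: nat \<Rightarrow> nat)"
      and rg: "\<forall>q\<in>Q. g q holomorphic_on upper_half \<and> (\<forall>x\<in>upper_half. (\<lambda>n. w (r n) x $$ q) \<longlonglongrightarrow> g q x)" by blast
    have g: "g q holomorphic_on upper_half" "x \<in> upper_half \<Longrightarrow> (\<lambda>n. w (r n) x $$ q) \<longlonglongrightarrow> g q x" if "q \<in> Q" for q x
      using rg that by blast+
    obtain i k where p: "p = (i, k)" "i < m" "k < m" using insert.prems by auto
    define \<H> where "\<H> = range (\<lambda>n x. w (r n) x $$ p)"
    have M1: "h holomorphic_on upper_half" if "h \<in> \<H>" for h
    proof -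
      from that obtain n where h: "h = (\<lambda>x. w (r n) x $$ p)" unfolding \<H>_def by (rule rangeE)
      show ?thesis using w[of "r n"] p(2,3) unfolding h p(1) by (simp add: nevanlinna_class_def)
    qed
    have M2: "\<exists>B. \<forall>h\<in>\<H>. \<forall>x\<in>K. cmod (h x) \<le> B" if K: "compact K" "K \<subseteq> upper_half" for K
    proof -
      obtain B where "\<forall>w\<in>nevanlinna_class m. w a = A \<longrightarrow> (\<forall>x\<in>K. \<forall>i<m. \<forall>k<m. cmod (w x $$ (i, k)) \<le> B)"
        using nevanlinna_locally_bounded[OF a K, of m A] by (elim exE)
      then have "cmod (w (r n) x $$ p) \<le> B" if "x \<in> K" for n x
        using w A that p(2,3) unfolding p(1) by simp
      then show ?thesis unfolding \<H>_def by (intro exI[of _ B]) simp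
    qed
    have M3: "range (\<lambda>n x. w (r n) x $$ p) \<subseteq> \<H>" by (simp add: \<H>_def)
    obtain h s where h: "h holomorphic_on upper_half" "strict_mono (s :: nat \<Rightarrow> nat)"
      "\<And>x. x \<in> upper_half \<Longrightarrow> (\<lambda>n. w (r (s n)) x $$ p) \<longlonglongrightarrow> h x"
    proof (rule Montel[OF op M1 M2 M3])
      fix h and s :: "nat \<Rightarrow> nat"
      assume "h holomorphic_on upper_half" "strict_mono s"
        "\<And>x. x \<in> upper_half \<Longrightarrow> (\<lambda>n. w (r (s n)) x $$ p) \<longlonglongrightarrow> h x"
      then show thesis by (rule that)
    qed
    show ?case
    proof (intro exI[of _ "r \<circ> s"] exI[of _ "g(p := h)"] conjI ballI)
      show "strict_mono (r \<circ> s)" using r h(2) by (rule strict_mono_o)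
      fix q assume "q \<in> insert p Q"
      then show "(g(p := h)) q holomorphic_on upper_half" using g(1)[of q] h(1) by (cases "q = p") simp_all
      fix x assume x: "x \<in> upper_half"
      show "(\<lambda>n. w ((r \<circ> s) n) x $$ q) \<longlonglongrightarrow> (g(p := h)) q x"
      proof (cases "q = p")
        case False
        then have "(\<lambda>n. w (r n) x $$ q) \<longlonglongrightarrow> g q x" using g(2)[OF _ x] \<open>q \<in> insert p Q\<close> by auto
        from LIMSEQ_subseq_LIMSEQ[OF this h(2)] show ?thesis using False by (simp add: o_def)
      qed (use h(3)[OF x] in simp)
    qed
  qed
  from this[of "{..<m} \<times> {..<m}"] obtain r g where r: "strict_mono (r :: nat \<Rightarrow> nat)"
    and rg: "\<forall>p\<in>{..<m} \<times> {..<m}. g p holomorphic_on upper_half \<and>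
      (\<forall>x\<in>upper_half. (\<lambda>n. w (r n) x $$ p) \<longlonglongrightarrow> g p x)" by blast
  have g: "g p holomorphic_on upper_half" "x \<in> upper_half \<Longrightarrow> (\<lambda>n. w (r n) x $$ p) \<longlonglongrightarrow> g p x"
    if "p \<in> {..<m} \<times> {..<m}" for p x
    using rg that by blast+
  define G where "G x = mat m m (\<lambda>p. g p x)" for x
  have lim: "(\<lambda>n. w (r n) x $$ (i, k)) \<longlonglongrightarrow> G x $$ (i, k)" if "x \<in> upper_half" "i < m" "k < m" for x i k
    using g(2)[of "(i, k)" x] that by (simp add: G_def)
  have "G \<in> nevanlinna_class m"
    unfolding nevanlinna_class_def mem_Collect_eq
  proof (intro conjI ballI allI impI)
    fix i k assume ik: "i < m" "k < m"
    have "(\<lambda>x. G x $$ (i, k)) = g (i, k)" using ik by (simp add: G_def)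
    then show "(\<lambda>x. G x $$ (i, k)) holomorphic_on upper_half" using g(1)[of "(i, k)"] ik by simp
  next
    fix x assume x: "x \<in> upper_half"
    have wc: "w n x \<in> carrier_mat m m" for n using w x by (simp add: nevanlinna_class_def)
    show "psd_mat m ((1 / (2 * \<i>)) \<cdot>\<^sub>m (G x - mat_adjoint (G x)))"
    proof (rule psd_limit[where L = "(1 / (2 * \<i>)) \<cdot>\<^sub>m (G x - mat_adjoint (G x))" and F = sequentially and A = "\<lambda>n. (1 / (2 * \<i>)) \<cdot>\<^sub>m (w (r n) x - mat_adjoint (w (r n) x))"])
      show "psd_mat m ((1 / (2 * \<i>)) \<cdot>\<^sub>m (w (r n) x - mat_adjoint (w (r n) x)))" for n
        using w x by (simp add: nevanlinna_class_def)
      fix i k assume ik: "i < m" "k < m"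
      have "(\<lambda>n. 1 / (2 * \<i>) * (w (r n) x $$ (i, k) - cnj (w (r n) x $$ (k, i)))) \<longlonglongrightarrow> 1 / (2 * \<i>) * (G x $$ (i, k) - cnj (G x $$ (k, i)))"
        by (intro tendsto_mult tendsto_const tendsto_diff tendsto_cnj lim x ik)
      then show "(\<lambda>n. ((1 / (2 * \<i>)) \<cdot>\<^sub>m (w (r n) x - mat_adjoint (w (r n) x))) $$ (i, k)) \<longlonglongrightarrow> ((1 / (2 * \<i>)) \<cdot>\<^sub>m (G x - mat_adjoint (G x))) $$ (i, k)"
        using ik carrier_matD[OF wc] by (simp add: G_def)
    next
      show "(1 / (2 * \<i>)) \<cdot>\<^sub>m (G x - mat_adjoint (G x)) \<in> carrier_mat m m"
        by (intro carrier_matI) (simp_all add: G_def)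
    qed simp
  qed (simp add: G_def)
  then show thesis by (rule that[OF r]) (rule lim)
qed

section \<open>Matrix balls\<close>

lemma matrix_ballI:
  "V \<in> carrier_mat m m \<Longrightarrow> psd_mat m (1\<^sub>m m - mat_adjoint V * V) \<Longrightarrow> c + r * V * \<rho> \<in> matrix_ball m c r \<rho>"
  unfolding matrix_ball_def by blast

text \<open>With \<open>Q = V V\<^sup>*\<close> one has \<open>1 - Q = (1 - Q)\<^sup>2 + V (1 - V\<^sup>* V) V\<^sup>*\<close>.\<close>

lemma contraction_adjoint:
  assumes V: "V \<in> carrier_mat m m" and psd: "psd_mat m (1\<^sub>m m - mat_adjoint V * V)"
  shows "psd_mat m (1\<^sub>m m - V * mat_adjoint V)"
proof -
  define Q where "Q = V * mat_adjoint V"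
  have Q: "Q \<in> carrier_mat m m" "mat_adjoint Q = Q" using V by (auto simp: Q_def mat_adjoint_mult)
  have c: "1\<^sub>m m - Q \<in> carrier_mat m m" using Q by (intro minus_carrier_mat)
  have a: "mat_adjoint (1\<^sub>m m - Q) = 1\<^sub>m m - Q" using Q by (simp add: mat_adjoint_minus)
  have e1: "(1\<^sub>m m - Q) * (1\<^sub>m m - Q) = 1\<^sub>m m - Q - (Q - Q * Q)"
    using Q by (simp add: mat_expand)
  have e2: "V * (1\<^sub>m m - mat_adjoint V * V) * mat_adjoint V = Q - Q * Q"
    unfolding Q_def using V by (simp add: mat_expand)
  have "psd_mat m ((1\<^sub>m m - Q) * (1\<^sub>m m - Q))" using psd_gram[OF c] a by simp
  moreover have "psd_mat m (V * (1\<^sub>m m - mat_adjoint V * V) * mat_adjoint V)"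
    using psd_congruence[OF psd, of "mat_adjoint V" m] V by simp
  ultimately have "psd_mat m ((1\<^sub>m m - Q - (Q - Q * Q)) + (Q - Q * Q))" unfolding e1 e2 by (rule psd_add)
  also have "(1\<^sub>m m - Q - (Q - Q * Q)) + (Q - Q * Q) = 1\<^sub>m m - Q"
    using Q by (intro eq_matI) (simp_all del: index_mult_mat(1))
  finally show ?thesis by (simp add: Q_def)
qed

lemma pd_psd_combination:
  assumes "psd_mat m (1\<^sub>m m - S)" "S \<in> carrier_mat m m" "0 \<le> t" "t < 1"
  shows "pd_mat m (1\<^sub>m m - complex_of_real t \<cdot>\<^sub>m S)"
proof -
  have "pd_mat m (complex_of_real (1 - t) \<cdot>\<^sub>m 1\<^sub>m m + complex_of_real t \<cdot>\<^sub>m (1\<^sub>m m - S))"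
    using assms by (intro pd_psd_add pd_smult psd_smult pd_one) auto
  also have "complex_of_real (1 - t) \<cdot>\<^sub>m 1\<^sub>m m + complex_of_real t \<cdot>\<^sub>m (1\<^sub>m m - S) = 1\<^sub>m m - complex_of_real t \<cdot>\<^sub>m S"
    using assms(2) by (intro eq_matI) (auto simp: algebra_simps)
  finally show ?thesis .
qed

text \<open>The ball with semi-radii \<open>r\<close>, \<open>\<rho>\<close> consists of the solutions of the quadratic inequality \<open>(X - c) A (X - c)\<^sup>* \<le> R2\<close> when \<open>r\<^sup>2 = R2\<close> and \<open>\<rho>\<^sup>2 = A\<^sup>-\<^sup>1\<close>.\<close>

locale ball_data =
  fixes m :: nat and A R2 c r \<rho> :: "complex mat"
  assumes A: "pd_mat m A" and r: "pd_mat m r" and \<rho>: "pd_mat m \<rho>" and c: "c \<in> carrier_mat m m"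
    and rr: "r * r = R2" and rho: "\<rho> * \<rho> = minv A"
begin

lemma carr: "A \<in> carrier_mat m m" "r \<in> carrier_mat m m" "\<rho> \<in> carrier_mat m m"
  using A r \<rho> by (auto intro: pd_carrier)

lemmas dims = carr[THEN carrier_matD(1)] carr[THEN carrier_matD(2)] c[THEN carrier_matD(1)] c[THEN carrier_matD(2)]

lemma rho_A_rho: "\<rho> * (A * \<rho>) = 1\<^sub>m m"
proof -
  have "\<rho> * (\<rho> * A) = 1\<^sub>m m"
    using minv_left[OF carr(1) pd_det[OF A]] unfolding rho[symmetric] using dims by (simp add: mat_mult_assoc)
  then have "(\<rho> * A) * \<rho> = 1\<^sub>m m"
    using carr by (intro mat_mult_left_right_inverse[OF carr(3)]) auto
  then show ?thesis using dims by (simp add: mat_mult_assoc)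
qed

lemma ball_form:
  assumes V: "V \<in> carrier_mat m m"
  shows "R2 - ((c + r * V * \<rho>) - c) * A * mat_adjoint ((c + r * V * \<rho>) - c) = r * (1\<^sub>m m - V * mat_adjoint V) * r"
proof -
  note d = dims V[THEN carrier_matD(1)] V[THEN carrier_matD(2)]
  have "(c + r * V * \<rho>) - c = r * (V * \<rho>)"
    using d by (intro eq_matI) (simp_all add: mat_mult_assoc del: index_mult_mat(1))
  then have "((c + r * V * \<rho>) - c) * A * mat_adjoint ((c + r * V * \<rho>) - c) = r * (V * ((\<rho> * (A * \<rho>)) * (mat_adjoint V * r)))"
    using d by (simp add: mat_adjoint_mult pd_adjoint[OF r] pd_adjoint[OF \<rho>] mat_mult_assoc)
  then show ?thesis unfolding rho_A_rho rr[symmetric] using d by (simp add: mat_expand)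
qed

lemma ball_member:
  assumes X: "X \<in> matrix_ball m c r \<rho>"
  shows "psd_mat m (R2 - (X - c) * A * mat_adjoint (X - c))"
proof -
  obtain V where V: "V \<in> carrier_mat m m" "psd_mat m (1\<^sub>m m - mat_adjoint V * V)" "X = c + r * V * \<rho>"
    using X by (auto simp: matrix_ball_def)
  show ?thesis unfolding V(3) ball_form[OF V(1)]
    using psd_congruence[OF contraction_adjoint[OF V(1,2)] carr(2)] by (simp add: pd_adjoint[OF r])
qed

lemma ball_interior:
  assumes V: "V \<in> carrier_mat m m" "psd_mat m (1\<^sub>m m - mat_adjoint V * V)" and t: "0 \<le> t" "t < 1"
    and X: "X = c + r * (complex_of_real t \<cdot>\<^sub>m V) * \<rho>"
  shows "pd_mat m (R2 - (X - c) * A * mat_adjoint (X - c))"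
proof -
  have tV: "complex_of_real t \<cdot>\<^sub>m V \<in> carrier_mat m m" using V by simp
  have "(complex_of_real t \<cdot>\<^sub>m V) * mat_adjoint (complex_of_real t \<cdot>\<^sub>m V) = complex_of_real (t * t) \<cdot>\<^sub>m (V * mat_adjoint V)"
    using V by (simp add: mat_expand)
  moreover have "pd_mat m (1\<^sub>m m - complex_of_real (t * t) \<cdot>\<^sub>m (V * mat_adjoint V))"
    using contraction_adjoint[OF V] V mult_strict_mono[of t 1 t 1] t by (intro pd_psd_combination) simp_all
  ultimately show ?thesis
    unfolding X ball_form[OF tV]
    using pd_congruence[of m _ r m, OF _ carr(2) mat_vec_nonzero[OF carr(2) pd_det[OF r]]] by (simp add: pd_adjoint[OF r])
qed

lemma in_ballI:
  assumes X: "X \<in> carrier_mat m m" and psd: "psd_mat m (R2 - (X - c) * A * mat_adjoint (X - c))"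
  shows "X \<in> matrix_ball m c r \<rho>"
proof -
  note ri = minv_works[OF carr(2) pd_det[OF r]] and ii = minv_works[OF carr(3) pd_det[OF \<rho>]]
  define V where "V = minv r * (X - c) * minv \<rho>"
  have Xc: "X - c \<in> carrier_mat m m" using c by (intro minus_carrier_mat)
  have V: "V \<in> carrier_mat m m" using ri ii Xc by (simp add: V_def)
  note d = dims X[THEN carrier_matD(1)] X[THEN carrier_matD(2)] ri(1)[THEN carrier_matD(1)] ri(1)[THEN carrier_matD(2)]
    ii(1)[THEN carrier_matD(1)] ii(1)[THEN carrier_matD(2)] V[THEN carrier_matD(1)] V[THEN carrier_matD(2)]
  have "r * V * \<rho> = (r * minv r) * ((X - c) * (minv \<rho> * \<rho>))"
    unfolding V_def using d by (simp add: mat_mult_assoc)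
  then have rV: "r * V * \<rho> = X - c" using Xc d by (simp add: ri ii)
  have X': "X = c + r * V * \<rho>" unfolding rV using d by (intro eq_matI) auto
  have "psd_mat m (r * (1\<^sub>m m - V * mat_adjoint V) * r)"
    using psd unfolding ball_form[OF V, folded X'] .
  then have "psd_mat m (mat_adjoint (minv r) * (r * (1\<^sub>m m - V * mat_adjoint V) * r) * minv r)"
    by (rule psd_congruence[OF _ ri(1)])
  also have "mat_adjoint (minv r) = minv r" by (rule minv_hermitian[OF pd_hermitian[OF r] pd_det[OF r]])
  also have "minv r * (r * (1\<^sub>m m - V * mat_adjoint V) * r) * minv r = (minv r * r) * ((1\<^sub>m m - V * mat_adjoint V) * (r * minv r))"
    using d by (simp add: mat_mult_assoc)
  also have "\<dots> = 1\<^sub>m m - V * mat_adjoint V" using V by (simp add: ri right_mult_one_mat[of _ m m])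
  finally have "psd_mat m (1\<^sub>m m - V * mat_adjoint V)" .
  then have "psd_mat m (1\<^sub>m m - mat_adjoint V * V)" using contraction_adjoint[of "mat_adjoint V" m] V by simp
  then show ?thesis unfolding matrix_ball_def using V X' by blast
qed

end

text \<open>Completing the square in the inequality for the value \<open>X\<close>. The linear terms in \<open>X\<close> and \<open>X\<^sup>*\<close> on the left are absorbed by the centre because \<open>k\<close> is purely imaginary.\<close>

lemma complete_square:
  assumes A: "pd_mat m A" and c: "N \<in> carrier_mat m m" "U \<in> carrier_mat m m" "X \<in> carrier_mat m m" and k: "cnj k = - k"
  defines "c \<equiv> (N - k \<cdot>\<^sub>m 1\<^sub>m m) * minv A"
  shows "k \<cdot>\<^sub>m (X - mat_adjoint X) - (U - N * mat_adjoint X - X * mat_adjoint N + X * A * mat_adjoint X)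
    = ((N - k \<cdot>\<^sub>m 1\<^sub>m m) * minv A * (mat_adjoint N + k \<cdot>\<^sub>m 1\<^sub>m m) - U) - (X - c) * A * mat_adjoint (X - c)"
proof -
  note Ac = pd_carrier[OF A] and Ai = minv_works[OF pd_carrier[OF A] pd_det[OF A]]
  have Na: "mat_adjoint N \<in> carrier_mat m m" using c by simp
  define L where "L = N - k \<cdot>\<^sub>m 1\<^sub>m m"
  have L: "L \<in> carrier_mat m m" unfolding L_def using c by (intro minus_carrier_mat) simp
  have La: "mat_adjoint L = mat_adjoint N + k \<cdot>\<^sub>m 1\<^sub>m m"
    unfolding L_def using c by (intro eq_matI) (auto simp: k)
  have cc: "c \<in> carrier_mat m m" unfolding c_def L_def[symmetric] using L Ai by simp
  have ca: "mat_adjoint c = minv A * mat_adjoint L"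
    unfolding c_def L_def[symmetric] using L Ai
    by (simp add: mat_adjoint_mult minv_hermitian[OF pd_hermitian[OF A] pd_det[OF A]])
  note d = Ac[THEN carrier_matD(1)] Ac[THEN carrier_matD(2)] Ai(1)[THEN carrier_matD(1)] Ai(1)[THEN carrier_matD(2)]
    L[THEN carrier_matD(1)] L[THEN carrier_matD(2)] c[THEN carrier_matD(1)] c[THEN carrier_matD(2)]
    cc[THEN carrier_matD(1)] cc[THEN carrier_matD(2)]
  have cA: "c * A = L"
  proof -
    have "c * A = L * (minv A * A)" unfolding c_def L_def[symmetric] using d by (simp add: mat_mult_assoc)
    then show ?thesis using L by (simp add: Ai)
  qed
  have Aca: "A * mat_adjoint c = mat_adjoint L"
  proof -
    have "A * mat_adjoint c = (A * minv A) * mat_adjoint L" unfolding ca using d by (simp add: mat_mult_assoc)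
    then show ?thesis using d by (simp add: Ai)
  qed
  have "(X - c) * A * mat_adjoint (X - c) = X * A * mat_adjoint X - X * mat_adjoint L - (L * mat_adjoint X - L * mat_adjoint c)"
  proof -
    have "(X - c) * A * mat_adjoint (X - c) = X * (A * mat_adjoint X) - X * (A * mat_adjoint c) - ((c * A) * mat_adjoint X - (c * A) * mat_adjoint c)"
      using d by (simp add: mat_expand) (rule eq_matI, simp_all del: index_mult_mat(1))
    then show ?thesis unfolding Aca cA using d by (simp add: mat_mult_assoc)
  qed
  moreover have "L * minv A * mat_adjoint L = L * mat_adjoint c" unfolding ca using d by (simp add: mat_mult_assoc)
  moreover have "X * mat_adjoint L = X * mat_adjoint N + k \<cdot>\<^sub>m X"
    unfolding La using d by (simp add: mat_expand right_mult_one_mat[OF c(3)])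
  moreover have "L * mat_adjoint X = N * mat_adjoint X - k \<cdot>\<^sub>m mat_adjoint X"
    unfolding L_def using d c by (simp add: mat_expand)
  ultimately show ?thesis
    unfolding L_def[symmetric] La[symmetric] using d
    by (intro eq_matI) (simp_all add: algebra_simps del: index_mult_mat(1))
qed

section \<open>The values of the solutions at a point\<close>

locale np_point = pd_nodes +
  fixes x :: complex
  assumes z_up: "\<And>j. 1 \<le> j \<Longrightarrow> 0 < Im (z j)" and x_up: "0 < Im x" and x_node: "\<And>j. 1 \<le> j \<Longrightarrow> z j \<noteq> x"
begin

lemma ne_x: "1 \<le> j \<Longrightarrow> z j \<noteq> x" "1 \<le> j \<Longrightarrow> z j \<noteq> cnj x"
proof -
  show "1 \<le> j \<Longrightarrow> z j \<noteq> x" by (rule x_node)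
  show "z j \<noteq> cnj x" if "1 \<le> j"
  proof
    assume "z j = cnj x"
    then show False using z_up[OF that] x_up by simp
  qed
qed

text \<open>The value \<open>X\<close> at \<open>s\<close> is admissible for the first \<open>n\<close> nodes if \<open>fmi n s X\<close> is positive; this is the fundamental matrix inequality, with the deviation family \<open>u - v X\<^sup>*\<close> at \<open>cnj s\<close>.\<close>

definition dev :: "complex \<Rightarrow> complex mat \<Rightarrow> nat \<Rightarrow> complex mat" where
  "dev s X j = uf (cnj s) j - vf (cnj s) j * mat_adjoint X"

definition fmi :: "nat \<Rightarrow> complex \<Rightarrow> complex mat \<Rightarrow> complex mat" where
  "fmi n s X = (1 / (s - cnj s)) \<cdot>\<^sub>m (X - mat_adjoint X) - Gram n (dev s X) (dev s X)"

lemma fam_dev: "X \<in> carrier_mat m m \<Longrightarrow> fam (dev s X)"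
  unfolding dev_def by (intro fam_diff fam_mult) simp_all

text \<open>Overwriting the node with number \<open>n + 1\<close> keeps the sequence of nodes infinite, as the locale demands.\<close>

lemma extended_nodes:
  assumes s: "Im s \<noteq> 0" "\<And>j. 1 \<le> j \<Longrightarrow> z j \<noteq> cnj s" and X: "X \<in> carrier_mat m m"
  shows "nodes m (z(Suc n := s)) (W(Suc n := X))"
proof
  fix j assume j: "1 \<le> (j::nat)"
  show "(z(Suc n := s)) j \<noteq> 0" using s(1) z_nonzero[OF j] by auto
  show "(W(Suc n := X)) j \<in> carrier_mat m m" using X W_carrier[OF j] by simp
  fix k assume k: "1 \<le> (k::nat)"
  have ss: "s \<noteq> cnj s" using s(1) by (auto simp: complex_eq_iff)
  have "s \<noteq> cnj (z k)" using s(2)[OF k] by (metis complex_cnj_cnj)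
  then show "(z(Suc n := s)) j \<noteq> cnj ((z(Suc n := s)) k)"
    using ss s(2)[OF j] z_cnj[OF j k] by auto
qed

text \<open>Up to the factor \<open>|s|\<^sup>2\<close> the matrix \<open>fmi n s X\<close> is the Schur complement of the new node, because the new block column is \<open>cnj s\<close> times the deviation family.\<close>

lemma extended_pick:
  fixes n :: nat and s :: complex and X :: "complex mat"
  assumes s: "Im s \<noteq> 0" "\<And>j. 1 \<le> j \<Longrightarrow> z j \<noteq> cnj s" and X: "X \<in> carrier_mat m m"
  defines "z' \<equiv> z(Suc n := s)" and "W' \<equiv> W(Suc n := X)"
  shows "psd_mat (Suc n * m) (pick_mat m z' W' (Suc n)) \<Longrightarrow> psd_mat m (fmi n s X)"
    and "pd_mat m (fmi n s X) \<Longrightarrow> pd_mat (Suc n * m) (pick_mat m z' W' (Suc n))"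
proof -
  interpret E: nodes m z' W' unfolding z'_def W'_def by (rule extended_nodes[OF s X])
  have s0: "s \<noteq> 0" "s - cnj s \<noteq> 0" using s(1) by (auto simp: complex_eq_iff)
  have old: "z' j = z j" "W' j = W j" if "j \<le> n" for j using that by (simp_all add: z'_def W'_def)
  have new: "z' (Suc n) = s" "W' (Suc n) = X" by (simp_all add: z'_def W'_def)
  have P: "pick_mat m z' W' n = Pm n"
  proof (rule eq_matI)
    fix i k assume "i < dim_row (Pm n)" "k < dim_col (Pm n)"
    then have ik: "i < n * m" "k < n * m" by simp_all
    then have "Suc (i div m) \<le> n" "Suc (k div m) \<le> n" using block_index(1) by (auto simp: Suc_le_eq)
    then show "pick_mat m z' W' n $$ (i, k) = Pm n $$ (i, k)"
      using ik by (simp add: pick_mat_eq E.pick_mat_eq block_mat_index E.pick_block_def pick_block_def old)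
  qed simp_all
  let ?d = "dev s X"
  note fd = fam_dev[OF X, of s]
  have Bj: "E.pick_block j (Suc n) = cnj s \<cdot>\<^sub>m ?d j" if j: "1 \<le> j" "j \<le> n" for j
  proof (rule eq_matI)
    note c = carrier_matD[OF W_carrier[OF j(1)]] carrier_matD[OF X] carrier_matD[OF famD[OF fd j(1)]]
    fix a b assume "a < dim_row (cnj s \<cdot>\<^sub>m ?d j)" "b < dim_col (cnj s \<cdot>\<^sub>m ?d j)"
    then have ab: "a < m" "b < m" using c by auto
    have "vf (cnj s) j * mat_adjoint X = ev (cnj s) j \<cdot>\<^sub>m mat_adjoint X"
      unfolding vf_def using c by (simp add: mat_smult_mult)
    then show "E.pick_block j (Suc n) $$ (a, b) = (cnj s \<cdot>\<^sub>m ?d j) $$ (a, b)"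
      using ab c by (simp add: E.pick_block_def old[OF j(2)] new dev_def uf_def ev_def algebra_simps)
  qed (use carrier_matD[OF E.pick_block_carrier[OF j(1), of "Suc n"]] carrier_matD[OF famD[OF fd j(1)]] in simp_all)
  have B: "coln m n (\<lambda>j. E.pick_block j (Suc n)) = cnj s \<cdot>\<^sub>m coln m n ?d"
    using coln_cong[of n "\<lambda>j. E.pick_block j (Suc n)" "\<lambda>j. cnj s \<cdot>\<^sub>m ?d j" m] Bj coln_smult[of ?d m n "cnj s"] famD[OF fd] by simp
  have C: "E.pick_block (Suc n) (Suc n) = (s * cnj s / (s - cnj s)) \<cdot>\<^sub>m (X - mat_adjoint X)"
    by (simp add: E.pick_block_def new)
  have pick: "pick_mat m z' W' (Suc n) = four_block_mat (Pm n) (cnj s \<cdot>\<^sub>m coln m n ?d) (mat_adjoint (cnj s \<cdot>\<^sub>m coln m n ?d))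
      (E.pick_block (Suc n) (Suc n))"
    unfolding E.Pm_Suc P B ..
  have h: "hermitian_mat m (E.pick_block (Suc n) (Suc n))"
    by (simp add: hermitian_mat_def E.pick_block_adjoint)
  have pick_col: "cnj s \<cdot>\<^sub>m coln m n ?d \<in> carrier_mat (n * m) m" by simp
  have ns: "s * cnj s = complex_of_real ((cmod s)\<^sup>2)" by (rule complex_norm_square[symmetric])
  have schur: "E.pick_block (Suc n) (Suc n) - mat_adjoint (cnj s \<cdot>\<^sub>m coln m n ?d) * (minv (Pm n) * (cnj s \<cdot>\<^sub>m coln m n ?d))
     = complex_of_real ((cmod s)\<^sup>2) \<cdot>\<^sub>m fmi n s X"
  proof -
    have "mat_adjoint (cnj s \<cdot>\<^sub>m coln m n ?d) * (minv (Pm n) * (cnj s \<cdot>\<^sub>m coln m n ?d)) = (s * cnj s) \<cdot>\<^sub>m Gram n ?d ?d"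
      unfolding Gram_def by (simp add: mat_expand mult.commute[of s])
    then show ?thesis unfolding C fmi_def ns[symmetric] using carrier_matD[OF X]
      by (intro eq_matI) (simp_all add: algebra_simps del: index_mult_mat(1))
  qed
  have pos: "0 < (cmod s)\<^sup>2" using s0 by simp
  have fc: "fmi n s X \<in> carrier_mat m m" unfolding fmi_def by (intro minus_carrier_mat) simp
  show "psd_mat m (fmi n s X)" if "psd_mat (Suc n * m) (pick_mat m z' W' (Suc n))"
  proof -
    have "psd_mat m (complex_of_real ((cmod s)\<^sup>2) \<cdot>\<^sub>m fmi n s X)"
      unfolding schur[symmetric] by (rule psd_schur_complement[OF pd_P pick_col h]) (use that pick in \<open>simp add: add.commute\<close>)
    then have "psd_mat m (complex_of_real (1 / (cmod s)\<^sup>2) \<cdot>\<^sub>m (complex_of_real ((cmod s)\<^sup>2) \<cdot>\<^sub>m fmi n s X))"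
      by (rule psd_smult) simp
    moreover have "complex_of_real (1 / (cmod s)\<^sup>2) \<cdot>\<^sub>m (complex_of_real ((cmod s)\<^sup>2) \<cdot>\<^sub>m fmi n s X) = fmi n s X"
      using pos fc by (intro eq_matI) auto
    ultimately show ?thesis by simp
  qed
  show "pd_mat (Suc n * m) (pick_mat m z' W' (Suc n))" if "pd_mat m (fmi n s X)"
  proof -
    have "pd_mat (n * m + m) (pick_mat m z' W' (Suc n))"
      unfolding pick by (rule pd_from_schur_complement[OF pd_P pick_col h]) (unfold schur, rule pd_smult[OF that pos])
    then show ?thesis by (simp add: add.commute)
  qed
qed

text \<open>The second statement uses the reflected node \<open>cnj x\<close> with the value \<open>(w x)\<^sup>*\<close>.\<close>

lemma solution_fmi:
  assumes w: "w \<in> np_solutions_trunc m z W n"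
  shows "psd_mat m (fmi n x (w x))" "psd_mat m (fmi n (cnj x) (mat_adjoint (w x)))" "w x \<in> carrier_mat m m"
proof -
  have wn: "w \<in> nevanlinna_class m" and wj: "\<And>j. 1 \<le> j \<Longrightarrow> j \<le> n \<Longrightarrow> w (z j) = W j"
    using w by (auto simp: np_solutions_trunc_def)
  show wx: "w x \<in> carrier_mat m m" using wn x_up by (simp add: nevanlinna_class_def upper_half_def)
  have Im1: "Im x \<noteq> 0" "Im (cnj x) \<noteq> 0" using x_up by auto
  have wa: "mat_adjoint (w x) \<in> carrier_mat m m" using wx by simp
  have nx: "z j \<noteq> cnj (cnj x)" if "1 \<le> j" for j using ne_x(1)[OF that] by simp
  show "psd_mat m (fmi n x (w x))"
  proof (rule extended_pick(1)[OF Im1(1) ne_x(2) wx])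
    interpret E: nodes m "z(Suc n := x)" "W(Suc n := w x)" by (rule extended_nodes[OF Im1(1) ne_x(2) wx])
    show "psd_mat (Suc n * m) (pick_mat m (z(Suc n := x)) (W(Suc n := w x)) (Suc n))"
    proof (rule E.pick_mat_psd[OF wn])
      show "Im ((z(Suc n := x)) j) \<noteq> 0" if "1 \<le> j" for j using z_up[OF that] x_up by auto
      show "(W(Suc n := w x)) j = (if 0 < Im ((z(Suc n := x)) j) then w ((z(Suc n := x)) j) else mat_adjoint (w (cnj ((z(Suc n := x)) j))))"
        if "1 \<le> j" "j \<le> Suc n" for j using z_up[OF that(1)] x_up wj[OF that(1)] that(2) by (cases "j = Suc n") auto
    qed
  qed
  show "psd_mat m (fmi n (cnj x) (mat_adjoint (w x)))"
  proof (rule extended_pick(1)[OF Im1(2) nx wa])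
    interpret E: nodes m "z(Suc n := cnj x)" "W(Suc n := mat_adjoint (w x))" by (rule extended_nodes[OF Im1(2) nx wa])
    show "psd_mat (Suc n * m) (pick_mat m (z(Suc n := cnj x)) (W(Suc n := mat_adjoint (w x))) (Suc n))"
    proof (rule E.pick_mat_psd[OF wn])
      show "Im ((z(Suc n := cnj x)) j) \<noteq> 0" if "1 \<le> j" for j using z_up[OF that] x_up by auto
      show "(W(Suc n := mat_adjoint (w x))) j = (if 0 < Im ((z(Suc n := cnj x)) j) then w ((z(Suc n := cnj x)) j) else mat_adjoint (w (cnj ((z(Suc n := cnj x)) j))))"
        if "1 \<le> j" "j \<le> Suc n" for j using z_up[OF that(1)] x_up wj[OF that(1)] that(2) by (cases "j = Suc n") auto
    qed
  qed
qed

lemma fmi_solution: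
  assumes X: "X \<in> carrier_mat m m" and pd: "pd_mat m (fmi n x X)"
  shows "\<exists>w \<in> np_solutions_trunc m z W n. w x = X"
proof -
  have Im1: "Im x \<noteq> 0" using x_up by auto
  interpret E: nodes m "z(Suc n := x)" "W(Suc n := X)" by (rule extended_nodes[OF Im1 ne_x(2) X])
  have "0 < Im ((z(Suc n := x)) j)" if "1 \<le> j" for j using z_up[OF that] x_up by auto
  from E.pick_solution_exists[OF extended_pick(2)[OF Im1 ne_x(2) X pd] this]
  obtain w where w: "w \<in> nevanlinna_class m" "\<forall>j. 1 \<le> j \<and> j \<le> Suc n \<longrightarrow> w ((z(Suc n := x)) j) = (W(Suc n := X)) j" by blast
  have "w x = X" using w(2)[rule_format, of "Suc n"] by simp
  moreover have "w (z j) = W j" if "1 \<le> j" "j \<le> n" for j using w(2)[rule_format, of j] that by auto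
  ultimately show ?thesis using w(1) unfolding np_solutions_trunc_def by blast
qed

text \<open>Interpolation conditions that hold eventually along a sequence survive in a limit function, even if they are not met from the start.\<close>

lemma limit_solution:
  assumes w: "\<And>k. w k \<in> nevanlinna_class m" "\<And>k. w k (z 1) = W 1"
    and lim: "\<And>a b. a < m \<Longrightarrow> b < m \<Longrightarrow> (\<lambda>k. w k x $$ (a, b)) \<longlonglongrightarrow> X $$ (a, b)" and X: "X \<in> carrier_mat m m"
  shows "\<exists>g \<in> nevanlinna_class m. g x = X \<and> (\<forall>j\<ge>1. (eventually (\<lambda>k. w k (z j) = W j) sequentially \<longrightarrow> g (z j) = W j))"
proof -
  have z1: "z 1 \<in> upper_half" using z_up[of 1] by (simp add: upper_half_def)
  obtain r g where r: "strict_mono (r :: nat \<Rightarrow> nat)" and g: "g \<in> nevanlinna_class m"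
    and conv: "\<And>y i k. y \<in> upper_half \<Longrightarrow> i < m \<Longrightarrow> k < m \<Longrightarrow> (\<lambda>n. w (r n) y $$ (i, k)) \<longlonglongrightarrow> g y $$ (i, k)"
  proof (rule nevanlinna_compact[OF w(1) z1 w(2)])
    fix r :: "nat \<Rightarrow> nat" and g
    assume "strict_mono r" "g \<in> nevanlinna_class m"
      "\<And>y i k. y \<in> upper_half \<Longrightarrow> i < m \<Longrightarrow> k < m \<Longrightarrow> (\<lambda>n. w (r n) y $$ (i, k)) \<longlonglongrightarrow> g y $$ (i, k)"
    then show thesis by (rule that)
  qed
  have gc: "g y \<in> carrier_mat m m" if "y \<in> upper_half" for y using g that by (simp add: nevanlinna_class_def)
  have xu: "x \<in> upper_half" using x_up by (simp add: upper_half_def)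
  have "g x = X"
  proof (rule eq_matI)
    fix i k assume "i < dim_row X" "k < dim_col X"
    then have ik: "i < m" "k < m" using X by auto
    show "g x $$ (i, k) = X $$ (i, k)"
      using LIMSEQ_unique[OF conv[OF xu ik] LIMSEQ_subseq_LIMSEQ[OF lim[OF ik] r, unfolded o_def]] .
  qed (use gc[OF xu] X in auto)
  moreover have "g (z j) = W j" if j: "1 \<le> j" and ev: "eventually (\<lambda>k. w k (z j) = W j) sequentially" for j
  proof (rule eq_matI)
    have zu: "z j \<in> upper_half" using z_up[OF j] by (simp add: upper_half_def)
    fix i k assume "i < dim_row (W j)" "k < dim_col (W j)"
    then have ik: "i < m" "k < m" using carrier_matD[OF W_carrier[OF j]] by auto
    have "eventually (\<lambda>n. w (r n) (z j) = W j) sequentially"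
      using ev r by (rule eventually_subseq[rotated])
    then have "eventually (\<lambda>n. w (r n) (z j) $$ (i, k) = W j $$ (i, k)) sequentially" by eventually_elim simp
    then have "(\<lambda>n. w (r n) (z j) $$ (i, k)) \<longlonglongrightarrow> W j $$ (i, k)" by (rule tendsto_eventually)
    then show "g (z j) $$ (i, k) = W j $$ (i, k)" using conv[OF zu ik] LIMSEQ_unique by blast
  qed (use gc[of "z j"] z_up[OF j] carrier_matD[OF W_carrier[OF j]] in \<open>auto simp: upper_half_def\<close>)
  ultimately show ?thesis using g by blast
qed

definition "kp = 1 / (x - cnj x)"

abbreviation "vm \<equiv> vf (cnj x)"
abbreviation "um \<equiv> uf (cnj x)"

lemma kp: "cnj kp = - kp" "- (kp * kp) = complex_of_real (1 / (4 * (Im x)\<^sup>2))" "kp * (x - cnj x) = 1"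
proof -
  have d: "x - cnj x = 2 * \<i> * of_real (Im x)" by (simp add: complex_eq_iff)
  have y: "complex_of_real (Im x) \<noteq> 0" using x_up by simp
  show "kp * (x - cnj x) = 1" unfolding kp_def using y by (simp add: d)
  show "cnj kp = - kp" unfolding kp_def d using y by (simp add: field_simps)
  show "- (kp * kp) = complex_of_real (1 / (4 * (Im x)\<^sup>2))" unfolding kp_def d using y by (simp add: field_simps power2_eq_square)
qed

lemma ev_product:
  assumes j: "1 \<le> j"
  shows "ev x j * ev (cnj x) j = kp * (x * ev x j - cnj x * ev (cnj x) j)"
proof -
  have n: "z j - x \<noteq> 0" "z j - cnj x \<noteq> 0" using ne_x[OF j] by auto
  have "x * ev x j - cnj x * ev (cnj x) j = (x - cnj x) * (ev x j * ev (cnj x) j)"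
  proof -
    have "x * (z j / (z j - x)) - cnj x * (z j / (z j - cnj x)) = (x * z j * (z j - cnj x) - cnj x * z j * (z j - x)) / ((z j - x) * (z j - cnj x))"
      unfolding times_divide_eq_right diff_frac_eq[OF n] ..
    also have "x * z j * (z j - cnj x) - cnj x * z j * (z j - x) = (x - cnj x) * (z j * z j)" by (simp add: algebra_simps)
    finally show ?thesis by (simp add: ev_def)
  qed
  then show ?thesis using kp(3) by (simp flip: mult.assoc)
qed

lemma smult_ev: "c \<cdot>\<^sub>m vf y j = (c * ev y j) \<cdot>\<^sub>m 1\<^sub>m m" "c \<cdot>\<^sub>m uf y j = (c * ev y j) \<cdot>\<^sub>m W j"
  by (simp_all add: vf_def uf_def mat_smult_smult)

text \<open>The product of the scalars at \<open>x\<close> and at \<open>cnj x\<close> is a combination of the two, which is the resolvent equation.\<close>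

lemma ev_combine:
  assumes j: "1 \<le> j"
  shows "ev (cnj x) j \<cdot>\<^sub>m vf x j = (kp * x) \<cdot>\<^sub>m vf x j - (kp * cnj x) \<cdot>\<^sub>m vm j"
    and "ev x j \<cdot>\<^sub>m vm j = (kp * x) \<cdot>\<^sub>m vf x j - (kp * cnj x) \<cdot>\<^sub>m vm j"
    and "ev x j \<cdot>\<^sub>m um j = (kp * x) \<cdot>\<^sub>m uf x j - (kp * cnj x) \<cdot>\<^sub>m um j"
proof -
  have e: "kp * x * ev x j - kp * cnj x * ev (cnj x) j = ev x j * ev (cnj x) j"
    unfolding ev_product[OF j] by (simp add: algebra_simps)
  have d: "s \<cdot>\<^sub>m M - t \<cdot>\<^sub>m M = (s - t) \<cdot>\<^sub>m M" for s t and M :: "complex mat"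
    by (intro eq_matI) (simp_all add: algebra_simps)
  show "ev (cnj x) j \<cdot>\<^sub>m vf x j = (kp * x) \<cdot>\<^sub>m vf x j - (kp * cnj x) \<cdot>\<^sub>m vm j"
    "ev x j \<cdot>\<^sub>m vm j = (kp * x) \<cdot>\<^sub>m vf x j - (kp * cnj x) \<cdot>\<^sub>m vm j"
    "ev x j \<cdot>\<^sub>m um j = (kp * x) \<cdot>\<^sub>m uf x j - (kp * cnj x) \<cdot>\<^sub>m um j"
    unfolding smult_ev d e by (simp_all only: mult.commute)
qed

text \<open>When \<open>ev x\<close> maps \<open>f\<close> into the span of \<open>f'\<close> and \<open>f\<close>, the intertwining relation applied to \<open>f\<close> and \<open>vf x\<close> turns into a relation between Gram matrices at \<open>x\<close> and at \<open>cnj x\<close>. It is used for \<open>f = vm\<close>, \<open>f' = vf x\<close> and for \<open>f = um\<close>, \<open>f' = uf x\<close>.\<close>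

lemma gram_identity:
  assumes f: "fam f" "fam f'" "\<And>j. 1 \<le> j \<Longrightarrow> ev x j \<cdot>\<^sub>m f j = (kp * x) \<cdot>\<^sub>m f' j - (kp * cnj x) \<cdot>\<^sub>m f j"
  shows "Gram n f vm * Gram n (uf x) (vf x) - Gram n f um * Gram n (vf x) (vf x)
    = kp \<cdot>\<^sub>m (Gram n f' (vf x) - Gram n f vm)"
proof -
  have ne: "\<And>j. 1 \<le> j \<Longrightarrow> z j \<noteq> cnj x" "\<And>j. 1 \<le> j \<Longrightarrow> z j \<noteq> cnj (cnj x)" using ne_x by auto
  note it = intertwine_resolvent[OF ne, simplified]
  have x0: "cnj x \<noteq> 0" using x_up by auto
  have main: "Gram n f (\<lambda>j. ev (cnj x) j \<cdot>\<^sub>m vf x j) = Gram n (\<lambda>j. cnj (cnj (ev x j)) \<cdot>\<^sub>m f j) (vf x)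
     + Gram n f (\<lambda>j. cnj x \<cdot>\<^sub>m vm j) * Gram n (uf x) (vf x) - Gram n f (\<lambda>j. cnj x \<cdot>\<^sub>m um j) * Gram n (vf x) (vf x)"
    by (rule Gram_intertwine[OF it]) (simp_all add: fam_smult f(1))
  have lhs: "Gram n f (\<lambda>j. ev (cnj x) j \<cdot>\<^sub>m vf x j) = (kp * x) \<cdot>\<^sub>m Gram n f (vf x) - (kp * cnj x) \<cdot>\<^sub>m Gram n f vm"
  proof -
    have "Gram n f (\<lambda>j. ev (cnj x) j \<cdot>\<^sub>m vf x j) = Gram n f (\<lambda>j. (kp * x) \<cdot>\<^sub>m vf x j - (kp * cnj x) \<cdot>\<^sub>m vm j)"
      by (rule Gram_cong) (simp_all only: ev_combine(1))
    then show ?thesis by (simp add: Gram_diff_right fam_smult Gram_smult_right)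
  qed
  have rhs: "Gram n (\<lambda>j. cnj (cnj (ev x j)) \<cdot>\<^sub>m f j) (vf x)
      = (- kp * cnj x) \<cdot>\<^sub>m Gram n f' (vf x) - (- kp * x) \<cdot>\<^sub>m Gram n f (vf x)"
  proof -
    have "Gram n (\<lambda>j. cnj (cnj (ev x j)) \<cdot>\<^sub>m f j) (vf x) = Gram n (\<lambda>j. (kp * x) \<cdot>\<^sub>m f' j - (kp * cnj x) \<cdot>\<^sub>m f j) (vf x)"
      by (rule Gram_cong) (simp_all only: f(3) complex_cnj_cnj)
    then show ?thesis by (simp add: Gram_diff_left fam_smult Gram_smult_left f(1,2) kp(1))
  qed
  define T1 where "T1 = Gram n f vm * Gram n (uf x) (vf x)"
  define T2 where "T2 = Gram n f um * Gram n (vf x) (vf x)"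
  have T: "T1 \<in> carrier_mat m m" "T2 \<in> carrier_mat m m"
    unfolding T1_def T2_def by (rule mult_carrier_mat[OF Gram_carrier Gram_carrier])+
  have "(kp * x) \<cdot>\<^sub>m Gram n f (vf x) - (kp * cnj x) \<cdot>\<^sub>m Gram n f vm
     = ((- kp * cnj x) \<cdot>\<^sub>m Gram n f' (vf x) - (- kp * x) \<cdot>\<^sub>m Gram n f (vf x)) + cnj x \<cdot>\<^sub>m T1 - cnj x \<cdot>\<^sub>m T2"
    using main unfolding lhs rhs T1_def T2_def by (simp add: Gram_smult_right mat_smult_mult)
  note eq = this
  show ?thesis
    unfolding T1_def[symmetric] T2_def[symmetric]
  proof (rule eq_matI)
    fix a b assume "a < dim_row (kp \<cdot>\<^sub>m (Gram n f' (vf x) - Gram n f vm))" "b < dim_col (kp \<cdot>\<^sub>m (Gram n f' (vf x) - Gram n f vm))"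
    then have ab: "a < m" "b < m" by simp_all
    have "kp * x * Gram n f (vf x) $$ (a, b) - kp * cnj x * Gram n f vm $$ (a, b)
      = (- kp * cnj x * Gram n f' (vf x) $$ (a, b) - (- kp * x * Gram n f (vf x) $$ (a, b))) + cnj x * T1 $$ (a, b) - cnj x * T2 $$ (a, b)"
      using arg_cong[OF eq, of "\<lambda>M. M $$ (a, b)"] ab T by simp
    then have "cnj x * (T1 $$ (a, b) - T2 $$ (a, b)) = cnj x * (kp * (Gram n f' (vf x) $$ (a, b) - Gram n f vm $$ (a, b)))"
      by (simp add: algebra_simps)
    then have "T1 $$ (a, b) - T2 $$ (a, b) = kp * (Gram n f' (vf x) $$ (a, b) - Gram n f vm $$ (a, b))"
      using x0 by simp
    then show "(T1 - T2) $$ (a, b) = (kp \<cdot>\<^sub>m (Gram n f' (vf x) - Gram n f vm)) $$ (a, b)" using ab T by simp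
  qed (use T in auto)
qed

text \<open>The constant term that is left after completing the square.\<close>

definition "left_radius_sq n = (Gram n um vm - kp \<cdot>\<^sub>m 1\<^sub>m m) * minv (Gram n vm vm) * (Gram n vm um + kp \<cdot>\<^sub>m 1\<^sub>m m) - Gram n um um"

text \<open>The two relations of \<open>gram_identity\<close> eliminate \<open>Gram n um um\<close> and the mixed forms, so that the left semi-radius is governed by the point \<open>x\<close> and the right one by \<open>cnj x\<close>.\<close>

lemma left_radius_sq_inverse:
  assumes A: "pd_mat m (Gram n vm vm)"
  shows "left_radius_sq n * Gram n (vf x) (vf x) = (- (kp * kp)) \<cdot>\<^sub>m 1\<^sub>m m"
proof -
  define A N Na U A' N' where "A = Gram n vm vm" and "N = Gram n um vm" and "Na = Gram n vm um" and "U = Gram n um um"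
    and "A' = Gram n (vf x) (vf x)" and "N' = Gram n (uf x) (vf x)"
  note defs = A_def N_def Na_def U_def A'_def N'_def
  have I: "A * N' - Na * A' = kp \<cdot>\<^sub>m (A' - A)" "N * N' - U * A' = kp \<cdot>\<^sub>m (N' - N)"
    unfolding defs by (rule gram_identity; simp add: ev_combine)+
  have c: "A \<in> carrier_mat m m" "N \<in> carrier_mat m m" "Na \<in> carrier_mat m m" "U \<in> carrier_mat m m" "A' \<in> carrier_mat m m" "N' \<in> carrier_mat m m"
    by (simp_all add: defs)
  note Ai = minv_works[OF c(1) pd_det[OF assms[folded A_def]]]
  note d = c[THEN carrier_matD(1)] c[THEN carrier_matD(2)] Ai(1)[THEN carrier_matD(1)] Ai(1)[THEN carrier_matD(2)]
  have s1: "(Na + kp \<cdot>\<^sub>m 1\<^sub>m m) * A' = A * (N' + kp \<cdot>\<^sub>m 1\<^sub>m m)"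
  proof -
    have "(Na + kp \<cdot>\<^sub>m 1\<^sub>m m) * A' = Na * A' + kp \<cdot>\<^sub>m A'" using d by (simp add: mat_expand)
    moreover have "A * (N' + kp \<cdot>\<^sub>m 1\<^sub>m m) = A * N' + kp \<cdot>\<^sub>m A"
      using d by (simp add: mat_expand right_mult_one_mat[OF c(1)])
    moreover have "Na * A' + kp \<cdot>\<^sub>m A' = A * N' + kp \<cdot>\<^sub>m A"
    proof (rule eq_matI)
      fix a b assume "a < dim_row (A * N' + kp \<cdot>\<^sub>m A)" "b < dim_col (A * N' + kp \<cdot>\<^sub>m A)"
      then have ab: "a < m" "b < m" using d by auto
      have "(A * N') $$ (a, b) - (Na * A') $$ (a, b) = kp * (A' $$ (a, b) - A $$ (a, b))"
        using arg_cong[OF I(1), of "\<lambda>M. M $$ (a, b)"] ab d by (simp del: index_mult_mat(1))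
      then show "(Na * A' + kp \<cdot>\<^sub>m A') $$ (a, b) = (A * N' + kp \<cdot>\<^sub>m A) $$ (a, b)"
        using ab d by (simp add: algebra_simps del: index_mult_mat(1))
    qed (use d in auto)
    ultimately show ?thesis by simp
  qed
  have "left_radius_sq n * A' = (N - kp \<cdot>\<^sub>m 1\<^sub>m m) * (minv A * ((Na + kp \<cdot>\<^sub>m 1\<^sub>m m) * A')) - U * A'"
    unfolding left_radius_sq_def defs[symmetric] using d by (simp add: mat_minus_mult mat_mult_assoc)
  also have "minv A * ((Na + kp \<cdot>\<^sub>m 1\<^sub>m m) * A') = N' + kp \<cdot>\<^sub>m 1\<^sub>m m"
    unfolding s1 using c by (intro minv_cancel(1)[OF c(1) pd_det[OF assms[folded A_def]], of _ m]) simp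
  also have "(N - kp \<cdot>\<^sub>m 1\<^sub>m m) * (N' + kp \<cdot>\<^sub>m 1\<^sub>m m) = N * N' + kp \<cdot>\<^sub>m N - (kp \<cdot>\<^sub>m N' + (kp * kp) \<cdot>\<^sub>m 1\<^sub>m m)"
    using d by (simp add: mat_expand right_mult_one_mat[OF c(2)])
      (rule eq_matI, simp_all add: algebra_simps del: index_mult_mat(1))
  also have "\<dots> - U * A' = (- (kp * kp)) \<cdot>\<^sub>m 1\<^sub>m m"
  proof (rule eq_matI)
    fix a b assume "a < dim_row ((- (kp * kp)) \<cdot>\<^sub>m 1\<^sub>m m :: complex mat)" "b < dim_col ((- (kp * kp)) \<cdot>\<^sub>m 1\<^sub>m m :: complex mat)"
    then have ab: "a < m" "b < m" by auto
    have "(N * N') $$ (a, b) - (U * A') $$ (a, b) = kp * (N' $$ (a, b) - N $$ (a, b))"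
      using arg_cong[OF I(2), of "\<lambda>M. M $$ (a, b)"] ab d by (simp del: index_mult_mat(1))
    then show "(N * N' + kp \<cdot>\<^sub>m N - (kp \<cdot>\<^sub>m N' + (kp * kp) \<cdot>\<^sub>m 1\<^sub>m m) - U * A') $$ (a, b) = ((- (kp * kp)) \<cdot>\<^sub>m 1\<^sub>m m) $$ (a, b)"
      using ab d by (simp add: algebra_simps del: index_mult_mat(1))
  qed (use d in auto)
  finally show ?thesis by (simp only: A'_def)
qed

lemma fmi_square:
  assumes A: "pd_mat m (Gram n vm vm)" and X: "X \<in> carrier_mat m m"
  defines "c \<equiv> (Gram n um vm - kp \<cdot>\<^sub>m 1\<^sub>m m) * minv (Gram n vm vm)"
  shows "fmi n x X = left_radius_sq n - (X - c) * Gram n vm vm * mat_adjoint (X - c)"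
proof -
  have Xa: "mat_adjoint X \<in> carrier_mat m m" using X by simp
  have "Gram n (dev x X) (dev x X) = Gram n um (dev x X) - X * Gram n vm (dev x X)"
    unfolding dev_def[of x X, abs_def] by (simp add: Gram_diff_left fam_mult[OF _ Xa] Gram_mult_left[OF _ Xa])
  also have "Gram n um (dev x X) = Gram n um um - Gram n um vm * mat_adjoint X"
    unfolding dev_def[of x X, abs_def] by (simp add: Gram_diff_right fam_mult[OF _ Xa] Gram_mult_right[OF _ Xa])
  also have "Gram n vm (dev x X) = Gram n vm um - Gram n vm vm * mat_adjoint X"
    unfolding dev_def[of x X, abs_def] by (simp add: Gram_diff_right fam_mult[OF _ Xa] Gram_mult_right[OF _ Xa])
  also have "Gram n um um - Gram n um vm * mat_adjoint X - X * (Gram n vm um - Gram n vm vm * mat_adjoint X)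
     = Gram n um um - Gram n um vm * mat_adjoint X - X * mat_adjoint (Gram n um vm) + X * Gram n vm vm * mat_adjoint X"
    using carrier_matD[OF X] by (simp add: Gram_adjoint mat_mult_minus mat_mult_assoc)
      (rule eq_matI, simp_all del: index_mult_mat(1))
  finally have g: "Gram n (dev x X) (dev x X)
     = Gram n um um - Gram n um vm * mat_adjoint X - X * mat_adjoint (Gram n um vm) + X * Gram n vm vm * mat_adjoint X" .
  note square = complete_square[OF A Gram_carrier[of n um vm] Gram_carrier[of n um um] X kp(1)]
  show ?thesis
    using square unfolding fmi_def g kp_def[symmetric] left_radius_sq_def c_def by (simp only: Gram_adjoint)
qed

end

section \<open>Limits of the Gram forms\<close>

context pd_nodes begin

text \<open>The block column of \<open>vf s\<close> is injective because its first block is a nonzero multiple of the identity.\<close>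

lemma Gram_vf_pd:
  assumes n: "1 \<le> n" and s: "z 1 \<noteq> s"
  shows "pd_mat m (Gram n (vf s) (vf s))"
proof -
  have "pd_mat m (mat_adjoint (coln m n (vf s)) * minv (Pm n) * coln m n (vf s))"
  proof (rule pd_congruence[OF pd_minv[OF pd_P] coln_carrier])
    fix v :: "complex vec" assume v: "v \<in> carrier_vec m" "v \<noteq> 0\<^sub>v m"
    show "coln m n (vf s) *\<^sub>v v \<noteq> 0\<^sub>v (n * m)"
    proof
      assume 0: "coln m n (vf s) *\<^sub>v v = 0\<^sub>v (n * m)"
      have "v $ a = 0" if a: "a < m" for a
      proof -
        have "1 * m \<le> n * m" using n by (rule mult_le_mono1)
        then have "m \<le> n * m" by (simp only: mult_1)
        with a have an: "a < n * m" by (rule less_le_trans)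
        have "0 = (coln m n (vf s) *\<^sub>v v) $ a" using 0 an by simp
        also have "\<dots> = (\<Sum>b<m. coln m n (vf s) $$ (a, b) * v $ b)"
          using an v by (subst mat_vec_index) auto
        also have "\<dots> = (\<Sum>b<m. if b = a then ev s 1 * v $ b else 0)"
          using an a by (intro sum.cong) (auto simp: coln_index vf_def)
        also have "\<dots> = ev s 1 * v $ a" using a by simp
        finally have "ev s 1 * v $ a = 0" ..
        moreover have "ev s 1 \<noteq> 0" using s z_nonzero[of 1] by (simp add: ev_def)
        ultimately show ?thesis by simp
      qed
      then show False using v by (metis carrier_vecD eq_vecI index_zero_vec)
    qed
  qed
  then show ?thesis unfolding Gram_def by (simp add: mat_mult_assoc)
qed

text \<open>The limit of the Gram forms for square summable families.\<close>

definition Gram_lim :: "(nat \<Rightarrow> complex mat) \<Rightarrow> (nat \<Rightarrow> complex mat) \<Rightarrow> complex mat" where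
  "Gram_lim f g = mat m m (\<lambda>(a, b). \<Sum>k. (mat_adjoint (hat k f) * hat k g) $$ (a, b))"

lemma Gram_lim_carrier [simp]: "Gram_lim f g \<in> carrier_mat m m"
  and dim_Gram_lim [simp]: "dim_row (Gram_lim f g) = m" "dim_col (Gram_lim f g) = m"
  by (simp_all add: Gram_lim_def)

lemma Gram_tendsto:
  assumes "fam f" "fam g" "l2 f" "l2 g" "a < m" "b < m"
  shows "(\<lambda>n. Gram n f g $$ (a, b)) \<longlonglongrightarrow> Gram_lim f g $$ (a, b)"
proof -
  have "(\<lambda>n. \<Sum>k<n. (mat_adjoint (hat k f) * hat k g) $$ (a, b)) \<longlonglongrightarrow> (\<Sum>k. (mat_adjoint (hat k f) * hat k g) $$ (a, b))"
    by (rule summable_LIMSEQ[OF l2_gram_summable[OF assms]])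
  then show ?thesis unfolding Gram_entry[OF assms(1,2,5,6)] using assms(5,6) by (simp add: Gram_lim_def)
qed

lemma Gram_mono: assumes "fam f" shows "psd_mat m (Gram (n + k) f f - Gram n f f)"
proof (induction k)
  case 0
  have e: "Gram n f f - Gram n f f = 0\<^sub>m m m" by (intro eq_matI) simp_all
  show ?case unfolding add_0_right e by (rule psd_zero)
next
  case (Suc k)
  have "psd_mat m ((Gram (n + k) f f - Gram n f f) + mat_adjoint (hat (n + k) f) * hat (n + k) f)"
    by (rule psd_add[OF Suc psd_gram[OF hat_carrier[OF assms]]])
  also have "(Gram (n + k) f f - Gram n f f) + mat_adjoint (hat (n + k) f) * hat (n + k) f = Gram (n + Suc k) f f - Gram n f f"
    unfolding add_Suc_right Gram_Suc[OF assms assms]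
    by (intro eq_matI) (simp_all add: dim_hat[OF assms] del: index_mult_mat(1))
  finally show ?case .
qed

lemma Gram_lim_Gram_psd:
  assumes "fam f" "l2 f"
  shows "psd_mat m (Gram_lim f f - Gram n f f)"
proof (rule psd_limit[where F = sequentially and A = "\<lambda>k. Gram (n + k) f f - Gram n f f"])
  show "(\<lambda>k. (Gram (n + k) f f - Gram n f f) $$ (i, j)) \<longlonglongrightarrow> (Gram_lim f f - Gram n f f) $$ (i, j)" if "i < m" "j < m" for i j
  proof -
    have "(\<lambda>k. Gram (k + n) f f $$ (i, j)) \<longlonglongrightarrow> Gram_lim f f $$ (i, j)"
      by (rule LIMSEQ_ignore_initial_segment[OF Gram_tendsto[OF assms(1,1,2,2) that]])
    then have "(\<lambda>k. Gram (n + k) f f $$ (i, j) - Gram n f f $$ (i, j)) \<longlonglongrightarrow> Gram_lim f f $$ (i, j) - Gram n f f $$ (i, j)"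
      by (intro tendsto_diff tendsto_const) (simp add: add.commute)
    then show ?thesis using that by simp
  qed
  show "Gram_lim f f - Gram n f f \<in> carrier_mat m m" by (intro minus_carrier_mat) simp
qed (simp_all add: Gram_mono[OF assms(1)])

lemma Gram_lim_pd:
  assumes "l2 (vf s)" "z 1 \<noteq> s"
  shows "pd_mat m (Gram_lim (vf s) (vf s))"
proof -
  have "pd_mat m (Gram 1 (vf s) (vf s) + (Gram_lim (vf s) (vf s) - Gram 1 (vf s) (vf s)))"
    by (rule pd_psd_add[OF Gram_vf_pd[OF _ assms(2)] Gram_lim_Gram_psd[OF fam_vf assms(1)]]) simp
  then show ?thesis by (simp add: mat_add_minus_cancel)
qed

end

context np_point begin

section \<open>The balls of the truncated problems\<close>

definition "four_im_sq = complex_of_real (4 * (Im x)\<^sup>2)"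
definition "center n = (Gram n um vm - kp \<cdot>\<^sub>m 1\<^sub>m m) * minv (Gram n vm vm)"
definition "left_radius n = inv_sqrt_mat m (four_im_sq \<cdot>\<^sub>m Gram n (vf x) (vf x))"
definition "right_radius n = inv_sqrt_mat m (Gram n vm vm)"

lemma Gram_pd: assumes "1 \<le> n" shows "pd_mat m (Gram n vm vm)" "pd_mat m (four_im_sq \<cdot>\<^sub>m Gram n (vf x) (vf x))"
  using Gram_vf_pd[OF assms ne_x(2)[of 1]] pd_smult[OF Gram_vf_pd[OF assms ne_x(1)[of 1]], of "4 * (Im x)\<^sup>2"] x_up
  by (simp_all add: four_im_sq_def)

lemma left_radius_sq_eq: assumes "1 \<le> n" shows "left_radius_sq n = minv (four_im_sq \<cdot>\<^sub>m Gram n (vf x) (vf x))"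
proof -
  note pd = Gram_pd[OF assms]
  have c: "left_radius_sq n \<in> carrier_mat m m" unfolding left_radius_sq_def by (intro minus_carrier_mat) simp
  have yk: "four_im_sq * - (kp * kp) = 1" unfolding kp(2) four_im_sq_def using x_up by simp
  have "left_radius_sq n * (four_im_sq \<cdot>\<^sub>m Gram n (vf x) (vf x)) = four_im_sq \<cdot>\<^sub>m (left_radius_sq n * Gram n (vf x) (vf x))"
    using c by (simp add: mat_mult_smult)
  also have "\<dots> = 1\<^sub>m m" unfolding left_radius_sq_inverse[OF pd(1)] mat_smult_smult yk by (intro eq_matI) simp_all
  finally have "left_radius_sq n * (four_im_sq \<cdot>\<^sub>m Gram n (vf x) (vf x)) = 1\<^sub>m m" .
  from mat_mult_left_right_inverse[OF c _ this] have "(four_im_sq \<cdot>\<^sub>m Gram n (vf x) (vf x)) * left_radius_sq n = 1\<^sub>m m" by simp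
  then show ?thesis using c by (intro minv_eqI[symmetric, of _ m]) simp_all
qed

lemma center_carrier: assumes "1 \<le> n" shows "center n \<in> carrier_mat m m"
proof -
  have "Gram n um vm - kp \<cdot>\<^sub>m 1\<^sub>m m \<in> carrier_mat m m" by (intro minus_carrier_mat) simp
  then show ?thesis unfolding center_def
    using minv_carrier[OF pd_carrier[OF Gram_pd(1)[OF assms]] pd_det[OF Gram_pd(1)[OF assms]]] by simp
qed

lemma trunc_ball_data: assumes n: "1 \<le> n" shows "ball_data m (Gram n vm vm) (left_radius_sq n) (center n) (left_radius n) (right_radius n)"
proof
  show "pd_mat m (Gram n vm vm)" by (rule Gram_pd(1)[OF n])
  show "pd_mat m (left_radius n)" "pd_mat m (right_radius n)"
    unfolding left_radius_def right_radius_def by (rule inv_sqrt_pd[OF Gram_pd(2)[OF n]], rule inv_sqrt_pd[OF Gram_pd(1)[OF n]])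
  show "center n \<in> carrier_mat m m" by (rule center_carrier[OF n])
  show "left_radius n * left_radius n = left_radius_sq n" unfolding left_radius_sq_eq[OF n] left_radius_def by (rule inv_sqrt_square[OF Gram_pd(2)[OF n]])
  show "right_radius n * right_radius n = minv (Gram n vm vm)" unfolding right_radius_def by (rule inv_sqrt_square[OF Gram_pd(1)[OF n]])
qed

text \<open>Points \<open>c + t r V \<rho>\<close> with \<open>t < 1\<close> satisfy the strict inequality and are values of rational solutions. A point of the ball itself is a limit of such points, and the solutions accumulate.\<close>

theorem trunc_ball:
  assumes n: "1 \<le> n"
  shows "(\<lambda>w. w x) ` np_solutions_trunc m z W n = matrix_ball m (center n) (left_radius n) (right_radius n)"
proof -
  interpret B: ball_data m "Gram n vm vm" "left_radius_sq n" "center n" "left_radius n" "right_radius n" by (rule trunc_ball_data[OF n])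
  note sq = fmi_square[OF Gram_pd(1)[OF n], folded center_def]
  show ?thesis
  proof (intro equalityI subsetI)
    fix X assume "X \<in> (\<lambda>w. w x) ` np_solutions_trunc m z W n"
    then obtain w where w: "w \<in> np_solutions_trunc m z W n" "X = w x" by blast
    note s = solution_fmi[OF w(1), folded w(2)]
    show "X \<in> matrix_ball m (center n) (left_radius n) (right_radius n)"
      by (rule B.in_ballI[OF s(3)]) (use s(1) sq[OF s(3)] in simp)
  next
    fix X assume "X \<in> matrix_ball m (center n) (left_radius n) (right_radius n)"
    then obtain V where V: "V \<in> carrier_mat m m" "psd_mat m (1\<^sub>m m - mat_adjoint V * V)"
      and X: "X = center n + left_radius n * V * right_radius n" unfolding matrix_ball_def by blast
    define t where "t k = 1 - inverse (real (Suc k))" for k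
    have t: "0 \<le> t k" "t k < 1" for k unfolding t_def by (simp_all add: inverse_eq_divide)
    define Y where "Y k = center n + left_radius n * (complex_of_real (t k) \<cdot>\<^sub>m V) * right_radius n" for k
    note d = B.dims V(1)[THEN carrier_matD(1)] V(1)[THEN carrier_matD(2)]
    have Yc: "Y k \<in> carrier_mat m m" for k unfolding Y_def by (intro carrier_matI) (simp_all add: d)
    have Xc: "X \<in> carrier_mat m m" unfolding X by (intro carrier_matI) (simp_all add: d)
    have "\<exists>w \<in> np_solutions_trunc m z W n. w x = Y k" for k
      by (rule fmi_solution[OF Yc]) (unfold sq[OF Yc], rule B.ball_interior[OF V t Y_def])
    then obtain w where w: "\<And>k. w k \<in> np_solutions_trunc m z W n" "\<And>k. w k x = Y k" by metis
    have wn: "w k \<in> nevanlinna_class m" "1 \<le> j \<Longrightarrow> j \<le> n \<Longrightarrow> w k (z j) = W j" for j k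
      using w(1)[of k] unfolding np_solutions_trunc_def by auto
    have tl: "t \<longlonglongrightarrow> 1"
      unfolding t_def using tendsto_diff[OF tendsto_const LIMSEQ_inverse_real_of_nat, of 1] by simp
    have conv: "(\<lambda>k. w k x $$ (a, b)) \<longlonglongrightarrow> X $$ (a, b)" if ab: "a < m" "b < m" for a b
    proof -
      have e: "w k x $$ (a, b) = center n $$ (a, b) + of_real (t k) * (left_radius n * V * right_radius n) $$ (a, b)" for k
        unfolding w(2) Y_def using ab d by (simp add: mat_expand del: index_mult_mat(1))
      have "(\<lambda>k. center n $$ (a, b) + of_real (t k) * (left_radius n * V * right_radius n) $$ (a, b)) \<longlonglongrightarrow> center n $$ (a, b) + of_real 1 * (left_radius n * V * right_radius n) $$ (a, b)"
        by (intro tendsto_add tendsto_const tendsto_mult tendsto_of_real tl)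
      then show ?thesis unfolding e X using ab d by (simp del: index_mult_mat(1))
    qed
    obtain g where g: "g \<in> nevanlinna_class m" "g x = X"
      "\<forall>j\<ge>1. (eventually (\<lambda>k. w k (z j) = W j) sequentially \<longrightarrow> g (z j) = W j)"
      using limit_solution[OF wn(1) wn(2)[of 1] conv Xc] n by auto
    have "g \<in> np_solutions_trunc m z W n"
      unfolding np_solutions_trunc_def using g(1,3) wn(2) by simp
    then show "X \<in> (\<lambda>w. w x) ` np_solutions_trunc m z W n" using g(2) by blast
  qed
qed

section \<open>Complete indeterminacy implies square summability\<close>

text \<open>The fundamental matrix inequality bounds the Gram forms of the deviation family uniformly in \<open>n\<close>.\<close>

lemma l2_dev:
  assumes X: "X \<in> carrier_mat m m" and psd: "\<And>n. psd_mat m (fmi n s X)"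
  shows "l2 (dev s X)"
proof (rule l2_if_bounded[OF fam_dev[OF X]])
  fix n
  show "(\<Sum>a<m. Re (Gram n (dev s X) (dev s X) $$ (a, a)))
      \<le> (\<Sum>a<m. Re (((1 / (s - cnj s)) \<cdot>\<^sub>m (X - mat_adjoint X)) $$ (a, a)))"
  proof (rule sum_mono)
    fix a assume "a \<in> {..<m}"
    then have a: "a < m" by simp
    have "0 \<le> Re (fmi n s X $$ (a, a))" by (rule psd_diag[OF psd a])
    then show "Re (Gram n (dev s X) (dev s X) $$ (a, a)) \<le> Re (((1 / (s - cnj s)) \<cdot>\<^sub>m (X - mat_adjoint X)) $$ (a, a))"
      unfolding fmi_def using a carrier_matD[OF X] by simp
  qed
qed

text \<open>The deviation families for \<open>X\<close> and \<open>Y\<close> differ by \<open>v (X - Y)\<^sup>*\<close>, so that invertibility of \<open>X - Y\<close> isolates \<open>v\<close>; then \<open>u\<close> follows.\<close>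

lemma l2_two_values:
  assumes X: "X \<in> carrier_mat m m" "\<And>n. psd_mat m (fmi n s X)"
    and Y: "Y \<in> carrier_mat m m" "\<And>n. psd_mat m (fmi n s Y)"
    and det: "det (X - Y) \<noteq> 0"
  shows "l2 (vf (cnj s))" "l2 (uf (cnj s))"
proof -
  let ?q = "vf (cnj s)"
  define D where "D = mat_adjoint (X - Y)"
  have XY: "X - Y \<in> carrier_mat m m" using Y(1) by (rule minus_carrier_mat)
  have D: "D \<in> carrier_mat m m" "det D \<noteq> 0"
    unfolding D_def using XY det_adjoint_nonzero[OF XY det] by simp_all
  note Di = minv_works[OF D]
  have dd: "l2 (\<lambda>j. dev s Y j - dev s X j)"
    by (rule l2_diff[OF fam_dev[OF Y(1)] fam_dev[OF X(1)] l2_dev[OF Y] l2_dev[OF X]])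
  have e: "dev s Y j - dev s X j = ?q j * D" if j: "1 \<le> j" for j
  proof -
    note d = carrier_matD[OF X(1)] carrier_matD[OF Y(1)] carrier_matD[OF famD[OF fam_vf[of "cnj s"] j]] carrier_matD[OF famD[OF fam_uf[of "cnj s"] j]]
    have "?q j * D = ?q j * mat_adjoint X - ?q j * mat_adjoint Y"
      unfolding D_def using d by (simp add: mat_adjoint_minus mat_mult_minus)
    then show ?thesis unfolding dev_def using d by (intro eq_matI) (simp_all del: index_mult_mat(1))
  qed
  have "l2 (\<lambda>j. ?q j * D)" using dd l2_cong[OF e] by simp
  then have "l2 (\<lambda>j. (?q j * D) * minv D)" by (rule l2_mult[OF fam_mult[OF fam_vf D(1)] Di(1)])
  moreover have "(?q j * D) * minv D = ?q j" if j: "1 \<le> j" for j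
  proof -
    note q = famD[OF fam_vf[of "cnj s"] j]
    have "(?q j * D) * minv D = ?q j * (D * minv D)" by (rule assoc_mult_mat[OF q D(1) Di(1)])
    then show ?thesis using q by (simp add: Di)
  qed
  ultimately show q2: "l2 ?q" using l2_cong[of "\<lambda>j. (?q j * D) * minv D" ?q] by simp
  have mX: "- mat_adjoint X \<in> carrier_mat m m" using X(1) by simp
  have "l2 (\<lambda>j. dev s X j - ?q j * (- mat_adjoint X))"
    by (rule l2_diff[OF fam_dev[OF X(1)] fam_mult[OF fam_vf mX] l2_dev[OF X] l2_mult[OF fam_vf mX q2]])
  moreover have "dev s X j - ?q j * (- mat_adjoint X) = uf (cnj s) j" if j: "1 \<le> j" for j
  proof -
    note d = carrier_matD[OF X(1)] carrier_matD[OF famD[OF fam_vf[of "cnj s"] j]] carrier_matD[OF famD[OF fam_uf[of "cnj s"] j]]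
    show ?thesis unfolding dev_def using d by (intro eq_matI) (simp_all del: index_mult_mat(1))
  qed
  ultimately show "l2 (uf (cnj s))" using l2_cong[of "\<lambda>j. dev s X j - ?q j * (- mat_adjoint X)" "uf (cnj s)"] by simp
qed

text \<open>The parameters \<open>V = 0\<close> and \<open>V = 1\<close> give two points of the ball that differ by the invertible matrix \<open>r \<rho>\<close>.\<close>

theorem indeterminate_imp_l2:
  assumes "completely_indeterminate_at m z W x"
  shows "l2 (vf x)" "l2 (uf x)" "l2 (vf (cnj x))" "l2 (uf (cnj x))"
proof -
  obtain c r \<rho> where ball: "limit_ball_data m z W x c r \<rho>" and rank: "vec_space.rank m r = m" "vec_space.rank m \<rho> = m"
    using assms unfolding completely_indeterminate_at_def by blast
  have c: "c \<in> carrier_mat m m" "r \<in> carrier_mat m m" "\<rho> \<in> carrier_mat m m"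
    and vals: "(\<lambda>w. w x) ` np_solutions m z W = matrix_ball m c r \<rho>"
    using ball unfolding limit_ball_data_def by (auto intro: psd_carrier)
  note d = c[THEN carrier_matD(1)] c[THEN carrier_matD(2)]
  have dets: "det r \<noteq> 0" "det \<rho> \<noteq> 0"
    using vec_space.det_rank_iff[OF c(2)] vec_space.det_rank_iff[OF c(3)] rank by auto
  have "psd_mat m (1\<^sub>m m - mat_adjoint (0\<^sub>m m m) * 0\<^sub>m m m)"
  proof -
    have "mat_adjoint (0\<^sub>m m m) * 0\<^sub>m m m = (0\<^sub>m m m :: complex mat)" by (rule right_mult_zero_mat[of _ m m]) simp
    then have "1\<^sub>m m - mat_adjoint (0\<^sub>m m m) * 0\<^sub>m m m = (1\<^sub>m m :: complex mat)" by (intro eq_matI) simp_all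
    then show ?thesis using pd_imp_psd[OF pd_one] by simp
  qed
  from matrix_ballI[OF zero_carrier_mat this, of c r \<rho>]
  have "c + r * 0\<^sub>m m m * \<rho> \<in> (\<lambda>w. w x) ` np_solutions m z W" unfolding vals .
  then obtain w1 where w1: "w1 \<in> np_solutions m z W" "c + r * 0\<^sub>m m m * \<rho> = w1 x" by (rule imageE)
  have "psd_mat m (1\<^sub>m m - mat_adjoint (1\<^sub>m m) * 1\<^sub>m m)"
  proof -
    have e: "1\<^sub>m m - mat_adjoint (1\<^sub>m m) * 1\<^sub>m m = (0\<^sub>m m m :: complex mat)" by (intro eq_matI) simp_all
    show ?thesis unfolding e by (rule psd_zero)
  qed
  from matrix_ballI[OF one_carrier_mat this, of c r \<rho>]
  have "c + r * 1\<^sub>m m * \<rho> \<in> (\<lambda>w. w x) ` np_solutions m z W" unfolding vals .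
  then obtain w2 where w2: "w2 \<in> np_solutions m z W" "c + r * 1\<^sub>m m * \<rho> = w2 x" by (rule imageE)
  have trunc: "w \<in> np_solutions_trunc m z W n" if "w \<in> np_solutions m z W" for w n
    using that unfolding np_solutions_def np_solutions_trunc_def by auto
  note s1 = solution_fmi[OF trunc[OF w1(1)]] and s2 = solution_fmi[OF trunc[OF w2(1)]]
  have diff: "w2 x - w1 x = r * \<rho>"
    unfolding w1(2)[symmetric] w2(2)[symmetric] using c d by (intro eq_matI) (simp_all del: index_mult_mat(1))
  have det: "det (w2 x - w1 x) \<noteq> 0" unfolding diff using det_mult[OF c(2,3)] dets by simp
  have det': "det (mat_adjoint (w2 x) - mat_adjoint (w1 x)) \<noteq> 0"
  proof -
    have "mat_adjoint (w2 x) - mat_adjoint (w1 x) = mat_adjoint (w2 x - w1 x)"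
      using carrier_matD[OF s1(3)] carrier_matD[OF s2(3)] by (simp add: mat_adjoint_minus)
    moreover have "w2 x - w1 x \<in> carrier_mat m m" using s1(3) by (rule minus_carrier_mat)
    ultimately show ?thesis using det_adjoint_nonzero[OF _ det] by simp
  qed
  show "l2 (vf (cnj x))" "l2 (uf (cnj x))"
    by (rule l2_two_values[OF s2(3,1) s1(3,1) det])+
  have a: "mat_adjoint (w1 x) \<in> carrier_mat m m" "mat_adjoint (w2 x) \<in> carrier_mat m m" using s1(3) s2(3) by simp_all
  show "l2 (vf x)" "l2 (uf x)"
    using l2_two_values[OF a(2) s2(2) a(1) s1(2) det'] by simp_all
qed

section \<open>Square summability implies complete indeterminacy\<close>

text \<open>The limits \<open>A\<close> and \<open>A'\<close> of the matrices that define the semi-radii are positive definite, so that inversion and roots are continuous there. A point of the limit ball satisfies the limit inequality; since \<open>fmi n x X\<close> decreases in \<open>n\<close>, it belongs to all truncated balls, and a limit of truncated solutions solves the full problem.\<close>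

theorem l2_imp_indeterminate:
  assumes l2: "l2 (vf x)" "l2 (uf x)" "l2 (vf (cnj x))" "l2 (uf (cnj x))"
  shows "completely_indeterminate_at m z W x"
proof -
  define A where "A = Gram_lim vm vm"
  define A' where "A' = four_im_sq \<cdot>\<^sub>m Gram_lim (vf x) (vf x)"
  define R2 where "R2 = minv A'"
  define c where "c = (Gram_lim um vm - kp \<cdot>\<^sub>m 1\<^sub>m m) * minv A"
  define r where "r = inv_sqrt_mat m A'"
  define \<rho> where "\<rho> = inv_sqrt_mat m A"
  have A: "pd_mat m A" unfolding A_def by (rule Gram_lim_pd[OF l2(3) ne_x(2)]) (rule order_refl)
  have A': "pd_mat m A'"
    unfolding A'_def four_im_sq_def
  proof (rule pd_smult)
    show "pd_mat m (Gram_lim (vf x) (vf x))" by (rule Gram_lim_pd[OF l2(1) ne_x(1)]) (rule order_refl)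
    show "0 < 4 * (Im x)\<^sup>2" using x_up by simp
  qed
  have Lc: "Gram_lim um vm - kp \<cdot>\<^sub>m 1\<^sub>m m \<in> carrier_mat m m" "Gram n um vm - kp \<cdot>\<^sub>m 1\<^sub>m m \<in> carrier_mat m m" for n
    by (rule minus_carrier_mat, rule smult_carrier_mat, rule one_carrier_mat)+
  have cc: "c \<in> carrier_mat m m" unfolding c_def
    by (rule mult_carrier_mat[OF Lc(1) minv_carrier[OF pd_carrier[OF A] pd_det[OF A]]])
  have R2c: "R2 \<in> carrier_mat m m" unfolding R2_def by (rule minv_carrier[OF pd_carrier[OF A'] pd_det[OF A']])
  have n1: "1 \<le> Suc n" for n by simp
  (* Limits are taken from the first node on, because Gram 0 is not invertible. *)
  have limA: "(\<lambda>n. Gram (Suc n) vm vm $$ (a, b)) \<longlonglongrightarrow> A $$ (a, b)" if "a < m" "b < m" for a b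
    unfolding A_def by (rule LIMSEQ_Suc[OF Gram_tendsto[OF fam_vf fam_vf l2(3,3) that]])
  have limA': "(\<lambda>n. (four_im_sq \<cdot>\<^sub>m Gram (Suc n) (vf x) (vf x)) $$ (a, b)) \<longlonglongrightarrow> A' $$ (a, b)" if "a < m" "b < m" for a b
  proof -
    have "(\<lambda>n. four_im_sq * Gram (Suc n) (vf x) (vf x) $$ (a, b)) \<longlonglongrightarrow> four_im_sq * Gram_lim (vf x) (vf x) $$ (a, b)"
      by (intro tendsto_mult tendsto_const LIMSEQ_Suc[OF Gram_tendsto[OF fam_vf fam_vf l2(1,1) that]])
    then show ?thesis unfolding A'_def using that by simp
  qed
  have limc: "(\<lambda>n. center (Suc n) $$ (a, b)) \<longlonglongrightarrow> c $$ (a, b)" if "a < m" "b < m" for a b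
    unfolding center_def c_def
  proof (rule mult_tendsto[OF Lc(2) minv_carrier[OF pd_carrier[OF Gram_pd(1)[OF n1]] pd_det[OF Gram_pd(1)[OF n1]]] Lc(1)
        minv_carrier[OF pd_carrier[OF A] pd_det[OF A]] _ _ that])
    fix i j assume ij: "i < m" "j < m"
    have "(\<lambda>n. Gram (Suc n) um vm $$ (i, j) - (kp \<cdot>\<^sub>m 1\<^sub>m m) $$ (i, j)) \<longlonglongrightarrow> Gram_lim um vm $$ (i, j) - (kp \<cdot>\<^sub>m 1\<^sub>m m) $$ (i, j)"
      by (intro tendsto_diff tendsto_const LIMSEQ_Suc[OF Gram_tendsto[OF fam_uf fam_vf l2(4,3) ij]])
    then show "(\<lambda>n. (Gram (Suc n) um vm - kp \<cdot>\<^sub>m 1\<^sub>m m) $$ (i, j)) \<longlonglongrightarrow> (Gram_lim um vm - kp \<cdot>\<^sub>m 1\<^sub>m m) $$ (i, j)"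
      using ij by simp
    show "(\<lambda>n. minv (Gram (Suc n) vm vm) $$ (i, j)) \<longlonglongrightarrow> minv A $$ (i, j)"
      by (rule minv_tendsto[OF pd_carrier[OF Gram_pd(1)[OF n1]] pd_carrier[OF A] pd_det[OF A] pd_det[OF Gram_pd(1)[OF n1]] limA ij])
  qed
  have limr: "(\<lambda>n. left_radius (Suc n) $$ (a, b)) \<longlonglongrightarrow> r $$ (a, b)" if "a < m" "b < m" for a b
    unfolding left_radius_def r_def by (rule inv_sqrt_tendsto[OF Gram_pd(2)[OF n1] A' limA' that])
  have lim\<rho>: "(\<lambda>n. right_radius (Suc n) $$ (a, b)) \<longlonglongrightarrow> \<rho> $$ (a, b)" if "a < m" "b < m" for a b
    unfolding right_radius_def \<rho>_def by (rule inv_sqrt_tendsto[OF Gram_pd(1)[OF n1] A limA that])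
  have limR: "(\<lambda>n. left_radius_sq (Suc n) $$ (a, b)) \<longlonglongrightarrow> R2 $$ (a, b)" if "a < m" "b < m" for a b
    unfolding left_radius_sq_eq[OF n1] R2_def
    by (rule minv_tendsto[OF pd_carrier[OF Gram_pd(2)[OF n1]] pd_carrier[OF A'] pd_det[OF A'] pd_det[OF Gram_pd(2)[OF n1]] limA' that])
  interpret B: ball_data m A R2 c r \<rho>
    by unfold_locales (simp_all add: A cc r_def \<rho>_def R2_def inv_sqrt_pd[OF A] inv_sqrt_pd[OF A'] inv_sqrt_square[OF A] inv_sqrt_square[OF A'])
  define Q where "Q X = R2 - (X - c) * A * mat_adjoint (X - c)" for X
  have fmi_lim: "(\<lambda>n. fmi (Suc n) x X $$ (a, b)) \<longlonglongrightarrow> Q X $$ (a, b)"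
    if X: "X \<in> carrier_mat m m" and ab: "a < m" "b < m" for X a b
  proof -
    have Xc: "X - center (Suc n) \<in> carrier_mat m m" "X - c \<in> carrier_mat m m" for n
      using center_carrier[OF n1] cc by (auto intro!: minus_carrier_mat)
    have Xl: "(\<lambda>n. (X - center (Suc n)) $$ (i, j)) \<longlonglongrightarrow> (X - c) $$ (i, j)" if ij: "i < m" "j < m" for i j
    proof -
      have "(\<lambda>n. X $$ (i, j) - center (Suc n) $$ (i, j)) \<longlonglongrightarrow> X $$ (i, j) - c $$ (i, j)"
        by (intro tendsto_diff tendsto_const limc ij)
      then show ?thesis using ij carrier_matD[OF center_carrier[OF n1]] carrier_matD[OF cc] by simp
    qed
    have Xal: "(\<lambda>n. mat_adjoint (X - center (Suc n)) $$ (i, j)) \<longlonglongrightarrow> mat_adjoint (X - c) $$ (i, j)" if ij: "i < m" "j < m" for i j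
    proof -
      have e: "mat_adjoint M $$ (i, j) = cnj (M $$ (j, i))" if "M \<in> carrier_mat m m" for M :: "complex mat"
        using ij carrier_matD[OF that] by simp
      show ?thesis unfolding e[OF Xc(1)] e[OF Xc(2)] by (intro tendsto_cnj Xl ij)
    qed
    have prod: "(\<lambda>n. ((X - center (Suc n)) * Gram (Suc n) vm vm * mat_adjoint (X - center (Suc n))) $$ (a, b))
        \<longlonglongrightarrow> ((X - c) * A * mat_adjoint (X - c)) $$ (a, b)"
    proof (rule mult_tendsto[where ?n1.0 = m and ?n2.0 = m and ?n3.0 = m])
      show "(\<lambda>n. ((X - center (Suc n)) * Gram (Suc n) vm vm) $$ (i, j)) \<longlonglongrightarrow> ((X - c) * A) $$ (i, j)" if "i < m" "j < m" for i j
        by (rule mult_tendsto[OF Xc(1) Gram_carrier Xc(2) pd_carrier[OF A] Xl limA that])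
      show "(X - center (Suc n)) * Gram (Suc n) vm vm \<in> carrier_mat m m" for n by (rule mult_carrier_mat[OF Xc(1) Gram_carrier])
      show "(X - c) * A \<in> carrier_mat m m" by (rule mult_carrier_mat[OF Xc(2) pd_carrier[OF A]])
    qed (use Xc Xal ab in simp_all)
    have "(\<lambda>n. left_radius_sq (Suc n) $$ (a, b) - ((X - center (Suc n)) * Gram (Suc n) vm vm * mat_adjoint (X - center (Suc n))) $$ (a, b))
       \<longlonglongrightarrow> R2 $$ (a, b) - ((X - c) * A * mat_adjoint (X - c)) $$ (a, b)"
      by (intro tendsto_diff limR prod ab)
    then show ?thesis
      unfolding fmi_square[OF Gram_pd(1)[OF n1] X, folded center_def] Q_def
      using ab carrier_matD[OF Xc(1)] carrier_matD[OF Xc(2)] by (simp del: index_mult_mat(1))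
  qed
  have Qc: "Q X \<in> carrier_mat m m" if "X \<in> carrier_mat m m" for X
  proof -
    have "X - c \<in> carrier_mat m m" using cc by (rule minus_carrier_mat)
    then show ?thesis unfolding Q_def
      using carrier_matD[OF cc] carrier_matD[OF R2c] carrier_matD[OF pd_carrier[OF A]] by (intro carrier_matI) simp_all
  qed
  have fmi_c: "fmi n x X \<in> carrier_mat m m" for n X unfolding fmi_def by (intro minus_carrier_mat) simp
  have fmi_Q: "psd_mat m (fmi (Suc n) x X - Q X)" if X: "X \<in> carrier_mat m m" for n X
  proof (rule psd_limit[where F = sequentially and A = "\<lambda>k. Gram (Suc n + k) (dev x X) (dev x X) - Gram (Suc n) (dev x X) (dev x X)"])
    show "psd_mat m (Gram (Suc n + k) (dev x X) (dev x X) - Gram (Suc n) (dev x X) (dev x X))" for k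
      by (rule Gram_mono[OF fam_dev[OF X]])
    show "fmi (Suc n) x X - Q X \<in> carrier_mat m m" using Qc[OF X] by (rule minus_carrier_mat)
    fix i j assume ij: "i < m" "j < m"
    have "(\<lambda>k. fmi (Suc n) x X $$ (i, j) - fmi (Suc (k + n)) x X $$ (i, j)) \<longlonglongrightarrow> fmi (Suc n) x X $$ (i, j) - Q X $$ (i, j)"
      by (intro tendsto_diff tendsto_const LIMSEQ_ignore_initial_segment[OF fmi_lim[OF X ij]])
    then show "(\<lambda>k. (Gram (Suc n + k) (dev x X) (dev x X) - Gram (Suc n) (dev x X) (dev x X)) $$ (i, j)) \<longlonglongrightarrow> (fmi (Suc n) x X - Q X) $$ (i, j)"
      using ij carrier_matD[OF Qc[OF X]] carrier_matD[OF X] by (simp add: fmi_def add.commute)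
  qed simp
  have vals: "(\<lambda>w. w x) ` np_solutions m z W = matrix_ball m c r \<rho>"
  proof (intro equalityI subsetI)
    fix X assume "X \<in> (\<lambda>w. w x) ` np_solutions m z W"
    then obtain w where w: "w \<in> np_solutions m z W" "X = w x" by blast
    have "w \<in> np_solutions_trunc m z W n" for n
      using w(1) unfolding np_solutions_def np_solutions_trunc_def by auto
    note s = solution_fmi[OF this, folded w(2)]
    have "psd_mat m (Q X)"
      by (rule psd_limit[where F = sequentially and A = "\<lambda>n. fmi (Suc n) x X"]) (simp_all add: s(1) Qc[OF s(3)] fmi_lim[OF s(3)])
    then show "X \<in> matrix_ball m c r \<rho>" unfolding Q_def by (rule B.in_ballI[OF s(3)])
  next
    fix X assume X: "X \<in> matrix_ball m c r \<rho>"
    have Xc: "X \<in> carrier_mat m m"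
      using X unfolding matrix_ball_def by (auto simp: B.dims intro!: carrier_matI)
    have Q: "psd_mat m (Q X)" unfolding Q_def by (rule B.ball_member[OF X])
    have "\<exists>w \<in> np_solutions_trunc m z W (Suc n). w x = X" for n
    proof -
      have "psd_mat m (Q X + (fmi (Suc n) x X - Q X))" by (rule psd_add[OF Q fmi_Q[OF Xc]])
      then have "psd_mat m (fmi (Suc n) x X)"
        using carrier_matD[OF Qc[OF Xc]] carrier_matD[OF fmi_c] by (simp add: mat_add_minus_cancel)
      then have "X \<in> matrix_ball m (center (Suc n)) (left_radius (Suc n)) (right_radius (Suc n))"
        unfolding fmi_square[OF Gram_pd(1)[OF n1] Xc, folded center_def] by (rule ball_data.in_ballI[OF trunc_ball_data[OF n1] Xc])
      then show ?thesis unfolding trunc_ball[OF n1, symmetric] by auto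
    qed
    then obtain w where w: "\<And>n. w n \<in> np_solutions_trunc m z W (Suc n)" "\<And>n. w n x = X" by metis
    have wn: "w k \<in> nevanlinna_class m" "1 \<le> j \<Longrightarrow> j \<le> Suc k \<Longrightarrow> w k (z j) = W j" for j k
      using w(1)[of k] unfolding np_solutions_trunc_def by auto
    have "eventually (\<lambda>k. w k (z j) = W j) sequentially" if "1 \<le> j" for j
      using eventually_ge_at_top[of j] by eventually_elim (use wn(2)[OF that] in simp)
    moreover obtain g where "g \<in> nevanlinna_class m" "g x = X"
      "\<forall>j\<ge>1. (eventually (\<lambda>k. w k (z j) = W j) sequentially \<longrightarrow> g (z j) = W j)"
      using limit_solution[of w X, OF wn(1) wn(2)[of 1] _ Xc] w(2) by auto
    ultimately have "g \<in> np_solutions m z W" "g x = X" unfolding np_solutions_def by auto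
    then show "X \<in> (\<lambda>w. w x) ` np_solutions m z W" by blast
  qed
  have tend: "mat_tendsto m center c" "mat_tendsto m left_radius r" "mat_tendsto m right_radius \<rho>"
    unfolding mat_tendsto_def by (intro allI impI, rule LIMSEQ_imp_Suc, rule limc limr lim\<rho>, assumption+)+
  have trunc: "center n \<in> carrier_mat m m \<and> pd_mat m (left_radius n) \<and> pd_mat m (right_radius n) \<and>
      (\<lambda>w. w x) ` np_solutions_trunc m z W n = matrix_ball m (center n) (left_radius n) (right_radius n)" if n: "1 \<le> n" for n
  proof -
    interpret C: ball_data m "Gram n vm vm" "left_radius_sq n" "center n" "left_radius n" "right_radius n" by (rule trunc_ball_data[OF n])
    show ?thesis by (intro conjI C.c C.r C.\<rho> trunc_ball[OF n])
  qed
  have "limit_ball_data m z W x c r \<rho>"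
    unfolding limit_ball_data_def
    by (intro conjI cc pd_imp_psd[OF B.r] pd_imp_psd[OF B.\<rho>] vals,
        rule exI[of _ center], rule exI[of _ left_radius], rule exI[of _ right_radius], intro conjI allI impI tend trunc)
  moreover have "vec_space.rank m r = m" "vec_space.rank m \<rho> = m"
    using vec_space.det_rank_iff[OF B.carr(2)] vec_space.det_rank_iff[OF B.carr(3)] pd_det[OF B.r] pd_det[OF B.\<rho>] by auto
  ultimately show ?thesis unfolding completely_indeterminate_at_def by blast
qed

end

section \<open>Complete indeterminacy in terms of the origin\<close>

text \<open>All but finitely many terms exceed \<open>1/2\<close> in modulus.\<close>

lemma nonzero_bounded_below:
  fixes g :: "nat \<Rightarrow> complex"
  assumes lim: "g \<longlonglongrightarrow> 1" and nz: "\<And>j. 1 \<le> j \<Longrightarrow> g j \<noteq> 0"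
  shows "\<exists>\<delta>. 0 < \<delta> \<and> (\<forall>j\<ge>1. \<delta> \<le> cmod (g j))"
proof -
  have "(\<lambda>j. cmod (g j)) \<longlonglongrightarrow> 1" using tendsto_norm[OF lim] by simp
  then have "eventually (\<lambda>j. 1/2 < cmod (g j)) sequentially" by (rule order_tendstoD(1)) simp
  then obtain N where N: "\<And>j. N \<le> j \<Longrightarrow> 1/2 < cmod (g j)" by (auto simp: eventually_sequentially)
  define \<delta> where "\<delta> = Min (insert (1/2) ((\<lambda>j. cmod (g j)) ` {1..N}))"
  have "0 < \<delta>" unfolding \<delta>_def using nz by (subst Min_gr_iff) auto
  moreover have "\<delta> \<le> cmod (g j)" if "1 \<le> j" for j
  proof (cases "j \<le> N")
    case True
    then show ?thesis unfolding \<delta>_def using that by (intro Min_le) auto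
  next
    case False
    have "\<delta> \<le> 1/2" unfolding \<delta>_def by (intro Min_le) auto
    then show ?thesis using N[of j] False by simp
  qed
  ultimately show ?thesis by blast
qed

context np_point begin

text \<open>The scalars \<open>1 - x / z\<^sub>j\<close> and their inverses tend to \<open>1\<close> and do not vanish, so that they stay away from \<open>0\<close>.\<close>

theorem indeterminate_iff_l2_origin:
  assumes zlim: "filterlim z at_infinity sequentially"
  shows "completely_indeterminate_at m z W x \<longleftrightarrow> l2 (vf 0) \<and> l2 (uf 0)"
proof
  have inv: "(\<lambda>j. 1 - s / z j) \<longlonglongrightarrow> 1" for s
    using tendsto_diff[OF tendsto_const tendsto_divide_0[OF tendsto_const zlim], of 1 s] by simp
  have low: "\<exists>\<delta>. 0 < \<delta> \<and> (\<forall>j\<ge>1. \<delta> \<le> cmod (1 - s / z j))" if ne: "\<And>j. 1 \<le> j \<Longrightarrow> z j \<noteq> s" for s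
  proof -
    have nz: "1 - s / z j \<noteq> 0" if j: "1 \<le> j" for j
    proof
      assume "1 - s / z j = 0"
      then have "s = z j" using z_nonzero[OF j] by (simp add: divide_eq_1_iff)
      then show False using ne[OF j] by simp
    qed
    show ?thesis by (rule nonzero_bounded_below[OF inv nz])
  qed
  {
    assume "completely_indeterminate_at m z W x"
    note L = indeterminate_imp_l2[OF this]
    have evq: "1 / (1 - x / z j) = ev x j" if "1 \<le> j" for j
      using z_nonzero[OF that] ne_x(1)[OF that] by (simp add: ev_def field_simps)
    have "(\<lambda>j. 1 / (1 - x / z j)) \<longlonglongrightarrow> 1 / 1" by (intro tendsto_divide tendsto_const inv) simp
    then have lim: "(\<lambda>j. 1 / (1 - x / z j)) \<longlonglongrightarrow> 1" by simp
    have nz: "1 / (1 - x / z j) \<noteq> 0" if "1 \<le> j" for j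
      unfolding evq[OF that] using z_nonzero[OF that] ne_x(1)[OF that] by (simp add: ev_def)
    obtain \<delta> where \<delta>: "0 < \<delta>" "\<And>j. 1 \<le> j \<Longrightarrow> \<delta> \<le> cmod (1 / (1 - x / z j))"
      using nonzero_bounded_below[OF lim nz] by blast
    show "l2 (vf 0) \<and> l2 (uf 0)"
      using l2_to_origin[OF L ne_x \<delta>(1)] \<delta>(2) evq by simp
  }
  assume O: "l2 (vf 0) \<and> l2 (uf 0)"
  obtain \<delta> where \<delta>: "0 < \<delta>" "\<And>j. 1 \<le> j \<Longrightarrow> \<delta> \<le> cmod (1 - x / z j)" using low[of x] ne_x(1) by blast
  obtain \<delta>' where \<delta>': "0 < \<delta>'" "\<And>j. 1 \<le> j \<Longrightarrow> \<delta>' \<le> cmod (1 - cnj x / z j)" using low[of "cnj x"] ne_x(2) by blast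
  show "completely_indeterminate_at m z W x"
    using O by (intro l2_imp_indeterminate l2_from_origin[OF _ _ \<delta>] l2_from_origin[OF _ _ \<delta>']) auto
qed

end

section \<open>The two matrix series\<close>

context pd_nodes begin

lemma P_series: "mat_series_converges m (\<lambda>j. mat_adjoint (P_fun m z W j 0) * P_fun m z W j 0) \<longleftrightarrow> l2 (vf 0)"
proof -
  have "mat_series_converges m (\<lambda>j. mat_adjoint (P_fun m z W j 0) * P_fun m z W j 0) \<longleftrightarrow> l2 (\<lambda>_. 1\<^sub>m m)"
    unfolding mat_series_converges_def P_fun_0 by (rule series_converges_iff_l2[OF fam_one])
  also have "\<dots> \<longleftrightarrow> l2 (vf 0)" by (rule l2_cong) (simp add: smult_one_mat vf_def ev_def z_nonzero)
  finally show ?thesis .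
qed

lemma Q_series: "mat_series_converges m (\<lambda>j. mat_adjoint (Q_fun m z W j 0) * Q_fun m z W j 0) \<longleftrightarrow> l2 (uf 0)"
proof -
  have e: "mat_adjoint (- hat n W) * (- hat n W) = mat_adjoint (hat n W) * hat n W" for n
    using dim_hat[OF fam_W, of n] by (simp add: mat_adjoint_uminus)
  have "mat_series_converges m (\<lambda>j. mat_adjoint (Q_fun m z W j 0) * Q_fun m z W j 0) \<longleftrightarrow> l2 W"
    unfolding mat_series_converges_def Q_fun_0 e by (rule series_converges_iff_l2[OF fam_W])
  also have "\<dots> \<longleftrightarrow> l2 (uf 0)" by (rule l2_cong) (simp add: smult_one_mat uf_def ev_def z_nonzero)
  finally show ?thesis .
qed

end

theorem theorem7p3:
  fixes m :: nat and y :: "nat \<Rightarrow> real" and z :: "nat \<Rightarrow> complex"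
    and W :: "nat \<Rightarrow> complex mat" and z0 :: complex
  assumes "m \<ge> 1"
    and "\<And>j. j \<ge> 1 \<Longrightarrow> z j = \<i> * complex_of_real (y j)"
    and "\<And>j. j \<ge> 1 \<Longrightarrow> y j > 0"
    and "\<And>j. j \<ge> 1 \<Longrightarrow> y (j + 1) > y j"
    and "filterlim y at_top sequentially"
    and "\<And>j. j \<ge> 1 \<Longrightarrow> W j \<in> carrier_mat m m"
    and "\<And>n. n \<ge> 1 \<Longrightarrow> pd_mat (n * m) (pick_mat m z W n)"
    and "z0 \<in> upper_half - z ` {1..}"
  shows "completely_indeterminate_at m z W z0 \<longleftrightarrow>
    mat_series_converges m (\<lambda>j. mat_adjoint (P_fun m z W j 0) * P_fun m z W j 0) \<and>
    mat_series_converges m (\<lambda>j. mat_adjoint (Q_fun m z W j 0) * Q_fun m z W j 0)"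
proof -
  interpret np_point m z W z0
  proof unfold_locales
    show "0 < Im (z j)" if "1 \<le> j" for j using assms(2,3)[OF that] by simp
    show "z j \<noteq> 0" if "1 \<le> j" for j using assms(2,3)[OF that] by simp
    show "z j \<noteq> cnj (z k)" if "1 \<le> j" "1 \<le> k" for j k
      using assms(2,3)[OF that(1)] assms(2,3)[OF that(2)] by (simp add: complex_eq_iff)
    show "z j \<noteq> z0" if "1 \<le> j" for j using assms(8) that by auto
    show "0 < Im z0" using assms(8) by (simp add: upper_half_def)
  qed (use assms(6,7) in auto)
  have "filterlim z at_infinity sequentially"
  proof (rule filterlim_norm_at_top_imp_at_infinity)
    have "eventually (\<lambda>j. y j = norm (z j)) sequentially"
      using eventually_ge_at_top[of 1]
    proof eventually_elim
      fix j :: nat assume "1 \<le> j"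
      then show "y j = norm (z j)" using assms(2,3)[of j] by (simp add: norm_mult)
    qed
    then show "filterlim (\<lambda>j. norm (z j)) at_top sequentially"
      using assms(5) filterlim_cong by fast
  qed
  from indeterminate_iff_l2_origin[OF this] show ?thesis unfolding P_series Q_series .
qed

end
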